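(* (Positive mass theorem for graphs.) Let $2\le k<\frac n2$, let $V=\cosh r$ on $\mathbb H^n$, and let $f:\mathbb H^n\to\mathbb R$ be a smooth function. Let $(\mathcal M^n,g)=(\mathbb H^n,\,b+V^2df\otimes df)$ be its graph, and assume that $(\mathcal M^n,g)$ is asymptotically hyperbolic of decay order $\tau>\frac n{k+1}$ and that $V\tilde L_k$ is integrable. Then the Gauss-Bonnet-Chern mass satisfies $$m_k^{\mathbb H}=c(n,k)\int_{\mathcal M^n}\frac12\,\frac{V\tilde L_k}{\sqrt{1+V^2|\bar\nabla f|^2}}\,dV_g .$$ In particular, $\tilde L_k\ge0$ implies $m_k^{\mathbb H}\ge0$.
   Context: Hyperbolic space: $(\mathbb H^n,b)$, $b=dr^2+\sinh^2r\,d\Theta^2$, $d\Theta^2$ the round metric on $\mathbb S^{n-1}$, $r$ the distance to a fixed point $x_0$; $\bar\nabla$ and $|\cdot|$ are taken with respect to $b$. $\mathbb N_b=\{V\in C^\infty(\mathbb H^n):\mathrm{Hess}^bV=Vb\}$ is spanned by $V_{(0)}=\cosh r$, $V_{(i)}=x^i\sinh r$; $\eta$ is the Lorentz inner product on $\mathbb N_b$ for which these are orthogonal with $\eta(V_{(0)},V_{(0)})=1$, $\eta(V_{(i)},V_{(i)})=-1$. Asymptotically hyperbolic of decay order $\tau$ (with chart $\Phi:\mathcal M\setminus K\to\mathbb H^n\setminus B$, $K$ compact, $B$ a closed ball): $(\Phi^{-1})^*g$ and $b$ are uniformly equivalent on $\mathbb H^n\setminus B$ and $\|(\Phi^{-1})^*g-b\|_b+\|\bar\nabla((\Phi^{-1})^*g)\|_b+\|\bar\nabla^2((\Phi^{-1})^*g)\|_b=O(e^{-\tau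 r})$. For a graph, $\Phi$ is the identity (projection of the graph to $\mathbb H^n$), so $e=g-b=V^2df\otimes df$. Modified curvature: $\tilde R_{ijls}=R_{ijls}+g_{il}g_{js}-g_{is}g_{jl}$ (sign convention: constant curvature $c$ means $R_{ijls}=c(g_{il}g_{js}-g_{is}g_{jl})$). With $\delta^{j_1\cdots j_r}_{i_1\cdots i_r}=\det(\delta^{j_b}_{i_a})$ and indices raised by $g$, $\tilde L_k=\frac1{2^k}\delta^{i_1\cdots i_{2k}}_{j_1\cdots j_{2k}}\tilde R_{i_1i_2}{}^{j_1j_2}\cdots\tilde R_{i_{2k-1}i_{2k}}{}^{j_{2k-1}j_{2k}}$ and $\tilde P_{(k)}^{ijls}=\frac1{2^k}\delta^{i_1\cdots i_{2k-2}ij}_{j_1\cdots j_{2k-2}j_{2k-1}j_{2k}}\tilde R_{i_1i_2}{}^{j_1j_2}\cdots\tilde R_{i_{2k-3}i_{2k-2}}{}^{j_{2k-3}j_{2k-2}}g^{j_{2k-1}l}g^{j_{2k}s}$. Mass functional: for $V\in\mathbb N_b$, $H_k^\Phi(V)=\lim_{r\to\infty}\int_{S_r}(V\bar\nabla_se_{jl}-e_{jl}\bar\nabla_sV)\tilde P_{(k)}^{ijls}\nu_i\,d\mu$, with $S_r$ the $b$-geodesic sphere of radius $r$, $\nu$ its outward $b$-unit normal, $d\mu$ its $b$-area element. Gauss-Bonnet-Chern mass: $m_k^{\mathbb H}=c(n,k)\inf\{H_k^\Phi(V):V\in\mathbb N_b,\ V>0,\ \eta(V,V)=1\}$, $c(n,k)=\frac{(n-2k)!}{2^{k-1}(n-1)!\,\omega_{n-1}}$,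 $\omega_{n-1}$ the volume of the unit sphere $\mathbb S^{n-1}$. Standing convention: the infimum is assumed to be achieved by $V=V_{(0)}=\cosh r$, i.e. $m_k^{\mathbb H}=c(n,k)H_k^\Phi(\cosh r)$. *)

theory Defs
  imports "HOL-Analysis.Analysis" "HOL-Library.Landau_Symbols"
begin

section \<open>Calculus in a global chart\<close>

text \<open>
  Everything lives on one global chart \<open>real ^ 'n\<close>, with \<open>n = CARD('n)\<close>. A Riemannian metric is
  the matrix field of its components; a covariant tensor field of rank \<open>m\<close> is a function
  \<open>T :: real ^ 'n \<Rightarrow> 'n list \<Rightarrow> real\<close> of which only index lists of length \<open>m\<close> matter.
\<close>

definition pd :: "'n::finite \<Rightarrow> (real ^ 'n \<Rightarrow> real) \<Rightarrow> real ^ 'n \<Rightarrow> real" where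
  "pd i F x = frechet_derivative F (at x) (axis i 1)"

primrec Ck :: "nat \<Rightarrow> (real ^ 'n::finite \<Rightarrow> real) \<Rightarrow> bool" where
  "Ck 0 F = continuous_on UNIV F"
| "Ck (Suc m) F = ((\<forall>x. F differentiable (at x)) \<and> (\<forall>i. Ck m (pd i F)))"

definition smooth_fun :: "(real ^ 'n::finite \<Rightarrow> real) \<Rightarrow> bool" where
  "smooth_fun F \<longleftrightarrow> (\<forall>m. Ck m F)"

type_synonym 'n metric = "real ^ 'n \<Rightarrow> real ^ 'n ^ 'n"
type_synonym 'n tensor = "real ^ 'n \<Rightarrow> 'n list \<Rightarrow> real"

definition christoffel :: "'n::finite metric \<Rightarrow> 'n \<Rightarrow> 'n \<Rightarrow> 'n \<Rightarrow> real ^ 'n \<Rightarrow> real" where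
  "christoffel g m i j x =
     1 / 2 * (\<Sum>l\<in>UNIV. matrix_inv (g x) $ m $ l *
       (pd i (\<lambda>y. g y $ j $ l) x + pd j (\<lambda>y. g y $ i $ l) x - pd l (\<lambda>y. g y $ i $ j) x))"

text \<open>
  Covariant derivative for the Levi-Civita connection of \<open>g\<close>. The new index is put in front:
  \<open>cov_deriv g T x (s # is)\<close> is \<open>(\<nabla>\<^sub>s T)\<close> with the indices \<open>is\<close>.
\<close>

definition cov_deriv :: "'n::finite metric \<Rightarrow> 'n tensor \<Rightarrow> 'n tensor" where
  "cov_deriv g T x js = (case js of [] \<Rightarrow> 0 | s # is \<Rightarrow>
     pd s (\<lambda>y. T y is) x
     - (\<Sum>a<length is. \<Sum>m\<in>UNIV. christoffel g m s (is ! a) x * T x (is[a := m])))"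

definition tensor0 :: "(real ^ 'n::finite \<Rightarrow> real) \<Rightarrow> 'n tensor" where
  "tensor0 F x is = F x"

definition tensor2 :: "'n::finite metric \<Rightarrow> 'n tensor" where
  "tensor2 h x is = h x $ (is ! 0) $ (is ! 1)"

definition hessian :: "'n::finite metric \<Rightarrow> (real ^ 'n \<Rightarrow> real) \<Rightarrow> 'n tensor" where
  "hessian g F = cov_deriv g (cov_deriv g (tensor0 F))"

definition tensor_norm :: "'n::finite metric \<Rightarrow> nat \<Rightarrow> 'n tensor \<Rightarrow> real ^ 'n \<Rightarrow> real" where
  "tensor_norm g m T x = sqrt (\<Sum>is | length is = m. \<Sum>js | length js = m.
     (\<Prod>a<m. matrix_inv (g x) $ (is ! a) $ (js ! a)) * T x is * T x js)"

definition riem_vol :: "'n::finite metric \<Rightarrow> (real ^ 'n) measure" where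
  "riem_vol g = density lborel (\<lambda>x. ennreal (sqrt (det (g x))))"


section \<open>Curvature\<close>

text \<open>
  \<open>riem g i j l s = R\<^sub>i\<^sub>j\<^sub>l\<^sub>s = g(R(\<partial>\<^sub>i,\<partial>\<^sub>j)\<partial>\<^sub>s, \<partial>\<^sub>l)\<close> with
  \<open>R(X,Y)Z = \<nabla>\<^sub>X\<nabla>\<^sub>YZ - \<nabla>\<^sub>Y\<nabla>\<^sub>XZ - \<nabla>\<^bsub>[X,Y]\<^esub>Z\<close>: for constant curvature \<open>c\<close> this is
  \<open>c (g\<^sub>i\<^sub>l g\<^sub>j\<^sub>s - g\<^sub>i\<^sub>s g\<^sub>j\<^sub>l)\<close>.
\<close>

definition riem :: "'n::finite metric \<Rightarrow> 'n \<Rightarrow> 'n \<Rightarrow> 'n \<Rightarrow> 'n \<Rightarrow> real ^ 'n \<Rightarrow> real" where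
  "riem g i j l s x = (\<Sum>m\<in>UNIV. g x $ l $ m *
     (pd i (christoffel g m j s) x - pd j (christoffel g m i s) x
      + (\<Sum>p\<in>UNIV. christoffel g m i p x * christoffel g p j s x
                 - christoffel g m j p x * christoffel g p i s x)))"

definition mod_riem :: "'n::finite metric \<Rightarrow> 'n \<Rightarrow> 'n \<Rightarrow> 'n \<Rightarrow> 'n \<Rightarrow> real ^ 'n \<Rightarrow> real" where
  "mod_riem g i j l s x =
     riem g i j l s x + g x $ i $ l * g x $ j $ s - g x $ i $ s * g x $ j $ l"

text \<open>\<open>mod_riem_up g i j l s\<close> has \<open>i, j\<close> as lower and \<open>l, s\<close> as upper indices.\<close>

definition mod_riem_up :: "'n::finite metric \<Rightarrow> 'n \<Rightarrow> 'n \<Rightarrow> 'n \<Rightarrow> 'n \<Rightarrow> real ^ 'n \<Rightarrow> real" where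
  "mod_riem_up g i j l s x = (\<Sum>p\<in>UNIV. \<Sum>q\<in>UNIV.
     matrix_inv (g x) $ l $ p * matrix_inv (g x) $ s $ q * mod_riem g i j p q x)"

text \<open>
  The generalized Kronecker delta as the \<open>r \<times> r\<close> determinant \<open>det (\<delta>\<^bsub>I a, J b\<^esub>)\<close>. The size \<open>r\<close>
  is a number and not a type, so the Leibniz formula is written out.
  Indices are numbered from \<open>0\<close>.
\<close>

definition gen_delta :: "nat \<Rightarrow> (nat \<Rightarrow> 'n) \<Rightarrow> (nat \<Rightarrow> 'n) \<Rightarrow> real" where
  "gen_delta r I J =
     (\<Sum>p | p permutes {..<r}. of_int (sign p) * (\<Prod>a<r. if I a = J (p a) then 1 else 0))"

definition mod_L :: "nat \<Rightarrow> 'n::finite metric \<Rightarrow> real ^ 'n \<Rightarrow> real" where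
  "mod_L k g x = 1 / 2 ^ k *
     (\<Sum>I \<in> {..<2 * k} \<rightarrow>\<^sub>E UNIV. \<Sum>J \<in> {..<2 * k} \<rightarrow>\<^sub>E UNIV.
        gen_delta (2 * k) I J *
        (\<Prod>a<k. mod_riem_up g (I (2 * a)) (I (2 * a + 1)) (J (2 * a)) (J (2 * a + 1)) x))"

definition mod_P ::
  "nat \<Rightarrow> 'n::finite metric \<Rightarrow> 'n \<Rightarrow> 'n \<Rightarrow> 'n \<Rightarrow> 'n \<Rightarrow> real ^ 'n \<Rightarrow> real" where
  "mod_P k g i j l s x = 1 / 2 ^ k *
     (\<Sum>I \<in> {..<2 * k - 2} \<rightarrow>\<^sub>E UNIV. \<Sum>J \<in> {..<2 * k} \<rightarrow>\<^sub>E UNIV.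
        gen_delta (2 * k) (I(2 * k - 2 := i, 2 * k - 1 := j)) J *
        (\<Prod>a<k - 1. mod_riem_up g (I (2 * a)) (I (2 * a + 1)) (J (2 * a)) (J (2 * a + 1)) x) *
        matrix_inv (g x) $ (J (2 * k - 2)) $ l * matrix_inv (g x) $ (J (2 * k - 1)) $ s)"


section \<open>Hyperbolic space\<close>

text \<open>
  The global chart of hyperbolic space is \<open>y = sinh r \<cdot> \<theta>\<close>, with \<open>r\<close> the distance to the origin
  \<open>x\<^sub>0\<close> and \<open>\<theta>\<close> in the unit sphere (orthogonal projection of the hyperboloid model). Unlike
  polar coordinates, this chart covers the origin too. That the metric below is
  \<open>dr\<^sup>2 + sinh\<^sup>2 r d\<Theta>\<^sup>2\<close> is lemma \<open>hyp_metric_polar\<close>.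
\<close>

definition hyp_metric :: "'n::finite metric" where
  "hyp_metric y = (\<chi> i j. (if i = j then 1 else 0) - y $ i * y $ j / (1 + (norm y)\<^sup>2))"

definition hyp_r :: "real ^ 'n::finite \<Rightarrow> real" where
  "hyp_r y = arsinh (norm y)"

lemma hyp_metric_inner:
  "u \<bullet> (hyp_metric y *v v) = u \<bullet> v - (y \<bullet> u) * (y \<bullet> v) / (1 + (norm y)\<^sup>2)"
proof -
  have "hyp_metric y *v v = v - ((y \<bullet> v) / (1 + (norm y)\<^sup>2)) *\<^sub>R y"
  proof (simp add: vec_eq_iff, intro allI)
    fix i
    have "(hyp_metric y *v v) $ i =
        (\<Sum>j\<in>UNIV. (if i = j then v $ j else 0) - y $ j * v $ j * (y $ i / (1 + (norm y)\<^sup>2)))"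
      unfolding matrix_vector_mult_def hyp_metric_def
      by (simp, intro sum.cong) (auto simp: algebra_simps)
    also have "\<dots> = v $ i - (y \<bullet> v) * (y $ i / (1 + (norm y)\<^sup>2))"
      by (simp add: sum_subtractf inner_vec_def sum_distrib_right sum_divide_distrib)
    finally show "(hyp_metric y *v v) $ i = v $ i - (y \<bullet> v) * y $ i / (1 + (norm y)\<^sup>2)"
      by simp
  qed
  then show ?thesis
    by (simp add: inner_diff_right inner_commute)
qed

text \<open>
  At \<open>y = sinh r \<cdot> \<theta>\<close> the coordinate vector of \<open>a \<partial>\<^sub>r + w\<close>, with \<open>w\<close> tangent to the unit
  sphere at \<open>\<theta>\<close>, is \<open>a cosh r \<cdot> \<theta> + sinh r \<cdot> w\<close>.
\<close>

lemma hyp_metric_polar: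
  fixes \<theta> w w' :: "real ^ 'n::finite"
  assumes "norm \<theta> = 1" "\<theta> \<bullet> w = 0" "\<theta> \<bullet> w' = 0"
  shows "((a * cosh r) *\<^sub>R \<theta> + sinh r *\<^sub>R w) \<bullet>
           (hyp_metric (sinh r *\<^sub>R \<theta>) *v ((a' * cosh r) *\<^sub>R \<theta> + sinh r *\<^sub>R w'))
         = a * a' + (sinh r)\<^sup>2 * (w \<bullet> w')"
proof -
  have 1: "\<theta> \<bullet> \<theta> = 1" "w \<bullet> \<theta> = 0" "w' \<bullet> \<theta> = 0"
    using assms by (simp_all add: dot_square_norm inner_commute)
  have 2: "1 + (norm (sinh r *\<^sub>R \<theta>))\<^sup>2 = (cosh r)\<^sup>2"
    using assms(1) by (simp add: cosh_square_eq)
  have 3: "(a * cosh r) * (a' * cosh r) - (sinh r * (a * cosh r)) * (sinh r * (a' * cosh r)) / (cosh r)\<^sup>2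
      = a * a' * ((cosh r)\<^sup>2 - (sinh r)\<^sup>2)"
    by (simp add: field_simps power2_eq_square)
  show ?thesis
    unfolding hyp_metric_inner 2 using 3 1 assms
    by (simp add: inner_add_left inner_add_right hyperbolic_pythagoras power2_eq_square[of "sinh r"]
        algebra_simps cosh_square_eq)
qed

definition V0 :: "real ^ 'n::finite \<Rightarrow> real" where
  "V0 y = cosh (hyp_r y)"

text \<open>\<open>sgn y\<close> is \<open>\<theta>\<close>, so this is \<open>x\<^sup>i sinh r\<close> (which is just the coordinate \<open>y $ i\<close>).\<close>

definition Vi :: "'n::finite \<Rightarrow> real ^ 'n \<Rightarrow> real" where
  "Vi i y = sgn y $ i * sinh (hyp_r y)"

lemma Vi_eq: "Vi i y = y $ i"
  by (cases "y = 0") (simp_all add: Vi_def hyp_r_def sgn_div_norm)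

definition static_potentials :: "(real ^ 'n::finite \<Rightarrow> real) set" where
  "static_potentials = {V. smooth_fun V \<and>
     (\<forall>x i j. hessian hyp_metric V x [i, j] = V x * hyp_metric x $ i $ j)}"

definition lorentz :: "(real ^ 'n::finite \<Rightarrow> real) \<Rightarrow> (real ^ 'n \<Rightarrow> real) \<Rightarrow> real" where
  "lorentz V W = (THE c. \<exists>a0 b0 (a :: 'n \<Rightarrow> real) b.
      V = (\<lambda>x. a0 * V0 x + (\<Sum>i\<in>UNIV. a i * Vi i x)) \<and>
      W = (\<lambda>x. b0 * V0 x + (\<Sum>i\<in>UNIV. b i * Vi i x)) \<and>
      c = a0 * b0 - (\<Sum>i\<in>UNIV. a i * b i))"

text \<open>
  Asymptotic hyperbolicity with respect to the identity chart; the excised ball is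
  \<open>{r \<le> R}\<close>.
\<close>

definition asymp_hyperbolic :: "real \<Rightarrow> 'n::finite metric \<Rightarrow> bool" where
  "asymp_hyperbolic \<tau> g \<longleftrightarrow>
     (\<exists>R\<ge>0. \<exists>C\<ge>1. \<forall>x v. hyp_r x > R \<longrightarrow>
        1 / C * (v \<bullet> (hyp_metric x *v v)) \<le> v \<bullet> (g x *v v) \<and>
        v \<bullet> (g x *v v) \<le> C * (v \<bullet> (hyp_metric x *v v))) \<and>
     (\<lambda>x. tensor_norm hyp_metric 2 (tensor2 (\<lambda>y. g y - hyp_metric y)) x
        + tensor_norm hyp_metric 3 (cov_deriv hyp_metric (tensor2 g)) x
        + tensor_norm hyp_metric 4 (cov_deriv hyp_metric (cov_deriv hyp_metric (tensor2 g))) x)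
       \<in> O[at_infinity](\<lambda>x. exp (- \<tau> * hyp_r x))"


section \<open>Geodesic spheres and the mass\<close>

text \<open>
  The area measure of the round unit sphere, as the cone measure
  \<open>A \<mapsto> n \<cdot> vol {t \<theta> | 0 < t \<le> 1, \<theta> \<in> A}\<close>, i.e. the measure of integration in
  polar coordinates. It is a measure on the whole space, concentrated on the unit sphere.
\<close>

definition sphere_measure :: "(real ^ 'n::finite) measure" where
  "sphere_measure =
     density (distr (restrict_space lborel (cball 0 1)) borel sgn) (\<lambda>_. ennreal CARD('n))"

text \<open>By \<open>b = dr\<^sup>2 + sinh\<^sup>2 r d\<Theta>\<^sup>2\<close> the area element of \<open>S\<^sub>r\<close> is \<open>sinh\<^bsup>n-1\<^esup> r d\<Theta>\<close>.\<close>

definition geod_sphere_measure :: "real \<Rightarrow> (real ^ 'n::finite) measure" where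
  "geod_sphere_measure r =
     density (distr sphere_measure borel (\<lambda>\<theta>. sinh r *\<^sub>R \<theta>))
       (\<lambda>_. ennreal (sinh r ^ (CARD('n) - 1)))"

text \<open>
  The outward normal \<open>\<nu> = \<partial>\<^sub>r\<close> (a unit vector orthogonal to the spheres, by
  \<open>hyp_metric_polar\<close>) with its index lowered by \<open>b\<close>.
\<close>

definition normal_cov :: "'n::finite \<Rightarrow> real ^ 'n \<Rightarrow> real" where
  "normal_cov i x = (hyp_metric x *v (cosh (hyp_r x) *\<^sub>R sgn x)) $ i"

definition mass_flux ::
  "nat \<Rightarrow> 'n::finite metric \<Rightarrow> (real ^ 'n \<Rightarrow> real) \<Rightarrow> real \<Rightarrow> real" where
  "mass_flux k g V r = (let e = tensor2 (\<lambda>y. g y - hyp_metric y) in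
     (\<integral>x. (\<Sum>i\<in>UNIV. \<Sum>j\<in>UNIV. \<Sum>l\<in>UNIV. \<Sum>s\<in>UNIV.
        (V x * cov_deriv hyp_metric e x [s, j, l] - e x [j, l] * pd s V x)
        * mod_P k g i j l s x * normal_cov i x) \<partial>geod_sphere_measure r))"

definition mass_functional ::
  "nat \<Rightarrow> 'n::finite metric \<Rightarrow> (real ^ 'n \<Rightarrow> real) \<Rightarrow> real" where
  "mass_functional k g V = Lim at_top (mass_flux k g V)"

definition admissible_potentials :: "(real ^ 'n::finite \<Rightarrow> real) set" where
  "admissible_potentials =
     {V \<in> static_potentials. (\<forall>x. V x > 0) \<and> lorentz V V = 1}"

definition sphere_volume :: "'n::finite itself \<Rightarrow> real" where
  "sphere_volume _ = measure (sphere_measure :: (real ^ 'n) measure) (sphere 0 1)"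

definition mass_const :: "'n::finite itself \<Rightarrow> nat \<Rightarrow> real" where
  "mass_const N k =
     fact (CARD('n) - 2 * k) / (2 ^ (k - 1) * fact (CARD('n) - 1) * sphere_volume N)"

definition gbc_mass :: "nat \<Rightarrow> 'n::finite metric \<Rightarrow> real" where
  "gbc_mass k g = mass_const TYPE('n) k * (INF V\<in>admissible_potentials. mass_functional k g V)"

lemma sphere_volume_eq:
  "sphere_volume TYPE('n::finite) = CARD('n) * unit_ball_vol CARD('n)"
proof -
  let ?R = "restrict_space lborel (cball (0 :: real ^ 'n) 1)"
  have m[measurable]: "sgn \<in> measurable ?R borel"
    by (intro measurable_restrict_space1) (simp add: sgn_div_norm[abs_def])
  have sp: "sgn -` sphere 0 1 \<inter> cball 0 1 = cball (0 :: real ^ 'n) 1 - {0}"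
    by (auto simp: norm_sgn split: if_splits)
  have "emeasure (distr ?R borel sgn) (sphere 0 1) = emeasure ?R (cball 0 1 - {0})"
    by (simp add: emeasure_distr space_restrict_space sp)
  also have "\<dots> = emeasure lborel (cball (0 :: real ^ 'n) 1 - {0})"
    by (rule emeasure_restrict_space) auto
  also have "\<dots> = emeasure lborel (cball (0 :: real ^ 'n) 1)"
    by (rule emeasure_Diff_null_set) (auto simp: null_sets_def)
  also have "\<dots> = ennreal (unit_ball_vol CARD('n))"
    by (simp add: emeasure_cball)
  finally have "emeasure (sphere_measure :: (real ^ 'n) measure) (sphere 0 1)
      = ennreal (CARD('n) * unit_ball_vol CARD('n))"
    by (simp add: sphere_measure_def emeasure_density_const ennreal_mult)
  then show ?thesis
    by (simp add: sphere_volume_def measure_def)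
qed


section \<open>Graphs over hyperbolic space\<close>

definition graph_metric :: "(real ^ 'n::finite \<Rightarrow> real) \<Rightarrow> 'n metric" where
  "graph_metric f x = (\<chi> i j. hyp_metric x $ i $ j + (V0 x)\<^sup>2 * pd i f x * pd j f x)"

definition hyp_grad_sq :: "(real ^ 'n::finite \<Rightarrow> real) \<Rightarrow> real ^ 'n \<Rightarrow> real" where
  "hyp_grad_sq f x =
     (\<Sum>i\<in>UNIV. \<Sum>j\<in>UNIV. matrix_inv (hyp_metric x) $ i $ j * pd i f x * pd j f x)"

end

theory Submission
  imports Defs
begin

text \<open>
  The graph embeds isometrically into the hyperboloid in Minkowski space by
  \<open>X(y) = (V cosh f, V sinh f, y)\<close>. In the chart \<open>y\<close> the \<open>y\<close>-components \<open>a\<^sup>m\<close> of (minus)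
  its unit normal satisfy \<open>\<Gamma>\<^sup>m\<^sub>i\<^sub>j = a\<^sup>m h\<^sub>i\<^sub>j - y\<^sup>m g\<^sub>i\<^sub>j\<close>, and the shape operator is the flat Jacobian
  \<open>\<partial>\<^sub>j a\<^sup>m\<close>. So the Codazzi equation is the symmetry of second partial derivatives, and by the Gauss
  equation the modified curvature with two raised indices is a \<open>2 \<times> 2\<close> minor of this Jacobian.
  Hence \<open>L\<^sub>k\<close> is a sum of minors of a Jacobian, a null Lagrangian: the Euclidean divergence of
  the vector field obtained by replacing one factor \<open>\<partial>\<^sub>j a\<^sup>m\<close> by \<open>a\<^sup>m\<close>.
  Since \<open>e = V\<^sup>2 df \<otimes> df\<close>, the mass integrand is half the normal component of the same field, so
  the flux through every geodesic sphere is exactly half the Euclidean integral of \<open>L\<^sub>k\<close> over the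
  ball. Finally \<open>V / sqrt (1 + V\<^sup>2 |df|\<^sup>2) dV\<^sub>g\<close> is Lebesgue measure in this chart.
\<close>

section \<open>Partial derivatives and smooth functions\<close>

text \<open>The coordinates \<open>y\<close> are linear on Minkowski space, and this makes the shape
  operator a flat Jacobian. The Gauss formula is
  \<open>d_i d_j X = Gamma^m_ij d_m X + h_ij N + g_ij X\<close>, the last term being due to the
  hyperboloid. The \<open>y\<close>-components of \<open>X\<close> have zero second derivatives, so
  this part of the formula can be solved for \<open>Gamma\<close>, with \<open>a = - N\<close>. The
  Weingarten equation \<open>d_j N = - S^m_j d_m X\<close> has no component along \<open>X\<close>,
  and its \<open>y\<close>-part is \<open>S^m_j = d_j a^m\<close>. Neither the embedding nor its
  normal occurs in the formal text: the closed forms that they suggest are verified after lowering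
  an index with \<open>g\<close>. The factor 1/2 has its origin in \<open>mod_P\<close>, which
  carries the constant \<open>1 / 2 ^ k\<close> but only \<open>k - 1\<close> curvature factors,
  each of which contributes a 2. The area of spheres is given by a cone measure, so the divergence
  theorem on balls is reached through integrals over thin shells. As the flux identity is exact at
  every radius, the limit only requires that \<open>mod_L\<close> be integrable in the
  chart.\<close>

lemma pd_eqI: "(F has_derivative D) (at x) \<Longrightarrow> pd i F x = D (axis i 1)"
  by (simp add: pd_def frechet_derivative_at[symmetric])

lemma has_derivative_pd:
  fixes F :: "real ^ 'n::finite \<Rightarrow> real"
  assumes "F differentiable (at x)"
  shows "(F has_derivative (\<lambda>v. \<Sum>i\<in>UNIV. v $ i * pd i F x)) (at x)"
proof -
  from assms have D: "(F has_derivative frechet_derivative F (at x)) (at x)"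
    by (simp add: frechet_derivative_works)
  interpret bounded_linear "frechet_derivative F (at x)"
    using D by (rule has_derivative_bounded_linear)
  have "frechet_derivative F (at x) v = (\<Sum>i\<in>UNIV. v $ i * pd i F x)" for v
  proof -
    have "frechet_derivative F (at x) v = frechet_derivative F (at x) (\<Sum>i\<in>UNIV. v $ i *\<^sub>R axis i 1)"
      using basis_expansion[of v] by (simp add: scalar_mult_eq_scaleR)
    then show ?thesis by (simp add: sum scaleR pd_def)
  qed
  then have "frechet_derivative F (at x) = (\<lambda>v. \<Sum>i\<in>UNIV. v $ i * pd i F x)" by blast
  then show ?thesis using D by simp
qed

lemma pd_const [simp]: "pd i (\<lambda>x. c) x = 0"
  by (subst pd_eqI[where D = "\<lambda>_. 0"]) auto

lemma pd_coord: "pd i (\<lambda>x. x $ j) x = (if i = j then 1 else 0)"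
  by (subst pd_eqI[where D = "\<lambda>v. v $ j"])
    (auto simp: axis_def intro!: bounded_linear_imp_has_derivative bounded_linear_vec_nth)

lemma
  assumes "F differentiable (at x)" "G differentiable (at x)"
  shows pd_add: "pd i (\<lambda>x. F x + G x) x = pd i F x + pd i G x"
    and pd_diff: "pd i (\<lambda>x. F x - G x) x = pd i F x - pd i G x"
    and pd_mult: "pd i (\<lambda>x. F x * G x) x = pd i F x * G x + F x * pd i G x"
proof -
  note D = assms[unfolded frechet_derivative_works]
  show "pd i (\<lambda>x. F x + G x) x = pd i F x + pd i G x"
    by (subst pd_eqI[OF has_derivative_add[OF D]]) (simp add: pd_def)
  show "pd i (\<lambda>x. F x - G x) x = pd i F x - pd i G x"
    by (subst pd_eqI[OF has_derivative_diff[OF D]]) (simp add: pd_def)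
  show "pd i (\<lambda>x. F x * G x) x = pd i F x * G x + F x * pd i G x"
    by (subst pd_eqI[OF has_derivative_mult[OF D]]) (simp add: pd_def)
qed

lemma pd_sum:
  assumes "\<And>a. a \<in> A \<Longrightarrow> F a differentiable (at x)"
  shows "pd i (\<lambda>x. \<Sum>a\<in>A. F a x) x = (\<Sum>a\<in>A. pd i (F a) x)"
proof -
  have "((\<lambda>x. \<Sum>a\<in>A. F a x) has_derivative (\<lambda>v. \<Sum>a\<in>A. frechet_derivative (F a) (at x) v)) (at x)"
    using assms by (intro has_derivative_sum) (simp add: frechet_derivative_works)
  from pd_eqI[OF this] show ?thesis by (simp add: pd_def)
qed

lemma pd_compose:
  assumes "F differentiable (at x)" "(\<phi> has_real_derivative d) (at (F x))"
  shows "pd i (\<lambda>x. \<phi> (F x)) x = d * pd i F x"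
    and "(\<lambda>x. \<phi> (F x)) differentiable (at x)"
proof -
  have "((\<lambda>x. \<phi> (F x)) has_derivative (\<lambda>v. d * frechet_derivative F (at x) v)) (at x)"
    using has_derivative_compose[of F "frechet_derivative F (at x)" x UNIV \<phi> "\<lambda>v. d * v"] assms
    by (simp add: frechet_derivative_works has_field_derivative_def)
  from pd_eqI[OF this] this show "pd i (\<lambda>x. \<phi> (F x)) x = d * pd i F x"
    "(\<lambda>x. \<phi> (F x)) differentiable (at x)" by (auto simp: pd_def differentiable_def)
qed

lemma pd_inverse:
  assumes "F differentiable (at x)" "F x \<noteq> 0"
  shows "pd i (\<lambda>x. inverse (F x)) x = - (pd i F x * (inverse (F x) * inverse (F x)))"
  using pd_compose(1)[OF assms(1) DERIV_inverse[OF assms(2)], of i]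
  by (simp add: power2_eq_square algebra_simps)

lemma pd_sqrt:
  assumes "F differentiable (at x)" "F x > 0"
  shows "pd i (\<lambda>x. sqrt (F x)) x = pd i F x * (inverse 2 * inverse (sqrt (F x)))"
  using pd_compose(1)[OF assms(1) DERIV_real_sqrt[OF assms(2)], of i] by (simp add: field_simps)

section \<open>Closure properties of smooth functions\<close>

lemma Ck_continuous: "Ck m F \<Longrightarrow> continuous_on UNIV F"
  by (cases m) (simp_all add: continuous_at_imp_continuous_on differentiable_imp_continuous_within)

lemma Ck_Suc: "Ck (Suc m) F \<Longrightarrow> Ck m F"
proof (induction m arbitrary: F)
  case 0
  then show ?case using Ck_continuous Ck.simps(1) by blast
next
  case (Suc m)
  then show ?case by (metis Ck.simps(2))
qed

lemma Ck_const [simp]: "Ck m (\<lambda>x. c)"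
proof (induction m arbitrary: c)
  case (Suc m)
  then show ?case by (simp add: pd_const[abs_def])
qed auto

lemma Ck_coord [simp]: "Ck m (\<lambda>x :: real ^ 'n::finite. x $ j)"
proof (cases m)
  case (Suc m')
  have "(\<lambda>x :: real ^ 'n. x $ j) differentiable (at x)" for x
    by (rule bounded_linear_imp_differentiable[OF bounded_linear_vec_nth])
  with Suc show ?thesis by (simp add: pd_coord[abs_def])
qed (simp add: continuous_on_component)

lemma Ck_add: "Ck m F \<Longrightarrow> Ck m G \<Longrightarrow> Ck m (\<lambda>x. F x + G x)"
proof (induction m arbitrary: F G)
  case (Suc m)
  then have "pd i (\<lambda>x. F x + G x) = (\<lambda>x. pd i F x + pd i G x)" for i
    by (auto simp: pd_add)
  with Suc show ?case by auto
qed (simp add: continuous_intros)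

lemma Ck_mult: "Ck m F \<Longrightarrow> Ck m G \<Longrightarrow> Ck m (\<lambda>x. F x * G x)"
proof (induction m arbitrary: F G)
  case (Suc m)
  then have "pd i (\<lambda>x. F x * G x) = (\<lambda>x. pd i F x * G x + F x * pd i G x)" for i
    by (auto simp: pd_mult)
  moreover note Ck_Suc[OF Suc.prems(1)] Ck_Suc[OF Suc.prems(2)]
  ultimately show ?case using Suc by (simp add: Ck_add)
qed (simp add: continuous_intros)

lemma Ck_minus: "Ck m F \<Longrightarrow> Ck m (\<lambda>x. - F x)"
  using Ck_mult[of m "\<lambda>_. -1" F] by simp

text \<open>Bootstrapping: the partial derivatives of \<open>1 / F\<close> are polynomials in those
  of \<open>F\<close> and in \<open>1 / F\<close> itself, so one order of regularity yields the
  next. The square root below is treated in the same way.\<close>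

lemma Ck_inverse: "Ck m F \<Longrightarrow> (\<And>x. F x \<noteq> 0) \<Longrightarrow> Ck m (\<lambda>x. inverse (F x))"
proof (induction m)
  case (Suc m)
  then have "pd i (\<lambda>x. inverse (F x)) = (\<lambda>x. - (pd i F x * (inverse (F x) * inverse (F x))))" for i
    by (auto simp: pd_inverse)
  moreover have "Ck m (\<lambda>x. inverse (F x))" by (rule Suc.IH[OF Ck_Suc[OF Suc.prems(1)] Suc.prems(2)])
  moreover have "(\<lambda>x. inverse (F x)) differentiable (at x)" for x
    using Suc.prems by (intro differentiable_inverse) auto
  ultimately show ?case using Suc.prems by (simp add: Ck_mult Ck_minus)
qed (simp add: continuous_on_inverse)

lemma Ck_sqrt: "Ck m F \<Longrightarrow> (\<And>x. F x > 0) \<Longrightarrow> Ck m (\<lambda>x. sqrt (F x))"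
proof (induction m)
  case (Suc m)
  have d: "F differentiable (at x)" for x using Suc.prems by simp
  have "Ck m (\<lambda>x. sqrt (F x))" by (rule Suc.IH[OF Ck_Suc[OF Suc.prems(1)] Suc.prems(2)])
  moreover have "sqrt (F x) \<noteq> 0" for x using Suc.prems(2)[of x] by simp
  ultimately have "Ck m (\<lambda>x. pd i F x * (inverse 2 * inverse (sqrt (F x))))" for i
    using Suc.prems by (intro Ck_mult Ck_inverse Ck_const) simp_all
  moreover have "pd i (\<lambda>x. sqrt (F x)) = (\<lambda>x. pd i F x * (inverse 2 * inverse (sqrt (F x))))" for i
    using d Suc.prems(2) by (intro ext pd_sqrt)
  moreover have "(\<lambda>x. sqrt (F x)) differentiable (at x)" for x
    using pd_compose(2)[OF d DERIV_real_sqrt[OF Suc.prems(2)]] .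
  ultimately show ?case by simp
qed (simp add: continuous_intros)

named_theorems smooth_intros

lemma smooth_const [smooth_intros]: "smooth_fun (\<lambda>x. c)"
  unfolding smooth_fun_def by simp

lemma smooth_coord [smooth_intros]: "smooth_fun (\<lambda>x. x $ j)"
  unfolding smooth_fun_def by simp

lemma smooth_add [smooth_intros]:
  "smooth_fun F \<Longrightarrow> smooth_fun G \<Longrightarrow> smooth_fun (\<lambda>x. F x + G x)"
  unfolding smooth_fun_def by (intro allI Ck_add) simp_all

lemma smooth_mult [smooth_intros]:
  "smooth_fun F \<Longrightarrow> smooth_fun G \<Longrightarrow> smooth_fun (\<lambda>x. F x * G x)"
  unfolding smooth_fun_def by (intro allI Ck_mult) simp_all

lemma smooth_minus [smooth_intros]: "smooth_fun F \<Longrightarrow> smooth_fun (\<lambda>x. - F x)"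
  unfolding smooth_fun_def by (intro allI Ck_minus) simp_all

lemma smooth_inverse [smooth_intros]:
  "smooth_fun F \<Longrightarrow> (\<And>x. F x \<noteq> 0) \<Longrightarrow> smooth_fun (\<lambda>x. inverse (F x))"
  unfolding smooth_fun_def by (intro allI Ck_inverse) simp_all

lemma smooth_sqrt [smooth_intros]:
  "smooth_fun F \<Longrightarrow> (\<And>x. F x > 0) \<Longrightarrow> smooth_fun (\<lambda>x. sqrt (F x))"
  unfolding smooth_fun_def by (intro allI Ck_sqrt) simp_all

lemma smooth_diff [smooth_intros]:
  "smooth_fun F \<Longrightarrow> smooth_fun G \<Longrightarrow> smooth_fun (\<lambda>x. F x - G x)"
  unfolding diff_conv_add_uminus by (intro smooth_intros)

lemma smooth_divide [smooth_intros]: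
  "smooth_fun F \<Longrightarrow> smooth_fun G \<Longrightarrow> (\<And>x. G x \<noteq> 0) \<Longrightarrow> smooth_fun (\<lambda>x. F x / G x)"
  unfolding divide_inverse by (intro smooth_intros)

lemma smooth_sum [smooth_intros]:
  "(\<And>a. a \<in> A \<Longrightarrow> smooth_fun (F a)) \<Longrightarrow> smooth_fun (\<lambda>x. \<Sum>a\<in>A. F a x)"
  by (induction A rule: infinite_finite_induct) (simp_all add: smooth_const smooth_add)

lemma smooth_prod [smooth_intros]:
  "(\<And>a. a \<in> A \<Longrightarrow> smooth_fun (F a)) \<Longrightarrow> smooth_fun (\<lambda>x. \<Prod>a\<in>A. F a x)"
  by (induction A rule: infinite_finite_induct) (simp_all add: smooth_const smooth_mult)

lemma smooth_power [smooth_intros]: "smooth_fun F \<Longrightarrow> smooth_fun (\<lambda>x. F x ^ m)"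
  by (induction m) (simp_all add: smooth_const smooth_mult)

lemma smooth_pd [smooth_intros]: "smooth_fun F \<Longrightarrow> smooth_fun (pd i F)"
  unfolding smooth_fun_def by (metis Ck.simps(2))

lemma smooth_differentiable: "smooth_fun F \<Longrightarrow> F differentiable (at x)"
  unfolding smooth_fun_def by (metis Ck.simps(2))

lemma smooth_continuous: "smooth_fun F \<Longrightarrow> continuous_on A F"
  unfolding smooth_fun_def by (meson Ck_continuous continuous_on_subset subset_UNIV)

text \<open>Restriction to a coordinate line gives access to the one-variable mean value theorem,
  both for the symmetry of second partial derivatives and for the Lipschitz bound behind the
  divergence theorem.\<close>

lemma smooth_field_derivative:
  fixes F :: "real ^ 'n::finite \<Rightarrow> real"
  assumes "smooth_fun F"
  shows "((\<lambda>s. F (x + s *\<^sub>R axis i 1)) has_real_derivative pd i F (x + s *\<^sub>R axis i 1)) (at s)"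
proof -
  have 1: "((\<lambda>s. x + s *\<^sub>R axis i 1) has_derivative (\<lambda>s. s *\<^sub>R axis i (1::real))) (at s)"
    by (auto intro!: derivative_eq_intros)
  have "((\<lambda>s. F (x + s *\<^sub>R axis i 1)) has_derivative
      (\<lambda>s'. \<Sum>j\<in>UNIV. (s' *\<^sub>R axis i (1::real)) $ j * pd j F (x + s *\<^sub>R axis i 1))) (at s)"
    using has_derivative_compose[OF 1 has_derivative_pd[OF smooth_differentiable[OF assms]]] by simp
  moreover have "(\<Sum>j\<in>UNIV. (s' *\<^sub>R axis i (1::real)) $ j * pd j F (x + s *\<^sub>R axis i 1))
      = pd i F (x + s *\<^sub>R axis i 1) * s'" for s'
    by (simp add: axis_def if_distrib[where f = "\<lambda>u. _ * u"] if_distrib[where f = "\<lambda>u. u * _"] cong: if_cong)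
  ultimately show ?thesis by (simp add: has_field_derivative_def)
qed

text \<open>The second difference of \<open>F\<close> over a square of side \<open>h\<close> with
  corner \<open>x\<close> is \<open>h * h\<close> times a mixed partial derivative at some point of
  the square, in either order of differentiation. Continuity identifies the two limits as
  \<open>h\<close> tends to 0.\<close>

lemma pd_swap:
  fixes F :: "real ^ 'n::finite \<Rightarrow> real"
  assumes F: "smooth_fun F"
  shows "pd i (pd j F) x = pd j (pd i F) x"
proof -
  have mixed: "\<exists>\<xi> \<eta>. 0 < \<xi> \<and> \<xi> < h \<and> 0 < \<eta> \<and> \<eta> < h \<and>
      F (x + h *\<^sub>R axis i 1 + h *\<^sub>R axis j 1) - F (x + h *\<^sub>R axis i 1) - F (x + h *\<^sub>R axis j 1) + F x
      = h * h * pd j (pd i F) (x + \<xi> *\<^sub>R axis i 1 + \<eta> *\<^sub>R axis j 1)"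
    if h: "h > 0" for h :: real and i j
  proof -
    let ?a = "\<lambda>s. F (x + h *\<^sub>R axis j 1 + s *\<^sub>R axis i 1) - F (x + s *\<^sub>R axis i 1)"
    have "\<exists>\<xi>. 0 < \<xi> \<and> \<xi> < h \<and> ?a h - ?a 0 = (h - 0) *
        (pd i F (x + h *\<^sub>R axis j 1 + \<xi> *\<^sub>R axis i 1) - pd i F (x + \<xi> *\<^sub>R axis i 1))"
      by (rule MVT2[OF h]) (intro DERIV_diff smooth_field_derivative F)
    then obtain \<xi> where \<xi>: "0 < \<xi>" "\<xi> < h" "?a h - ?a 0 = h *
        (pd i F (x + h *\<^sub>R axis j 1 + \<xi> *\<^sub>R axis i 1) - pd i F (x + \<xi> *\<^sub>R axis i 1))" by auto
    have "\<exists>\<eta>. 0 < \<eta> \<and> \<eta> < h \<and> pd i F (x + \<xi> *\<^sub>R axis i 1 + h *\<^sub>R axis j 1)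
        - pd i F (x + \<xi> *\<^sub>R axis i 1 + 0 *\<^sub>R axis j 1)
        = (h - 0) * pd j (pd i F) (x + \<xi> *\<^sub>R axis i 1 + \<eta> *\<^sub>R axis j 1)"
      by (rule MVT2[OF h, where f = "\<lambda>s. pd i F (x + \<xi> *\<^sub>R axis i 1 + s *\<^sub>R axis j 1)"])
        (intro smooth_field_derivative smooth_intros F)
    then obtain \<eta> where "0 < \<eta>" "\<eta> < h" "pd i F (x + \<xi> *\<^sub>R axis i 1 + h *\<^sub>R axis j 1)
        - pd i F (x + \<xi> *\<^sub>R axis i 1)
        = h * pd j (pd i F) (x + \<xi> *\<^sub>R axis i 1 + \<eta> *\<^sub>R axis j 1)" by auto
    with \<xi> show ?thesis by (intro exI[of _ \<xi>] exI[of _ \<eta>]) (simp add: ac_simps)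
  qed
  define h where "h m = inverse (real (Suc m))" for m
  have h: "h m > 0" for m by (simp add: h_def)
  have lim: "\<exists>D. (D \<longlonglongrightarrow> pd j (pd i F) x) \<and> (\<forall>m. F (x + h m *\<^sub>R axis i 1 + h m *\<^sub>R axis j 1)
      - F (x + h m *\<^sub>R axis i 1) - F (x + h m *\<^sub>R axis j 1) + F x = h m * h m * D m)" for i j
  proof -
    obtain \<xi> \<eta> where \<xi>: "\<And>m. 0 < \<xi> m" "\<And>m. \<xi> m < h m" and \<eta>: "\<And>m. 0 < \<eta> m" "\<And>m. \<eta> m < h m"
      and D: "\<And>m. F (x + h m *\<^sub>R axis i 1 + h m *\<^sub>R axis j 1)
      - F (x + h m *\<^sub>R axis i 1) - F (x + h m *\<^sub>R axis j 1) + F x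
      = h m * h m * pd j (pd i F) (x + \<xi> m *\<^sub>R axis i 1 + \<eta> m *\<^sub>R axis j 1)"
      using mixed[OF h, of _ i j] by metis
    have h0: "h \<longlonglongrightarrow> 0" unfolding h_def using LIMSEQ_inverse_real_of_nat .
    have "\<xi> \<longlonglongrightarrow> 0" "\<eta> \<longlonglongrightarrow> 0"
      using \<xi> \<eta> by (auto intro!: tendsto_sandwich[OF _ _ tendsto_const h0] always_eventually less_imp_le)
    then have "(\<lambda>m. x + \<xi> m *\<^sub>R axis i 1 + \<eta> m *\<^sub>R axis j 1) \<longlonglongrightarrow> x + 0 *\<^sub>R axis i 1 + 0 *\<^sub>R axis j 1"
      by (intro tendsto_intros)
    then have "(\<lambda>m. x + \<xi> m *\<^sub>R axis i 1 + \<eta> m *\<^sub>R axis j 1) \<longlonglongrightarrow> x" by simp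
    moreover have "continuous_on UNIV (pd j (pd i F))"
      by (intro smooth_continuous smooth_intros F)
    ultimately have "(\<lambda>m. pd j (pd i F) (x + \<xi> m *\<^sub>R axis i 1 + \<eta> m *\<^sub>R axis j 1)) \<longlonglongrightarrow> pd j (pd i F) x"
      by (auto intro: continuous_on_tendsto_compose)
    with D show ?thesis by blast
  qed
  obtain D D' where D: "D \<longlonglongrightarrow> pd j (pd i F) x" "D' \<longlonglongrightarrow> pd i (pd j F) x"
    and "\<And>m. F (x + h m *\<^sub>R axis i 1 + h m *\<^sub>R axis j 1)
      - F (x + h m *\<^sub>R axis i 1) - F (x + h m *\<^sub>R axis j 1) + F x = h m * h m * D m"
    and "\<And>m. F (x + h m *\<^sub>R axis j 1 + h m *\<^sub>R axis i 1)
      - F (x + h m *\<^sub>R axis j 1) - F (x + h m *\<^sub>R axis i 1) + F x = h m * h m * D' m"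
    using lim[of i j] lim[of j i] by metis
  \<comment> \<open>The second difference is unchanged when \<open>i\<close> and \<open>j\<close>
    are exchanged.\<close>
  then have eq: "h m * h m * D m = h m * h m * D' m" for m
    by (simp add: algebra_simps)
  have "D m = D' m" for m using eq[of m] h[of m] by simp
  then have "D = D'" by blast
  with D show ?thesis by (simp add: LIMSEQ_unique)
qed

section \<open>The hyperbolic metric\<close>

lemma
  assumes "smooth_fun F" "smooth_fun G"
  shows pd_smooth_add: "pd i (\<lambda>x. F x + G x) x = pd i F x + pd i G x"
    and pd_smooth_diff: "pd i (\<lambda>x. F x - G x) x = pd i F x - pd i G x"
    and pd_smooth_mult: "pd i (\<lambda>x. F x * G x) x = pd i F x * G x + F x * pd i G x"
  by (simp_all add: assms pd_add pd_diff pd_mult smooth_differentiable)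

lemma pd_smooth_sum:
  assumes "\<And>a. a \<in> A \<Longrightarrow> smooth_fun (F a)"
  shows "pd i (\<lambda>x. \<Sum>a\<in>A. F a x) x = (\<Sum>a\<in>A. pd i (F a) x)"
  by (simp add: assms pd_sum smooth_differentiable)

lemma pd_smooth_divide:
  assumes "smooth_fun F" "smooth_fun G" "\<And>x. G x \<noteq> 0"
  shows "pd i (\<lambda>x. F x / G x) x = (pd i F x * G x - F x * pd i G x) / (G x * G x)"
proof -
  have "pd i (\<lambda>x. F x * inverse (G x)) x = pd i F x * inverse (G x) + F x * pd i (\<lambda>x. inverse (G x)) x"
    by (rule pd_smooth_mult) (intro smooth_inverse assms)+
  also have "pd i (\<lambda>x. inverse (G x)) x = - (pd i G x * (inverse (G x) * inverse (G x)))"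
    by (rule pd_inverse) (use assms smooth_differentiable in auto)
  finally show ?thesis using assms(3)[of x] by (simp add: field_simps)
qed

lemma V0_eq: "V0 y = sqrt (1 + (\<Sum>i\<in>UNIV. y $ i * y $ i))"
  by (simp add: V0_def hyp_r_def cosh_arsinh_real norm_vec_def L2_set_def power2_eq_square
      sum_nonneg add.commute)

lemma sum_sq_nonneg: "0 \<le> (\<Sum>i\<in>UNIV. (y :: real ^ 'n::finite) $ i * y $ i)"
  by (simp add: sum_nonneg)

lemma V0_sq: "V0 y * V0 y = 1 + (\<Sum>i\<in>UNIV. y $ i * y $ i)"
  using sum_sq_nonneg[of y] by (simp add: V0_eq)

lemma norm_sq_V0: "1 + (norm y)\<^sup>2 = V0 y * V0 y"
  by (simp add: V0_sq power2_norm_eq_inner inner_vec_def)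

lemma V0_pos [simp]: "V0 y > 0"
  using sum_sq_nonneg[of y] by (simp add: V0_eq)

lemma V0_nonzero [simp]: "V0 y \<noteq> 0"
  using V0_pos[of y] by linarith

lemma smooth_V0 [smooth_intros]: "smooth_fun V0"
  unfolding V0_eq[abs_def] by (intro smooth_intros) (simp add: add_pos_nonneg sum_sq_nonneg)

lemma pd_V0: "pd i V0 y = y $ i / V0 y"
proof -
  let ?Q = "\<lambda>y :: real ^ 'a. 1 + (\<Sum>i\<in>UNIV. y $ i * y $ i)"
  have s: "smooth_fun ?Q" by (intro smooth_intros)
  have p: "?Q y > 0" using sum_sq_nonneg[of y] by simp
  have "pd i ?Q y = (\<Sum>l\<in>UNIV. pd i (\<lambda>y. y $ l * y $ l) y)"
    by (simp add: pd_smooth_add pd_smooth_sum smooth_const smooth_coord smooth_mult smooth_sum)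
  also have "\<dots> = (\<Sum>l\<in>UNIV. (if i = l then 2 * y $ i else 0))"
    by (intro sum.cong refl) (simp add: pd_smooth_mult smooth_intros pd_coord)
  finally have "pd i ?Q y = 2 * y $ i" by simp
  then have "pd i V0 y = 2 * y $ i * (inverse 2 * inverse (V0 y))"
    using pd_sqrt[OF smooth_differentiable[OF s] p, of i] by (simp only: V0_eq[abs_def])
  then show ?thesis by (simp add: field_simps)
qed

text \<open>This is \<open>|dy|^2 - dV^2\<close>, the metric induced on the hyperboloid of points
  \<open>(V0 y, y)\<close>.\<close>

lemma hyp_metric_V0: "hyp_metric y $ i $ j = (if i = j then 1 else 0) - pd i V0 y * pd j V0 y"
  by (simp add: hyp_metric_def norm_sq_V0 pd_V0)

lemma hyp_metric_nth: "hyp_metric y $ i $ j = (if i = j then 1 else 0) - y $ i * y $ j / (V0 y * V0 y)"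
  by (simp add: hyp_metric_def norm_sq_V0)

lemma pd_pd_V0: "pd i (pd j V0) y = hyp_metric y $ i $ j / V0 y"
proof -
  have "pd i (pd j V0) y = pd i (\<lambda>y. y $ j / V0 y) y"
    by (simp add: pd_V0[abs_def])
  also have "\<dots> = ((if i = j then 1 else 0) * V0 y - y $ j * (y $ i / V0 y)) / (V0 y * V0 y)"
    by (simp add: pd_smooth_divide smooth_coord smooth_V0 pd_coord pd_V0)
  also have "\<dots> = hyp_metric y $ i $ j / V0 y"
    by (simp add: hyp_metric_nth field_simps)
  finally show ?thesis .
qed

lemma pd_hyp_metric:
  "pd l (\<lambda>y. hyp_metric y $ i $ j) y
    = - (hyp_metric y $ l $ i * pd j V0 y + pd i V0 y * hyp_metric y $ l $ j) / V0 y"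
proof -
  have "pd l (\<lambda>y. hyp_metric y $ i $ j) y = - (pd l (pd i V0) y * pd j V0 y + pd i V0 y * pd l (pd j V0) y)"
    unfolding hyp_metric_V0 by (simp add: pd_smooth_diff pd_smooth_mult smooth_intros)
  then show ?thesis by (simp add: pd_pd_V0 field_simps)
qed

lemma smooth_hyp_metric [smooth_intros]: "smooth_fun (\<lambda>y. hyp_metric y $ i $ j)"
  unfolding hyp_metric_V0 by (intro smooth_intros)

lemma hyp_metric_sym: "hyp_metric y $ i $ j = hyp_metric y $ j $ i"
  by (simp add: hyp_metric_nth)

lemma hyp_metric_apply:
  "(\<Sum>m\<in>UNIV. hyp_metric y $ i $ m * v m) = v i - y $ i * (\<Sum>m\<in>UNIV. y $ m * v m) / (V0 y * V0 y)"
proof -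
  have "(\<Sum>m\<in>UNIV. hyp_metric y $ i $ m * v m)
      = (\<Sum>m\<in>UNIV. (if i = m then v m else 0) - y $ i / (V0 y * V0 y) * (y $ m * v m))"
    by (intro sum.cong refl) (simp add: hyp_metric_nth algebra_simps)
  also have "\<dots> = v i - y $ i / (V0 y * V0 y) * (\<Sum>m\<in>UNIV. y $ m * v m)"
    by (simp only: sum_subtractf sum_distrib_left) simp
  finally show ?thesis by simp
qed

text \<open>All indices are raised by this rule: the raised object is guessed, and only the fact
  that it lowers to \<open>w\<close> is verified. No entry of \<open>matrix_inv\<close> has to be
  computed.\<close>

lemma matrix_inv_cancel:
  fixes A :: "real ^ 'n::finite ^ 'n"
  assumes "invertible A" "\<And>l. (\<Sum>m\<in>UNIV. A $ l $ m * v m) = w l"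
  shows "(\<Sum>l\<in>UNIV. matrix_inv A $ m $ l * w l) = v m"
proof -
  have "\<exists>A'. A ** A' = mat 1 \<and> A' ** A = mat 1"
    using assms(1) by (simp add: invertible_def)
  from someI_ex[OF this] have "matrix_inv A ** A = mat 1"
    by (simp add: matrix_inv_def)
  moreover have "A *v (\<chi> m. v m) = (\<chi> l. w l)"
    by (simp add: vec_eq_iff matrix_vector_mult_def assms(2))
  ultimately have "matrix_inv A *v (\<chi> l. w l) = (\<chi> m. v m)"
    using matrix_vector_mul_assoc[of "matrix_inv A" A "\<chi> m. v m"] by simp
  then show ?thesis by (simp add: vec_eq_iff matrix_vector_mult_def)
qed

section \<open>The shape operator of a graph\<close>

definition radial :: "(real ^ 'n::finite \<Rightarrow> real) \<Rightarrow> real ^ 'n \<Rightarrow> real" where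
  "radial f y = (\<Sum>l\<in>UNIV. y $ l * pd l f y)"

text \<open>The components of the \<open>b\<close>-gradient: the inverse of the matrix of
  \<open>b\<close> is \<open>1 + y y^T\<close>, so raising \<open>df\<close> adds \<open>y\<close>
  times the Euler derivative \<open>radial f\<close>.\<close>

definition hyp_grad :: "(real ^ 'n::finite \<Rightarrow> real) \<Rightarrow> 'n \<Rightarrow> real ^ 'n \<Rightarrow> real" where
  "hyp_grad f m y = pd m f y + y $ m * radial f y"

text \<open>The ratio of the volume elements of \<open>graph_metric f\<close> and
  \<open>hyp_metric\<close>. It is also \<open>V\<close> times the length of the gradient of
  \<open>t - f\<close> in the metric \<open>b + V^2 dt^2\<close>, which normalises the normal of the
  graph.\<close>

definition slope :: "(real ^ 'n::finite \<Rightarrow> real) \<Rightarrow> real ^ 'n \<Rightarrow> real" where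
  "slope f y = sqrt (1 + (V0 y)\<^sup>2 * hyp_grad_sq f y)"

text \<open>The \<open>a\<^sup>m\<close> of the introduction: \<open>V \<nabla>\<^sup>m f / sqrt (1 + V\<^sup>2 |df|\<^sup>2)\<close>, index raised by \<open>b\<close>.\<close>

definition gauss_map :: "(real ^ 'n::finite \<Rightarrow> real) \<Rightarrow> 'n \<Rightarrow> real ^ 'n \<Rightarrow> real" where
  "gauss_map f m y = V0 y * hyp_grad f m y / slope f y"

text \<open>Since \<open>Hess^b f\<close> has the components
  \<open>pd i (pd j f) + radial f * b_ij\<close>, and
  \<open><grad V, grad f> = V * radial f\<close>, this is \<open>(V Hess^b f + dV df + df dV + V^2
  <grad V, grad f> df df) / slope\<close>, the second fundamental form of the graph in
  \<open>b + V^2 dt^2\<close>. All terms with \<open>radial f\<close> combine into a multiple of the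
  graph metric.\<close>

definition second_form :: "(real ^ 'n::finite \<Rightarrow> real) \<Rightarrow> 'n \<Rightarrow> 'n \<Rightarrow> real ^ 'n \<Rightarrow> real" where
  "second_form f i j y =
     (V0 y * pd i (pd j f) y + pd i V0 y * pd j f y + pd j V0 y * pd i f y
       + V0 y * radial f y * graph_metric f y $ i $ j) / slope f y"

lemma graph_metric_nth:
  "graph_metric f y $ i $ j = hyp_metric y $ i $ j + V0 y * V0 y * pd i f y * pd j f y"
  by (simp add: graph_metric_def power2_eq_square)

lemma graph_metric_sym: "graph_metric f y $ i $ j = graph_metric f y $ j $ i"
  by (simp add: graph_metric_nth hyp_metric_sym[of y i j])

lemma graph_metric_const: "graph_metric (\<lambda>_. c) = hyp_metric"
  by (simp add: fun_eq_iff vec_eq_iff graph_metric_nth)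

lemma hyp_grad_lower: "(\<Sum>m\<in>UNIV. hyp_metric y $ i $ m * hyp_grad f m y) = pd i f y"
proof -
  have "(\<Sum>m\<in>UNIV. y $ m * hyp_grad f m y) = radial f y * (V0 y * V0 y)"
  proof -
    have "(\<Sum>m\<in>UNIV. y $ m * hyp_grad f m y)
        = (\<Sum>m\<in>UNIV. y $ m * pd m f y) + radial f y * (\<Sum>m\<in>UNIV. y $ m * y $ m)"
      by (simp add: hyp_grad_def algebra_simps sum.distrib sum_distrib_left)
    then show ?thesis by (simp add: V0_sq algebra_simps flip: radial_def)
  qed
  then show ?thesis by (simp add: hyp_metric_apply) (simp add: hyp_grad_def)
qed

lemma hyp_coord_lower: "(\<Sum>m\<in>UNIV. hyp_metric y $ i $ m * y $ m) = y $ i / (V0 y * V0 y)"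
proof -
  have *: "(\<Sum>m\<in>UNIV. y $ m * y $ m) = V0 y * V0 y - 1" by (simp add: V0_sq)
  show ?thesis unfolding hyp_metric_apply * by (simp add: field_simps)
qed

lemma hyp_metric_invertible: "invertible (hyp_metric y)"
proof -
  \<comment> \<open>The Sherman-Morrison inverse of \<open>1 - y y^T / V^2\<close>; its denominator
    \<open>V^2 - |y|^2\<close> equals 1.\<close>
  let ?B = "\<chi> i j. (if i = j then 1 else 0) + y $ i * y $ j"
  have "(\<Sum>m\<in>UNIV. hyp_metric y $ i $ m * ((if m = j then 1 else 0) + y $ m * y $ j))
      = (if i = j then 1 else 0)" for i j
  proof -
    have "(\<Sum>m\<in>UNIV. y $ m * ((if m = j then 1 else 0) + y $ m * y $ j)) = V0 y * V0 y * y $ j"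
    proof -
      have "(\<Sum>m\<in>UNIV. y $ m * ((if m = j then 1 else 0) + y $ m * y $ j))
          = (\<Sum>m\<in>UNIV. (if m = j then y $ m else 0) + y $ j * (y $ m * y $ m))"
        by (intro sum.cong refl) (simp add: algebra_simps)
      then show ?thesis
        by (simp only: sum.distrib sum_distrib_left[symmetric] V0_sq) (simp add: algebra_simps)
    qed
    then show ?thesis by (simp add: hyp_metric_apply)
  qed
  then have "hyp_metric y ** ?B = mat 1"
    by (simp add: matrix_matrix_mult_def mat_def vec_eq_iff)
  then show ?thesis
    using matrix_left_right_inverse[of "hyp_metric y" ?B] by (auto simp: invertible_def)
qed

lemma hyp_raise: "(\<Sum>j\<in>UNIV. matrix_inv (hyp_metric y) $ i $ j * pd j f y) = hyp_grad f i y"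
  by (rule matrix_inv_cancel[OF hyp_metric_invertible hyp_grad_lower])

lemma hyp_grad_sq_eq: "hyp_grad_sq f y = (\<Sum>i\<in>UNIV. pd i f y * hyp_grad f i y)"
  unfolding hyp_grad_sq_def hyp_raise[symmetric] by (simp add: sum_distrib_left ac_simps)

text \<open>The inverse \<open>1 + y y^T\<close> turns the squared gradient into a sum of squares.
  Its sign and its derivative are read off from this form.\<close>

lemma hyp_grad_sq_expand:
  "hyp_grad_sq f y = (\<Sum>i\<in>UNIV. pd i f y * pd i f y) + radial f y * radial f y"
proof -
  have "(\<Sum>i\<in>UNIV. pd i f y * hyp_grad f i y)
      = (\<Sum>i\<in>UNIV. pd i f y * pd i f y + radial f y * (y $ i * pd i f y))"
    by (intro sum.cong refl) (simp add: hyp_grad_def algebra_simps)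
  then show ?thesis
    by (simp only: hyp_grad_sq_eq sum.distrib sum_distrib_left[symmetric] radial_def[symmetric])
qed

lemma hyp_grad_sq_nonneg: "hyp_grad_sq f y \<ge> 0"
  unfolding hyp_grad_sq_expand by (intro add_nonneg_nonneg sum_nonneg) auto

lemma slope_arg: "1 + (V0 y)\<^sup>2 * hyp_grad_sq f y > 0"
  using hyp_grad_sq_nonneg[of f y] by (simp add: add_pos_nonneg)

lemma slope_ge_1: "slope f y \<ge> 1"
  using hyp_grad_sq_nonneg[of f y] by (simp add: slope_def)

lemma slope_pos [simp]: "slope f y > 0"
  using slope_ge_1[of f y] by linarith

lemma slope_nonzero [simp]: "slope f y \<noteq> 0"
  using slope_pos[of f y] by linarith

lemma slope_sq: "slope f y * slope f y = 1 + V0 y * V0 y * hyp_grad_sq f y"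
  using slope_arg[of y f] by (simp add: slope_def power2_eq_square)

lemma graph_metric_apply:
  "(\<Sum>m\<in>UNIV. graph_metric f y $ i $ m * v m)
    = (\<Sum>m\<in>UNIV. hyp_metric y $ i $ m * v m) + V0 y * V0 y * pd i f y * (\<Sum>m\<in>UNIV. pd m f y * v m)"
  by (simp add: graph_metric_nth algebra_simps sum.distrib sum_distrib_left)

text \<open>Lowering the \<open>b\<close>-gradient of \<open>f\<close> with \<open>g\<close> instead
  of \<open>b\<close> gives \<open>(1 + V^2 |df|^2) df\<close>, that is \<open>slope^2 df\<close>;
  one factor \<open>slope\<close> cancels the denominator of \<open>gauss_map\<close>.\<close>

lemma gauss_map_lower:
  "(\<Sum>m\<in>UNIV. graph_metric f y $ i $ m * gauss_map f m y) = V0 y * slope f y * pd i f y"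
proof -
  have *: "(\<Sum>m\<in>UNIV. w m * gauss_map f m y) = (V0 y / slope f y) * (\<Sum>m\<in>UNIV. w m * hyp_grad f m y)" for w
    by (simp add: gauss_map_def sum_distrib_left ac_simps)
  have "(\<Sum>m\<in>UNIV. graph_metric f y $ i $ m * gauss_map f m y)
     = (V0 y / slope f y) * (pd i f y * (slope f y * slope f y))"
    unfolding * graph_metric_apply slope_sq hyp_grad_lower hyp_grad_sq_eq by (simp add: algebra_simps)
  then show ?thesis by simp
qed

text \<open>With respect to \<open>b\<close>, the position vector \<open>y\<close> is the gradient
  of \<open>log V\<close>. The second term is the contribution of \<open>V^2 df df\<close>.\<close>

lemma graph_coord_lower:
  "(\<Sum>m\<in>UNIV. graph_metric f y $ i $ m * y $ m)
     = pd i V0 y / V0 y + V0 y * V0 y * radial f y * pd i f y"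
  unfolding graph_metric_apply hyp_coord_lower by (simp add: radial_def pd_V0 ac_simps)

locale smooth_graph =
  fixes f :: "real ^ 'n::finite \<Rightarrow> real"
  assumes f [smooth_intros]: "smooth_fun f"
begin

lemma smooth_radial [smooth_intros]: "smooth_fun (radial f)"
  unfolding radial_def[abs_def] by (intro smooth_intros)

lemma smooth_hyp_grad [smooth_intros]: "smooth_fun (hyp_grad f m)"
  unfolding hyp_grad_def[abs_def] by (intro smooth_intros)

lemma smooth_hyp_grad_sq [smooth_intros]: "smooth_fun (hyp_grad_sq f)"
  unfolding hyp_grad_sq_eq[abs_def] by (intro smooth_intros)

lemma smooth_slope [smooth_intros]: "smooth_fun (slope f)"
  unfolding slope_def[abs_def] by (intro smooth_intros slope_arg)

lemma smooth_gauss_map [smooth_intros]: "smooth_fun (gauss_map f m)"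
  unfolding gauss_map_def[abs_def] by (intro smooth_intros slope_nonzero)

lemma smooth_graph_metric [smooth_intros]: "smooth_fun (\<lambda>y. graph_metric f y $ i $ j)"
  unfolding graph_metric_nth by (intro smooth_intros)

lemma second_form_sym: "second_form f i j y = second_form f j i y"
  by (simp add: second_form_def pd_swap[OF f, of i j] graph_metric_sym[of f y i j] add.commute)

lemma pd_radial: "pd j (radial f) y = pd j f y + (\<Sum>l\<in>UNIV. y $ l * pd j (pd l f) y)"
proof -
  have "pd j (radial f) y = (\<Sum>l\<in>UNIV. pd j (\<lambda>y. y $ l * pd l f y) y)"
    unfolding radial_def[abs_def] by (rule pd_smooth_sum) (intro smooth_intros)
  also have "\<dots> = (\<Sum>l\<in>UNIV. (if j = l then pd l f y else 0) + y $ l * pd j (pd l f) y)"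
    by (intro sum.cong refl) (simp add: pd_smooth_mult smooth_coord smooth_pd f pd_coord)
  finally show ?thesis by (simp add: sum.distrib)
qed

lemma pd_hyp_grad:
  "pd j (hyp_grad f m) y
    = pd j (pd m f) y + ((if j = m then 1 else 0) * radial f y + y $ m * pd j (radial f) y)"
  unfolding hyp_grad_def[abs_def]
  by (simp add: pd_smooth_add pd_smooth_mult smooth_coord smooth_pd smooth_radial smooth_mult f pd_coord)

text \<open>Half the derivative of \<open>slope^2\<close>, so that no square root has to be
  differentiated.\<close>

lemma slope_pd_slope:
  "slope f y * pd j (slope f) y = V0 y * pd j V0 y * hyp_grad_sq f y
    + V0 y * V0 y * ((\<Sum>m\<in>UNIV. pd m f y * pd j (pd m f) y) + radial f y * pd j (radial f) y)"
proof -
  have "pd j (hyp_grad_sq f) y = (\<Sum>i\<in>UNIV. pd j (\<lambda>y. pd i f y * pd i f y) y) + pd j (\<lambda>y. radial f y * radial f y) y"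
    unfolding hyp_grad_sq_expand[abs_def]
    by (simp add: pd_smooth_add pd_smooth_sum smooth_pd smooth_radial smooth_mult smooth_sum f)
  also have "\<dots> = 2 * ((\<Sum>m\<in>UNIV. pd m f y * pd j (pd m f) y) + radial f y * pd j (radial f) y)"
    by (simp add: pd_smooth_mult smooth_pd smooth_radial f sum_distrib_left)
  finally have 1: "pd j (hyp_grad_sq f) y = \<dots>" .
  have "2 * (slope f y * pd j (slope f) y) = pd j (\<lambda>y. slope f y * slope f y) y"
    by (simp add: pd_smooth_mult smooth_slope)
  also have "\<dots> = 2 * V0 y * pd j V0 y * hyp_grad_sq f y + V0 y * V0 y * pd j (hyp_grad_sq f) y"
    unfolding slope_sq
    by (simp add: pd_smooth_add pd_smooth_mult smooth_const smooth_V0 smooth_hyp_grad_sq smooth_mult)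
  finally show ?thesis unfolding 1 by (simp add: algebra_simps)
qed

lemma pd_hyp_grad_lower:
  "(\<Sum>m\<in>UNIV. graph_metric f y $ i $ m * pd j (hyp_grad f m) y)
    = pd i (pd j f) y + radial f y * graph_metric f y $ i $ j + pd i V0 y * pd j f y / V0 y
      + V0 y * V0 y * pd i f y * ((\<Sum>m\<in>UNIV. pd m f y * pd j (pd m f) y) + radial f y * pd j (radial f) y)"
proof -
  have 1: "(\<Sum>m\<in>UNIV. w m * pd j (hyp_grad f m) y)
    = (\<Sum>m\<in>UNIV. w m * pd j (pd m f) y) + radial f y * w j + pd j (radial f) y * (\<Sum>m\<in>UNIV. w m * y $ m)"
    for w
  proof -
    have "(\<Sum>m\<in>UNIV. w m * pd j (hyp_grad f m) y)
        = (\<Sum>m\<in>UNIV. w m * pd j (pd m f) y + (if j = m then radial f y * w m else 0)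
            + pd j (radial f) y * (w m * y $ m))"
      unfolding pd_hyp_grad by (intro sum.cong refl) (simp add: algebra_simps)
    then show ?thesis by (simp only: sum.distrib sum_distrib_left) simp
  qed
  have 2: "(\<Sum>m\<in>UNIV. hyp_metric y $ i $ m * pd j (pd m f) y)
    = pd i (pd j f) y - y $ i * (pd j (radial f) y - pd j f y) / (V0 y * V0 y)"
    by (simp add: hyp_metric_apply pd_radial pd_swap[OF f, of i j])
  show ?thesis
    unfolding 1 graph_coord_lower
    unfolding graph_metric_apply 2 by (simp add: pd_V0 field_simps)
qed

text \<open>The Weingarten equation with its upper index lowered. In the quotient rule the
  derivative of \<open>slope\<close> cancels the bracket \<open>?D\<close> coming from
  \<open>pd_hyp_grad_lower\<close>, and by \<open>slope_sq\<close> it reduces the coefficient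
  \<open>slope^2\<close> of \<open>dV_j df_i\<close> to 1.\<close>

lemma shape_lower:
  "(\<Sum>m\<in>UNIV. graph_metric f y $ i $ m * pd j (gauss_map f m) y) = second_form f i j y"
proof -
  let ?V = "V0 y" and ?W = "slope f y"
  let ?D = "(\<Sum>m\<in>UNIV. pd m f y * pd j (pd m f) y) + radial f y * pd j (radial f) y"
  have 1: "pd j (gauss_map f m) y = pd j V0 y / ?W * hyp_grad f m y + ?V / ?W * pd j (hyp_grad f m) y
      - ?V * pd j (slope f) y / (?W * ?W) * hyp_grad f m y" for m
    unfolding gauss_map_def[abs_def]
    by (subst pd_smooth_divide) (simp_all add: smooth_V0 smooth_hyp_grad smooth_mult smooth_slope pd_smooth_mult field_simps)
  have 2: "(\<Sum>m\<in>UNIV. graph_metric f y $ i $ m * hyp_grad f m y) = ?W * ?W * pd i f y"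
    unfolding graph_metric_apply hyp_grad_lower slope_sq hyp_grad_sq_eq by (simp add: algebra_simps)
  have "(\<Sum>m\<in>UNIV. graph_metric f y $ i $ m * pd j (gauss_map f m) y)
     = pd j V0 y / ?W * (\<Sum>m\<in>UNIV. graph_metric f y $ i $ m * hyp_grad f m y)
       + ?V / ?W * (\<Sum>m\<in>UNIV. graph_metric f y $ i $ m * pd j (hyp_grad f m) y)
       - ?V * pd j (slope f) y / (?W * ?W) * (\<Sum>m\<in>UNIV. graph_metric f y $ i $ m * hyp_grad f m y)"
    unfolding 1 sum_distrib_left sum.distrib[symmetric] sum_subtractf[symmetric]
    by (intro sum.cong refl) (simp add: algebra_simps)
  also have "\<dots> = (pd j V0 y * (?W * ?W) * pd i f y
       + ?V * (\<Sum>m\<in>UNIV. graph_metric f y $ i $ m * pd j (hyp_grad f m) y)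
       - ?V * pd i f y * (?W * pd j (slope f) y)) / ?W"
    unfolding 2 by (simp add: field_simps)
  also have "\<dots> = second_form f i j y"
    unfolding slope_pd_slope pd_hyp_grad_lower slope_sq second_form_def
    by (intro arg_cong2[where f = "(/)"] refl) (simp add: field_simps)
  finally show ?thesis .
qed

end

section \<open>Christoffel symbols, Gauss and Codazzi equations\<close>

lemma det_rank_one_update:
  fixes u v :: "real ^ 'n::finite"
  shows "det (\<chi> i j. (if i = j then 1 else 0) + u $ i * v $ j) = 1 + (\<Sum>i\<in>UNIV. u $ i * v $ i)"
proof -
  let ?e = "\<lambda>i. axis i 1 :: real ^ 'n"
  \<comment> \<open>\<open>S\<close> holds the rows that have already received their multiple of
    \<open>v\<close>. As row \<open>k\<close> equals \<open>v\<close>, these multiples are removed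
    by row operations.\<close>
  have 1: "det (\<chi> i. if i = k then v else if i \<in> S then ?e i + u $ i *s v else ?e i) = v $ k"
    if "finite S" "k \<notin> S" for S k
    using that
  proof (induction S)
    case empty
    have id: "(\<chi> i. ?e i) = (mat 1 :: real ^ 'n ^ 'n)"
      by (simp add: mat_def axis_def vec_eq_iff)
    have rows: "row i (mat 1 :: real ^ 'n ^ 'n) = ?e i" for i
      by (simp add: row_def flip: id)
    have "(\<Sum>i\<in>UNIV. v $ i *s ?e i) = v" by (rule basis_expansion)
    then have "det (\<chi> i. if i = k then v else ?e i) = v $ k"
      using cramer_lemma_transpose[of k v "mat 1"] by (simp only: rows) simp
    then show ?case by (simp only: empty_iff if_False)
  next
    case (insert a S)
    let ?A = "\<chi> i. if i = k then v else if i \<in> S then ?e i + u $ i *s v else ?e i"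
    have "(\<chi> i. if i = k then v else if i \<in> insert a S then ?e i + u $ i *s v else ?e i)
        = (\<chi> i. if i = a then row a ?A + u $ a *s row k ?A else row i ?A)"
      using insert by (auto simp: vec_eq_iff row_def)
    then show ?case
      using det_row_operation[of a k ?A "u $ a"] insert by auto
  qed
  \<comment> \<open>Rows are updated one at a time; by linearity in row \<open>k\<close> the update
    adds \<open>u $ k\<close> times the determinant of the previous step.\<close>
  have 2: "det (\<chi> i. if i \<in> S then ?e i + u $ i *s v else ?e i) = 1 + (\<Sum>i\<in>S. u $ i * v $ i)"
    if "finite S" for S
    using that
  proof (induction S)
    case empty
    have "(\<chi> i. ?e i) = (mat 1 :: real ^ 'n ^ 'n)"
      by (simp add: mat_def axis_def vec_eq_iff)
    then show ?case by simp
  next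
    case (insert k S)
    let ?c = "\<lambda>i. if i \<in> S then ?e i + u $ i *s v else ?e i"
    have "(\<chi> i. if i \<in> insert k S then ?e i + u $ i *s v else ?e i)
        = (\<chi> i. if i = k then ?e i + u $ i *s v else ?c i)"
      by (auto simp: vec_eq_iff)
    moreover have "(\<chi> i. if i = k then ?e i else ?c i) = (\<chi> i. ?c i)"
      using insert by (auto simp: vec_eq_iff)
    moreover have "det (\<chi> i. if i = k then u $ i *s v else ?c i) = u $ k * v $ k"
    proof -
      have "(\<chi> i. if i = k then u $ i *s v else ?c i) = (\<chi> i. if i = k then u $ k *s v else ?c i)"
        by (auto simp: vec_eq_iff)
      then show ?thesis
        using det_row_mul[of k "u $ k" "\<lambda>_. v" ?c] 1[of S k] insert by simp
    qed
    ultimately show ?case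
      using det_row_add[of k "\<lambda>i. ?e i" "\<lambda>i. u $ i *s v" ?c] insert by simp
  qed
  have "(\<chi> i j. (if i = j then 1 else 0) + u $ i * v $ j)
      = (\<chi> i. if i \<in> UNIV then ?e i + u $ i *s v else ?e i)"
    by (auto simp: vec_eq_iff axis_def)
  then show ?thesis using 2[of UNIV] by simp
qed

lemma det_hyp_metric: "det (hyp_metric y) = 1 / (V0 y * V0 y)"
proof -
  let ?u = "\<chi> i. - y $ i / (V0 y * V0 y)"
  have "hyp_metric y = (\<chi> i j. (if i = j then 1 else 0) + ?u $ i * y $ j)"
    by (simp add: vec_eq_iff hyp_metric_nth)
  then have "det (hyp_metric y) = 1 + (\<Sum>i\<in>UNIV. ?u $ i * y $ i)"
    by (simp only: det_rank_one_update)
  also have "\<dots> = 1 - (\<Sum>i\<in>UNIV. y $ i * y $ i) / (V0 y * V0 y)"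
    by (simp add: sum_negf sum_divide_distrib)
  also have "(\<Sum>i\<in>UNIV. y $ i * y $ i) = V0 y * V0 y - 1" by (simp add: V0_sq)
  finally show ?thesis by (simp add: diff_divide_distrib)
qed

text \<open>The metric factors as \<open>b\<close> times \<open>1 + V^2 grad f df^T\<close>, and the
  second factor has determinant \<open>slope^2\<close>.\<close>

lemma det_graph_metric: "det (graph_metric f y) = (slope f y / V0 y)\<^sup>2"
proof -
  let ?u = "\<chi> i. V0 y * V0 y * hyp_grad f i y" and ?v = "\<chi> j. pd j f y"
  have "graph_metric f y = hyp_metric y ** (\<chi> i j. (if i = j then 1 else 0) + ?u $ i * ?v $ j)"
  proof (simp add: vec_eq_iff matrix_matrix_mult_def, intro allI)
    fix i j
    have "(\<Sum>m\<in>UNIV. hyp_metric y $ i $ m * ((if m = j then 1 else 0) + V0 y * V0 y * hyp_grad f m y * pd j f y))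
       = (\<Sum>m\<in>UNIV. (if m = j then hyp_metric y $ i $ m else 0)
            + V0 y * V0 y * pd j f y * (hyp_metric y $ i $ m * hyp_grad f m y))"
      by (intro sum.cong refl) (simp add: algebra_simps)
    also have "\<dots> = graph_metric f y $ i $ j"
      by (simp only: sum.distrib sum_distrib_left[symmetric] hyp_grad_lower) (simp add: graph_metric_nth)
    finally show "graph_metric f y $ i $ j = (\<Sum>m\<in>UNIV. hyp_metric y $ i $ m *
        ((if m = j then 1 else 0) + V0 y * V0 y * hyp_grad f m y * pd j f y))" by simp
  qed
  then have "det (graph_metric f y) = 1 / (V0 y * V0 y) * (1 + (\<Sum>i\<in>UNIV. ?u $ i * ?v $ i))"
    by (simp only: det_mul det_rank_one_update det_hyp_metric)
  also have "(\<Sum>i\<in>UNIV. ?u $ i * ?v $ i) = V0 y * V0 y * hyp_grad_sq f y"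
    by (simp add: hyp_grad_sq_eq sum_distrib_left ac_simps)
  finally show ?thesis
    using slope_sq[of f y] by (simp add: power2_eq_square)
qed

lemma graph_metric_invertible: "invertible (graph_metric f y)"
  by (simp add: invertible_det_nz det_graph_metric)

section \<open>The Levi-Civita connection of the graph in closed form, and its curvature\<close>

context smooth_graph
begin

lemma pd_graph_metric:
  "pd i (\<lambda>y. graph_metric f y $ j $ l) y
    = - (hyp_metric y $ i $ j * pd l V0 y + pd j V0 y * hyp_metric y $ i $ l) / V0 y
      + 2 * V0 y * pd i V0 y * pd j f y * pd l f y
      + V0 y * V0 y * (pd i (pd j f) y * pd l f y + pd j f y * pd i (pd l f) y)"
  unfolding graph_metric_nth
  by (simp add: pd_smooth_add pd_smooth_mult smooth_hyp_metric smooth_V0 smooth_pd smooth_mult f pd_hyp_metric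
      algebra_simps)

text \<open>The Christoffel symbols of the first kind, with the lowered index in the last
  place.\<close>

definition christoffel1 :: "'n \<Rightarrow> 'n \<Rightarrow> 'n \<Rightarrow> real ^ 'n \<Rightarrow> real" where
  "christoffel1 i j l y = 1 / 2 * (pd i (\<lambda>y. graph_metric f y $ j $ l) y
     + pd j (\<lambda>y. graph_metric f y $ i $ l) y - pd l (\<lambda>y. graph_metric f y $ i $ j) y)"

lemma christoffel1_eq:
  "christoffel1 i j l y =
     V0 y * pd l f y * (V0 y * pd i (pd j f) y + pd i V0 y * pd j f y + pd j V0 y * pd i f y)
     - pd l V0 y / V0 y * graph_metric f y $ i $ j"
  unfolding christoffel1_def pd_graph_metric
  by (simp add: graph_metric_nth pd_swap[OF f, of j i] pd_swap[OF f, of l] hyp_metric_sym[of y j i]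
      hyp_metric_sym[of y l] field_simps)

lemma christoffel1_sym: "christoffel1 i j l y = christoffel1 j i l y"
  unfolding christoffel1_eq by (simp add: pd_swap[OF f, of i j] graph_metric_sym[of f y i j])

lemma pd_metric_christoffel1:
  "pd i (\<lambda>y. graph_metric f y $ j $ l) y = christoffel1 i j l y + christoffel1 i l j y"
  unfolding christoffel1_def by (simp add: graph_metric_sym[of f _ l j] field_simps)

definition christoffel2 :: "'n \<Rightarrow> 'n \<Rightarrow> 'n \<Rightarrow> real ^ 'n \<Rightarrow> real" where
  "christoffel2 m i j y = gauss_map f m y * second_form f i j y - y $ m * graph_metric f y $ i $ j"

text \<open>Lowered with \<open>g\<close>, \<open>a\<close> becomes a multiple of \<open>df\<close>,
  while \<open>y\<close> becomes \<open>d log V\<close> plus a multiple of \<open>df\<close>. The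
  latter multiple cancels the \<open>radial f\<close> term of \<open>second_form\<close>.\<close>

lemma christoffel2_lower: "(\<Sum>m\<in>UNIV. graph_metric f y $ l $ m * christoffel2 m i j y) = christoffel1 i j l y"
proof -
  have "(\<Sum>m\<in>UNIV. graph_metric f y $ l $ m * christoffel2 m i j y)
     = (\<Sum>m\<in>UNIV. graph_metric f y $ l $ m * gauss_map f m y) * second_form f i j y
       - (\<Sum>m\<in>UNIV. graph_metric f y $ l $ m * y $ m) * graph_metric f y $ i $ j"
    by (simp add: christoffel2_def sum_distrib_left sum_distrib_right sum_subtractf algebra_simps)
  also have "\<dots> = christoffel1 i j l y"
    unfolding gauss_map_lower graph_coord_lower christoffel1_eq second_form_def
    by (simp add: field_simps)
  finally show ?thesis .
qed

lemma christoffel_graph: "christoffel (graph_metric f) m i j = christoffel2 m i j"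
proof
  fix y
  show "christoffel (graph_metric f) m i j y = christoffel2 m i j y"
  proof -
    have "(\<Sum>l\<in>UNIV. matrix_inv (graph_metric f y) $ m $ l * christoffel1 i j l y) = christoffel2 m i j y"
      by (rule matrix_inv_cancel[OF graph_metric_invertible christoffel2_lower])
    then show ?thesis
      by (simp only: christoffel_def christoffel1_def sum_distrib_left) (simp only: ac_simps)
  qed
qed

lemma second_form_eq: "second_form f i j y = (\<Sum>m\<in>UNIV. graph_metric f y $ j $ m * pd i (gauss_map f m) y)"
  using shape_lower[of y j i] second_form_sym[of i j y] by simp

lemma second_form_eq': "second_form f i j = (\<lambda>y. \<Sum>m\<in>UNIV. graph_metric f y $ j $ m * pd i (gauss_map f m) y)"
  by (simp add: fun_eq_iff second_form_eq)

lemma smooth_second_form [smooth_intros]: "smooth_fun (second_form f i j)"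
  unfolding second_form_eq' by (intro smooth_intros)

text \<open>Both sides are the third fundamental form \<open>g (S d_i, S d_j)\<close> of the graph,
  with \<open>S\<close> the shape operator.\<close>

lemma third_form_sym:
  "(\<Sum>m\<in>UNIV. pd j (gauss_map f m) y * second_form f i m y)
    = (\<Sum>m\<in>UNIV. pd i (gauss_map f m) y * second_form f j m y)"
proof -
  have "(\<Sum>m\<in>UNIV. pd j (gauss_map f m) y * second_form f i m y)
    = (\<Sum>m\<in>UNIV. \<Sum>q\<in>UNIV. pd j (gauss_map f m) y * graph_metric f y $ m $ q * pd i (gauss_map f q) y)" for i j
    by (simp add: second_form_eq sum_distrib_left mult.assoc)
  note eq = this
  have "(\<Sum>m\<in>UNIV. pd j (gauss_map f m) y * second_form f i m y)
    = (\<Sum>q\<in>UNIV. \<Sum>m\<in>UNIV. pd j (gauss_map f m) y * graph_metric f y $ m $ q * pd i (gauss_map f q) y)"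
    unfolding eq by (rule sum.swap)
  also have "\<dots> = (\<Sum>m\<in>UNIV. pd i (gauss_map f m) y * second_form f j m y)"
    unfolding eq by (intro sum.cong refl) (simp add: graph_metric_sym[of f y] mult.commute mult.left_commute)
  finally show ?thesis .
qed

text \<open>The left-hand side is the difference of the covariant derivatives of \<open>h\<close> in
  the directions \<open>i\<close> and \<open>j\<close>; the Christoffel terms in which
  \<open>i\<close> and \<open>j\<close> are both lower indices have dropped out by symmetry. After
  the product rule the second partial derivatives of \<open>a\<close> cancel, and only first-kind
  Christoffel symbols times \<open>S\<close> remain.\<close>

lemma codazzi:
  "pd i (second_form f j s) y - pd j (second_form f i s) y
    + (\<Sum>p\<in>UNIV. second_form f i p y * christoffel2 p j s y) - (\<Sum>p\<in>UNIV. second_form f j p y * christoffel2 p i s y) = 0"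
proof -
  let ?S = "\<lambda>m i. pd i (gauss_map f m) y" and ?G = "\<lambda>i j. graph_metric f y $ i $ j"
  have 1: "pd i (second_form f j s) y = (\<Sum>m\<in>UNIV. (christoffel1 i s m y + christoffel1 i m s y) * ?S m j
      + ?G s m * pd i (pd j (gauss_map f m)) y)" for i j
    unfolding second_form_eq'
    by (subst pd_smooth_sum) (simp_all add: pd_smooth_mult smooth_graph_metric smooth_pd smooth_gauss_map smooth_mult
        pd_metric_christoffel1)
  have 2: "(\<Sum>p\<in>UNIV. second_form f i p y * christoffel2 p j s y) = (\<Sum>m\<in>UNIV. ?S m i * christoffel1 j s m y)" for i j
  proof -
    have "(\<Sum>p\<in>UNIV. second_form f i p y * christoffel2 p j s y)
        = (\<Sum>p\<in>UNIV. \<Sum>m\<in>UNIV. ?S m i * (?G m p * christoffel2 p j s y))"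
      unfolding second_form_eq sum_distrib_right
      by (intro sum.cong refl) (simp add: graph_metric_sym[of f y] mult.commute mult.left_commute)
    also have "\<dots> = (\<Sum>m\<in>UNIV. \<Sum>p\<in>UNIV. ?S m i * (?G m p * christoffel2 p j s y))"
      by (rule sum.swap)
    finally show ?thesis by (simp only: sum_distrib_left[symmetric] christoffel2_lower)
  qed
  have 3: "(\<Sum>m\<in>UNIV. ?S m j * christoffel1 i m s y)
     = (\<Sum>p\<in>UNIV. ?G s p * (gauss_map f p y * (\<Sum>m\<in>UNIV. ?S m j * second_form f i m y)
          - y $ p * second_form f j i y))" for i j
  proof -
    have "(\<Sum>m\<in>UNIV. ?S m j * christoffel1 i m s y) = (\<Sum>m\<in>UNIV. \<Sum>p\<in>UNIV. ?S m j * (?G s p * christoffel2 p i m y))"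
      by (simp only: christoffel2_lower[symmetric] sum_distrib_left)
    also have "\<dots> = (\<Sum>p\<in>UNIV. \<Sum>m\<in>UNIV. ?S m j * (?G s p * christoffel2 p i m y))"
      by (rule sum.swap)
    also have "\<dots> = (\<Sum>p\<in>UNIV. ?G s p * (gauss_map f p y * (\<Sum>m\<in>UNIV. ?S m j * second_form f i m y)
          - y $ p * (\<Sum>m\<in>UNIV. ?G i m * ?S m j)))"
      by (intro sum.cong refl) (simp add: christoffel2_def sum_distrib_left sum_subtractf algebra_simps)
    finally show ?thesis by (simp add: second_form_eq[of j i])
  qed
  \<comment> \<open>By 3, this sum involves only the third fundamental form and \<open>h\<close>,
    both symmetric in \<open>i\<close> and \<open>j\<close>.\<close>
  have 4: "(\<Sum>m\<in>UNIV. ?S m j * christoffel1 i m s y) = (\<Sum>m\<in>UNIV. ?S m i * christoffel1 j m s y)"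
    unfolding 3 third_form_sym[of j y i] second_form_sym[of j i y] ..
  have "pd i (second_form f j s) y - pd j (second_form f i s) y
    = (\<Sum>m\<in>UNIV. christoffel1 i s m y * ?S m j) - (\<Sum>m\<in>UNIV. christoffel1 j s m y * ?S m i)"
    using 4 unfolding 1
    by (simp add: pd_swap[OF smooth_gauss_map, of i j] sum.distrib sum_subtractf algebra_simps)
  then show ?thesis unfolding 2 by (simp add: mult.commute)
qed

text \<open>The same identity with \<open>g\<close> in place of \<open>h\<close>, now a consequence
  of metric compatibility. It disposes of the part \<open>y^m g_ij\<close> of the connection in the
  curvature.\<close>

lemma metric_codazzi:
  "pd i (\<lambda>y. graph_metric f y $ j $ s) y - pd j (\<lambda>y. graph_metric f y $ i $ s) y
    + (\<Sum>p\<in>UNIV. graph_metric f y $ i $ p * christoffel2 p j s y) - (\<Sum>p\<in>UNIV. graph_metric f y $ j $ p * christoffel2 p i s y) = 0"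
  unfolding christoffel2_lower pd_metric_christoffel1 by (simp add: christoffel1_sym[of j i])

lemma mod_riem_graph:
  "mod_riem (graph_metric f) i j l s y
    = second_form f l i y * second_form f j s y - second_form f l j y * second_form f i s y"
proof -
  let ?S = "\<lambda>m i. pd i (gauss_map f m) y" and ?G = "\<lambda>i j. graph_metric f y $ i $ j"
    and ?a = "\<lambda>m. gauss_map f m y" and ?h = "\<lambda>i j. second_form f i j y"
  have 1: "pd i (christoffel2 m j s) y = ?S m i * ?h j s + ?a m * pd i (second_form f j s) y
     - ((if i = m then 1 else 0) * ?G j s + y $ m * pd i (\<lambda>y. graph_metric f y $ j $ s) y)" for m i j
    unfolding christoffel2_def[abs_def]
    by (simp add: pd_smooth_diff pd_smooth_mult smooth_gauss_map smooth_second_form smooth_coord smooth_graph_metric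
        smooth_mult pd_coord)
  \<comment> \<open>The undifferentiated \<open>a^m\<close> multiplies the Codazzi expression of
    \<open>h\<close>, and the undifferentiated \<open>y^m\<close> that of \<open>g\<close>; both
    vanish. What is left comes from the derivatives of \<open>a^m\<close> and \<open>y^m\<close>.
    The latter are Kronecker deltas and produce the curvature of constant value -1 that
    \<open>mod_riem\<close> removes.\<close>
  have 2: "pd i (christoffel2 m j s) y - pd j (christoffel2 m i s) y
      + (\<Sum>p\<in>UNIV. christoffel2 m i p y * christoffel2 p j s y - christoffel2 m j p y * christoffel2 p i s y)
     = ?S m i * ?h j s - ?S m j * ?h i s
       - (if m = i then 1 else 0) * ?G j s + (if m = j then 1 else 0) * ?G i s" for m
  proof -
    have "(\<Sum>p\<in>UNIV. christoffel2 m i p y * christoffel2 p j s y - christoffel2 m j p y * christoffel2 p i s y)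
      = ?a m * ((\<Sum>p\<in>UNIV. ?h i p * christoffel2 p j s y) - (\<Sum>p\<in>UNIV. ?h j p * christoffel2 p i s y))
        - y $ m * ((\<Sum>p\<in>UNIV. ?G i p * christoffel2 p j s y) - (\<Sum>p\<in>UNIV. ?G j p * christoffel2 p i s y))"
      unfolding right_diff_distrib sum_distrib_left sum_subtractf[symmetric]
      by (intro sum.cong refl) (simp add: christoffel2_def[of m] algebra_simps)
    also have "(\<Sum>p\<in>UNIV. ?h i p * christoffel2 p j s y) - (\<Sum>p\<in>UNIV. ?h j p * christoffel2 p i s y)
       = pd j (second_form f i s) y - pd i (second_form f j s) y"
      using codazzi[of i j s y] by simp
    also have "(\<Sum>p\<in>UNIV. ?G i p * christoffel2 p j s y) - (\<Sum>p\<in>UNIV. ?G j p * christoffel2 p i s y)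
       = pd j (\<lambda>y. graph_metric f y $ i $ s) y - pd i (\<lambda>y. graph_metric f y $ j $ s) y"
      using metric_codazzi[of i j s y] by simp
    finally show ?thesis unfolding 1 by (simp only:) (simp add: algebra_simps)
  qed
  have "riem (graph_metric f) i j l s y
     = (\<Sum>m\<in>UNIV. ?G l m * ?S m i) * ?h j s - (\<Sum>m\<in>UNIV. ?G l m * ?S m j) * ?h i s
       - ?G l i * ?G j s + ?G l j * ?G i s"
  proof -
    have "riem (graph_metric f) i j l s y = (\<Sum>m\<in>UNIV. ?G l m * (?S m i * ?h j s - ?S m j * ?h i s
       - (if m = i then 1 else 0) * ?G j s + (if m = j then 1 else 0) * ?G i s))"
      unfolding riem_def christoffel_graph 2 ..
    also have "\<dots> = (\<Sum>m\<in>UNIV. ?G l m * ?S m i * ?h j s - ?G l m * ?S m j * ?h i s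
       - (if m = i then ?G l m * ?G j s else 0) + (if m = j then ?G l m * ?G i s else 0))"
      by (intro sum.cong refl) (simp add: algebra_simps)
    finally show ?thesis
      by (simp add: sum.distrib sum_subtractf sum_distrib_right[symmetric])
  qed
  then show ?thesis
    unfolding shape_lower mod_riem_def by (simp add: graph_metric_sym[of f y l])
qed

lemma mod_riem_up_graph:
  "mod_riem_up (graph_metric f) i j l s y
    = pd i (gauss_map f l) y * pd j (gauss_map f s) y - pd j (gauss_map f l) y * pd i (gauss_map f s) y"
proof -
  let ?I = "matrix_inv (graph_metric f y)"
  have raise: "(\<Sum>p\<in>UNIV. ?I $ l $ p * second_form f p i y) = pd i (gauss_map f l) y" for l i
    by (rule matrix_inv_cancel[OF graph_metric_invertible shape_lower])
  have "mod_riem_up (graph_metric f) i j l s y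
     = (\<Sum>p\<in>UNIV. ?I $ l $ p * second_form f p i y) * (\<Sum>q\<in>UNIV. ?I $ s $ q * second_form f q j y)
       - (\<Sum>p\<in>UNIV. ?I $ l $ p * second_form f p j y) * (\<Sum>q\<in>UNIV. ?I $ s $ q * second_form f q i y)"
    unfolding mod_riem_up_def mod_riem_graph sum_product sum_subtractf[symmetric]
    by (intro sum.cong refl) (simp add: second_form_sym[of j] second_form_sym[of i] algebra_simps)
  then show ?thesis unfolding raise .
qed

end

section \<open>Sums of minors and their divergence structure\<close>

abbreviation idx :: "nat \<Rightarrow> (nat \<Rightarrow> 'n::finite) set" where
  "idx r \<equiv> {..<r} \<rightarrow>\<^sub>E UNIV"

lemma finite_idx: "finite (idx r :: (nat \<Rightarrow> 'n::finite) set)"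
  by (intro finite_PiE) auto

lemma transpose_permutes: "p < r \<Longrightarrow> q < r \<Longrightarrow> Transposition.transpose p q permutes {..<r::nat}"
  by (rule permutes_swap_id) auto

lemma idx_transpose:
  assumes "p < r" "q < r" "J \<in> idx r"
  shows "J \<circ> Transposition.transpose p q \<in> idx r"
  using assms by (auto simp: PiE_iff extensional_def Transposition.transpose_def)

lemma sum_idx_transpose:
  assumes "p < r" "q < r"
  shows "(\<Sum>J\<in>idx r. F (J \<circ> Transposition.transpose p q)) = (\<Sum>J\<in>idx r. F J)"
  by (rule sum.reindex_bij_witness[of _ "\<lambda>J. J \<circ> Transposition.transpose p q" "\<lambda>J. J \<circ> Transposition.transpose p q"])
    (use assms in \<open>auto simp: idx_transpose comp_assoc\<close>)

text \<open>Two columns of the determinant are exchanged; the Leibniz sum is reindexed by composing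
  each permutation with the transposition.\<close>

lemma gen_delta_transpose_right:
  assumes "p < r" "q < r" "p \<noteq> q"
  shows "gen_delta r I (J \<circ> Transposition.transpose p q) = - gen_delta r I J"
proof -
  let ?t = "Transposition.transpose p q"
  have t: "?t permutes {..<r}" using assms by (intro transpose_permutes)
  have "gen_delta r I (J \<circ> ?t)
    = (\<Sum>\<pi> | \<pi> permutes {..<r}. - (of_int (sign (?t \<circ> \<pi>)) * (\<Prod>a<r. if I a = J ((?t \<circ> \<pi>) a) then 1 else 0)))"
    unfolding gen_delta_def
  proof (intro sum.cong refl)
    fix \<pi> assume "\<pi> \<in> {\<pi>. \<pi> permutes {..<r}}"
    then have "sign (?t \<circ> \<pi>) = - sign \<pi>"
      using assms by (simp add: sign_compose permutes_imp_permutation[OF finite_lessThan] permutation_swap_id sign_swap_id)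
    then show "real_of_int (sign \<pi>) * (\<Prod>a<r. if I a = (J \<circ> ?t) (\<pi> a) then 1 else 0)
      = - (real_of_int (sign (?t \<circ> \<pi>)) * (\<Prod>a<r. if I a = J ((?t \<circ> \<pi>) a) then 1 else 0))"
      by simp
  qed
  also have "\<dots> = - gen_delta r I J"
    unfolding sum_negf gen_delta_def
    using setum_permutations_compose_left[OF t,
        of "\<lambda>\<pi>. of_int (sign \<pi>) * (\<Prod>a<r. if I a = J (\<pi> a) then 1 else (0::real))"] by simp
  finally show ?thesis .
qed

lemma gen_delta_transpose_left:
  assumes "p < r" "q < r" "p \<noteq> q"
  shows "gen_delta r (I \<circ> Transposition.transpose p q) J = - gen_delta r I J"
proof -
  let ?t = "Transposition.transpose p q"
  have t: "?t permutes {..<r}" using assms by (intro transpose_permutes)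
  have "gen_delta r (I \<circ> ?t) J
    = (\<Sum>\<pi> | \<pi> permutes {..<r}. - (of_int (sign (\<pi> \<circ> ?t)) * (\<Prod>a<r. if I a = J ((\<pi> \<circ> ?t) a) then 1 else 0)))"
    unfolding gen_delta_def
  proof (intro sum.cong refl)
    fix \<pi> assume "\<pi> \<in> {\<pi>. \<pi> permutes {..<r}}"
    then have "sign (\<pi> \<circ> ?t) = - sign \<pi>"
      using assms by (simp add: sign_compose permutes_imp_permutation[OF finite_lessThan] permutation_swap_id sign_swap_id)
    moreover have "(\<Prod>a<r. if (I \<circ> ?t) a = J (\<pi> a) then 1 else 0)
       = (\<Prod>a<r. if I a = J ((\<pi> \<circ> ?t) a) then 1 else (0::real))"
      using prod.permute[OF t, of "\<lambda>a. if I a = J ((\<pi> \<circ> ?t) a) then 1 else (0::real)"] by (simp add: o_def)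
    ultimately show "real_of_int (sign \<pi>) * (\<Prod>a<r. if (I \<circ> ?t) a = J (\<pi> a) then 1 else 0)
      = - (real_of_int (sign (\<pi> \<circ> ?t)) * (\<Prod>a<r. if I a = J ((\<pi> \<circ> ?t) a) then 1 else 0))"
      by simp
  qed
  also have "\<dots> = - gen_delta r I J"
    unfolding sum_negf gen_delta_def
    using sum_permutations_compose_right[OF t,
        of "\<lambda>\<pi>. of_int (sign \<pi>) * (\<Prod>a<r. if I a = J (\<pi> a) then 1 else (0::real))"] by simp
  finally show ?thesis .
qed

text \<open>Against an alternating \<open>D\<close>, the two terms of each 2 by 2 minor contribute
  equally, so each of the \<open>m\<close> pairs yields a factor 2. These factors cancel the powers
  of 2 in \<open>mod_L\<close> and, up to one of them, in \<open>mod_P\<close>. \<open>R\<close>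
  stands for further factors that do not notice the exchanges within the pairs.\<close>

lemma sum_alternating_pairs:
  fixes D R :: "(nat \<Rightarrow> 'n::finite) \<Rightarrow> real" and u :: "nat \<Rightarrow> 'n \<Rightarrow> real"
  assumes "2 * m \<le> r"
    and "\<And>J a. a < m \<Longrightarrow> D (J \<circ> Transposition.transpose (2 * a) (2 * a + 1)) = - D J"
    and "\<And>J a. a < m \<Longrightarrow> R (J \<circ> Transposition.transpose (2 * a) (2 * a + 1)) = R J"
  shows "(\<Sum>J\<in>idx r. D J * (\<Prod>a<m. u (2 * a) (J (2 * a)) * u (2 * a + 1) (J (2 * a + 1))
             - u (2 * a + 1) (J (2 * a)) * u (2 * a) (J (2 * a + 1))) * R J)
    = 2 ^ m * (\<Sum>J\<in>idx r. D J * (\<Prod>c<2 * m. u c (J c)) * R J)"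
  using assms
proof (induction m arbitrary: R)
  case (Suc m)
  define X where "X J = u (2 * m) (J (2 * m)) * u (2 * m + 1) (J (2 * m + 1))" for J
  define Y where "Y J = u (2 * m + 1) (J (2 * m)) * u (2 * m) (J (2 * m + 1))" for J
  define Q where "Q J = (\<Prod>a<m. u (2 * a) (J (2 * a)) * u (2 * a + 1) (J (2 * a + 1))
             - u (2 * a + 1) (J (2 * a)) * u (2 * a) (J (2 * a + 1)))" for J
  let ?t = "Transposition.transpose (2 * m) (2 * m + 1)"
  have fix1: "Transposition.transpose (2 * a) (2 * a + 1) (2 * m) = 2 * m"
    "Transposition.transpose (2 * a) (2 * a + 1) (2 * m + 1) = 2 * m + 1" if "a < m" for a
    using that by (auto simp: Transposition.transpose_def)
  have fix2: "?t (2 * a) = 2 * a" "?t (2 * a + 1) = 2 * a + 1" if "a < m" for a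
    using that by (auto simp: Transposition.transpose_def)
  \<comment> \<open>Renaming the slots \<open>2 * m\<close> and \<open>2 * m + 1\<close> turns
    \<open>Y\<close> into \<open>X\<close> at the price of the sign of \<open>D\<close>, so
    \<open>X - Y\<close> counts \<open>X\<close> twice.\<close>
  have "(\<Sum>J\<in>idx r. D J * Q J * Y J * R J) = (\<Sum>J\<in>idx r. D (J \<circ> ?t) * Q (J \<circ> ?t) * Y (J \<circ> ?t) * R (J \<circ> ?t))"
    using Suc.prems(1) sum_idx_transpose[of "2 * m" r "2 * m + 1" "\<lambda>J. D J * Q J * Y J * R J"] by simp
  also have "\<dots> = (\<Sum>J\<in>idx r. - (D J * Q J * (X J * R J)))"
  proof (intro sum.cong refl)
    fix J
    have "Q (J \<circ> ?t) = Q J"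
      unfolding Q_def by (intro prod.cong refl) (simp add: fix2[simplified])
    moreover have "Y (J \<circ> ?t) = X J" by (simp add: X_def Y_def)
    ultimately show "D (J \<circ> ?t) * Q (J \<circ> ?t) * Y (J \<circ> ?t) * R (J \<circ> ?t) = - (D J * Q J * (X J * R J))"
      unfolding Suc.prems(2)[OF lessI] Suc.prems(3)[OF lessI] by simp
  qed
  finally have "(\<Sum>J\<in>idx r. D J * (Q J * (X J - Y J)) * R J) = 2 * (\<Sum>J\<in>idx r. D J * Q J * (X J * R J))"
    by (simp add: algebra_simps sum_subtractf sum_negf)
  \<comment> \<open>The last pair, now a plain product, is absorbed into \<open>R\<close>; for this
    reason the induction is over arbitrary \<open>R\<close>.\<close>
  also have "(\<Sum>J\<in>idx r. D J * Q J * (X J * R J))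
     = 2 ^ m * (\<Sum>J\<in>idx r. D J * (\<Prod>c<2 * m. u c (J c)) * (X J * R J))"
    unfolding Q_def
  proof (rule Suc.IH)
    fix J a assume a: "a < m"
    let ?s = "Transposition.transpose (2 * a) (2 * a + 1)"
    have "R (J \<circ> ?s) = R J" by (rule Suc.prems(3)) (use a in simp)
    moreover have "X (J \<circ> ?s) = X J" using fix1[OF a] by (simp add: X_def)
    ultimately show "X (J \<circ> ?s) * R (J \<circ> ?s) = X J * R J" by simp
  qed (use Suc.prems in auto)
  finally show ?case
    by (simp add: X_def Y_def Q_def mult.assoc)
qed simp

text \<open>This is \<open>r!\<close> times the \<open>r\<close>-th elementary symmetric function of
  the Jacobian of \<open>a\<close>, the sum of its principal minors of size
  \<open>r\<close>.\<close>

definition minor_sum :: "nat \<Rightarrow> ('n::finite \<Rightarrow> real ^ 'n \<Rightarrow> real) \<Rightarrow> real ^ 'n \<Rightarrow> real" where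
  "minor_sum r a y = (\<Sum>I\<in>idx r. \<Sum>J\<in>idx r. gen_delta r I J * (\<Prod>c<r. pd (I c) (a (J c)) y))"

text \<open>Up to a factorial, the Newton tensor of the Jacobian applied to \<open>a\<close>: slot
  \<open>q\<close> loses its derivative, and the index of that derivative becomes the direction
  \<open>i\<close> of the field. The slot is a parameter because the mass integrand leaves the bare
  \<open>a\<close> in the last slot but one.\<close>

definition minor_field ::
  "nat \<Rightarrow> nat \<Rightarrow> ('n::finite \<Rightarrow> real ^ 'n \<Rightarrow> real) \<Rightarrow> 'n \<Rightarrow> real ^ 'n \<Rightarrow> real" where
  "minor_field r q a i y = (\<Sum>I\<in>{I \<in> idx r. I q = i}. \<Sum>J\<in>idx r.
     gen_delta r I J * ((\<Prod>c\<in>{..<r} - {q}. pd (I c) (a (J c)) y) * a (J q) y))"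

lemma smooth_minor_sum [smooth_intros]: "(\<And>m. smooth_fun (a m)) \<Longrightarrow> smooth_fun (minor_sum r a)"
  unfolding minor_sum_def[abs_def] by (intro smooth_intros)

lemma smooth_minor_field [smooth_intros]: "(\<And>m. smooth_fun (a m)) \<Longrightarrow> smooth_fun (minor_field r q a i)"
  unfolding minor_field_def[abs_def] by (intro smooth_intros)

lemma pd_smooth_prod:
  assumes "finite A" "\<And>c. c \<in> A \<Longrightarrow> smooth_fun (F c)"
  shows "pd i (\<lambda>x. \<Prod>c\<in>A. F c x) x = (\<Sum>c\<in>A. pd i (F c) x * (\<Prod>d\<in>A - {c}. F d x))"
  using assms
proof (induction A)
  case (insert c A)
  have "pd i (\<lambda>x. F c x * (\<Prod>d\<in>A. F d x)) x
     = pd i (F c) x * (\<Prod>d\<in>A. F d x) + F c x * (\<Sum>d\<in>A. pd i (F d) x * (\<Prod>e\<in>A - {d}. F e x))"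
    using insert by (subst pd_smooth_mult) (simp_all add: smooth_prod)
  also have "F c x * (\<Sum>d\<in>A. pd i (F d) x * (\<Prod>e\<in>A - {d}. F e x))
     = (\<Sum>d\<in>A. pd i (F d) x * (\<Prod>e\<in>insert c A - {d}. F e x))"
    unfolding sum_distrib_left
  proof (intro sum.cong refl)
    fix d assume "d \<in> A"
    then have "insert c A - {d} = insert c (A - {d})" using insert by auto
    then show "F c x * (pd i (F d) x * (\<Prod>e\<in>A - {d}. F e x)) = pd i (F d) x * (\<Prod>e\<in>insert c A - {d}. F e x)"
      using insert by simp
  qed
  finally show ?case using insert by simp
qed simp

text \<open>If the derivative falls on the bare \<open>a\<close> in slot \<open>q\<close>, the
  minors appear. If it falls on the factor in slot \<open>c\<close>, the second partial derivative
  is symmetric under exchanging the slots \<open>q\<close> and \<open>c\<close> of \<open>I\<close>,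
  whereas \<open>gen_delta\<close> changes its sign, and the sum vanishes.\<close>

lemma minor_field_divergence:
  assumes a: "\<And>m. smooth_fun (a m)" and q: "q < r"
  shows "(\<Sum>i\<in>UNIV. pd i (minor_field r q a i) y) = minor_sum r a y"
proof -
  let ?P = "\<lambda>I J A. \<Prod>d\<in>A. pd (I d) (a (J d)) y"
  let ?H = "\<lambda>c I J. pd (I q) (pd (I c) (a (J c))) y * ?P I J ({..<r} - {q} - {c}) * a (J q) y"
  have pd_term: "pd i (\<lambda>y. (\<Prod>c\<in>{..<r} - {q}. pd (I c) (a (J c)) y) * a (J q) y) y
     = (\<Sum>c\<in>{..<r} - {q}. ?H c I J) + (\<Prod>c<r. pd (I c) (a (J c)) y)" if "I q = i" for i I J
  proof -
    have "(\<Prod>c<r. pd (I c) (a (J c)) y) = pd (I q) (a (J q)) y * ?P I J ({..<r} - {q})"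
      using q by (simp add: prod.remove[of "{..<r}" q])
    then show ?thesis using that
      by (simp add: pd_smooth_mult pd_smooth_prod a smooth_pd smooth_prod sum_distrib_left mult.commute)
  qed
  have "pd i (minor_field r q a i) y = (\<Sum>I\<in>{I \<in> idx r. I q = i}. \<Sum>J\<in>idx r.
     gen_delta r I J * ((\<Sum>c\<in>{..<r} - {q}. ?H c I J) + (\<Prod>c<r. pd (I c) (a (J c)) y)))" for i
  proof -
    have s: "smooth_fun (\<lambda>y. (\<Prod>c\<in>{..<r} - {q}. pd (I c) (a (J c)) y) * a (J q) y)" for I J
      by (intro smooth_intros a)
    have "pd i (minor_field r q a i) y = (\<Sum>I\<in>{I \<in> idx r. I q = i}. \<Sum>J\<in>idx r.
       gen_delta r I J * pd i (\<lambda>y. (\<Prod>c\<in>{..<r} - {q}. pd (I c) (a (J c)) y) * a (J q) y) y)"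
      unfolding minor_field_def[abs_def] by (simp add: pd_smooth_sum pd_smooth_mult s smooth_const smooth_mult smooth_sum)
    then show ?thesis using pd_term by simp
  qed
  \<comment> \<open>The sets of multi-indices with \<open>I q = i\<close>, for all \<open>i\<close>,
    partition \<open>idx r\<close>.\<close>
  then have "(\<Sum>i\<in>UNIV. pd i (minor_field r q a i) y) = (\<Sum>I\<in>idx r. \<Sum>J\<in>idx r.
     gen_delta r I J * ((\<Sum>c\<in>{..<r} - {q}. ?H c I J) + (\<Prod>c<r. pd (I c) (a (J c)) y)))"
    by (simp only: sum.group[OF finite_idx finite subset_UNIV])
  also have "\<dots> = (\<Sum>c\<in>{..<r} - {q}. \<Sum>I\<in>idx r. \<Sum>J\<in>idx r. gen_delta r I J * ?H c I J) + minor_sum r a y"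
  proof -
    have "(\<Sum>c\<in>{..<r} - {q}. \<Sum>I\<in>idx r. \<Sum>J\<in>idx r. gen_delta r I J * ?H c I J)
       = (\<Sum>I\<in>idx r. \<Sum>c\<in>{..<r} - {q}. \<Sum>J\<in>idx r. gen_delta r I J * ?H c I J)"
      by (rule sum.swap)
    also have "\<dots> = (\<Sum>I\<in>idx r. \<Sum>J\<in>idx r. \<Sum>c\<in>{..<r} - {q}. gen_delta r I J * ?H c I J)"
      by (intro sum.cong refl sum.swap)
    finally show ?thesis
      unfolding minor_sum_def by (simp add: distrib_left sum.distrib sum_distrib_left)
  qed
  also have "(\<Sum>c\<in>{..<r} - {q}. \<Sum>I\<in>idx r. \<Sum>J\<in>idx r. gen_delta r I J * ?H c I J) = 0"
  proof (rule sum.neutral, intro ballI)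
    fix c assume c: "c \<in> {..<r} - {q}"
    let ?t = "Transposition.transpose q c"
    have H: "?H c (I \<circ> ?t) J = ?H c I J" for I J
    proof -
      have "?P (I \<circ> ?t) J ({..<r} - {q} - {c}) = ?P I J ({..<r} - {q} - {c})"
        by (intro prod.cong refl) (simp add: Transposition.transpose_def)
      then show ?thesis by (simp add: pd_swap[OF a, of "I q"])
    qed
    have "(\<Sum>I\<in>idx r. \<Sum>J\<in>idx r. gen_delta r I J * ?H c I J)
       = (\<Sum>I\<in>idx r. \<Sum>J\<in>idx r. gen_delta r (I \<circ> ?t) J * ?H c (I \<circ> ?t) J)"
      using c q sum_idx_transpose[of q r c "\<lambda>I. \<Sum>J\<in>idx r. gen_delta r I J * ?H c I J"] by simp
    also have "\<dots> = - (\<Sum>I\<in>idx r. \<Sum>J\<in>idx r. gen_delta r I J * ?H c I J)"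
      unfolding H using c q by (simp add: gen_delta_transpose_left sum_negf)
    finally show "(\<Sum>I\<in>idx r. \<Sum>J\<in>idx r. gen_delta r I J * ?H c I J) = 0" by simp
  qed
  finally show ?thesis by simp
qed

section \<open>The flux integrand\<close>

text \<open>Hyperbolic space is itself the graph of the function 0, for which \<open>a\<close>
  vanishes and only the second term of \<open>christoffel2\<close> survives.\<close>

lemma christoffel_hyp: "christoffel hyp_metric m i j y = - y $ m * hyp_metric y $ i $ j"
proof -
  interpret smooth_graph "\<lambda>_. 0 :: real" by unfold_locales (rule smooth_const)
  have "hyp_grad (\<lambda>_. 0) m y = 0" by (simp add: hyp_grad_def radial_def)
  then show ?thesis
    using christoffel_graph[of m i j] by (simp add: graph_metric_const christoffel2_def gauss_map_def)
qed

section \<open>The tensor \<open>mod_P\<close> of a graph and its contraction with the derivative of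
  \<open>e\<close>\<close>

context smooth_graph
begin

abbreviation "shape m i y \<equiv> pd i (gauss_map f m) y"

lemma mod_L_graph: "mod_L k (graph_metric f) y = minor_sum (2 * k) (gauss_map f) y"
proof -
  have "(\<Sum>J\<in>idx (2 * k). gen_delta (2 * k) I J *
      (\<Prod>a<k. mod_riem_up (graph_metric f) (I (2 * a)) (I (2 * a + 1)) (J (2 * a)) (J (2 * a + 1)) y))
    = 2 ^ k * (\<Sum>J\<in>idx (2 * k). gen_delta (2 * k) I J * (\<Prod>c<2 * k. shape (J c) (I c) y))" for I
    using sum_alternating_pairs[of k "2 * k" "gen_delta (2 * k) I" "\<lambda>_. 1" "\<lambda>c l. shape l (I c) y"]
    by (simp only: mod_riem_up_graph) (simp add: gen_delta_transpose_right)
  then show ?thesis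
    by (simp add: mod_L_def minor_sum_def sum_distrib_left[symmetric])
qed

text \<open>For \<open>k = Suc m\<close> there are \<open>m\<close> curvature factors, occupying the
  slots below \<open>2 * m\<close>; the last two slots carry \<open>i\<close>, \<open>j\<close> and
  the two inverse metrics. Of the constant \<open>1 / 2 ^ Suc m\<close> a factor 1/2 is left, the
  one that appears in the mass formula.\<close>

lemma mod_P_graph:
  "mod_P (Suc m) (graph_metric f) i j l s y = 1 / 2 * (\<Sum>I\<in>idx (2 * m). \<Sum>J\<in>idx (2 * m + 2).
     gen_delta (2 * m + 2) (I(2 * m := i, 2 * m + 1 := j)) J * (\<Prod>c<2 * m. shape (J c) (I c) y) *
     (matrix_inv (graph_metric f y) $ J (2 * m) $ l * matrix_inv (graph_metric f y) $ J (2 * m + 1) $ s))"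
proof -
  let ?I = "\<lambda>I. I(2 * m := i, 2 * m + 1 := j)" and ?M = "matrix_inv (graph_metric f y)"
  have "(\<Sum>J\<in>idx (2 * m + 2). gen_delta (2 * m + 2) (?I I) J *
      (\<Prod>a<m. shape (J (2 * a)) (I (2 * a)) y * shape (J (2 * a + 1)) (I (2 * a + 1)) y
        - shape (J (2 * a)) (I (2 * a + 1)) y * shape (J (2 * a + 1)) (I (2 * a)) y) *
      (?M $ J (2 * m) $ l * ?M $ J (2 * m + 1) $ s))
    = 2 ^ m * (\<Sum>J\<in>idx (2 * m + 2). gen_delta (2 * m + 2) (?I I) J *
      (\<Prod>c<2 * m. shape (J c) (I c) y) * (?M $ J (2 * m) $ l * ?M $ J (2 * m + 1) $ s))" for I
  proof (rule sum_alternating_pairs[where u = "\<lambda>c l. shape l (I c) y"])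
    fix J and a assume "a < m"
    then have "Transposition.transpose (2 * a) (2 * a + 1) (2 * m) = 2 * m"
      "Transposition.transpose (2 * a) (2 * a + 1) (2 * m + 1) = 2 * m + 1"
      by (auto simp: Transposition.transpose_def)
    then show "?M $ (J \<circ> Transposition.transpose (2 * a) (2 * a + 1)) (2 * m) $ l *
        ?M $ (J \<circ> Transposition.transpose (2 * a) (2 * a + 1)) (2 * m + 1) $ s
      = ?M $ J (2 * m) $ l * ?M $ J (2 * m + 1) $ s" by (simp only: o_apply)
  qed (simp_all add: gen_delta_transpose_right)
  note step = this
  have "mod_P (Suc m) (graph_metric f) i j l s y = 1 / 2 ^ Suc m * (\<Sum>I\<in>idx (2 * m). \<Sum>J\<in>idx (2 * m + 2).
      gen_delta (2 * m + 2) (?I I) J *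
      (\<Prod>a<m. shape (J (2 * a)) (I (2 * a)) y * shape (J (2 * a + 1)) (I (2 * a + 1)) y
        - shape (J (2 * a)) (I (2 * a + 1)) y * shape (J (2 * a + 1)) (I (2 * a)) y) *
      (?M $ J (2 * m) $ l * ?M $ J (2 * m + 1) $ s))"
    by (simp add: mod_P_def mod_riem_up_graph mult.assoc)
  then show ?thesis
    unfolding step by (simp add: sum_distrib_left[symmetric])
qed

text \<open>Exchanging the last two slots of \<open>J\<close> exchanges the roles of
  \<open>l\<close> and \<open>s\<close>.\<close>

lemma mod_P_antisym:
  "mod_P (Suc m) (graph_metric f) i j s l y = - mod_P (Suc m) (graph_metric f) i j l s y"
proof -
  let ?t = "Transposition.transpose (2 * m) (2 * m + 1)"
  let ?M = "matrix_inv (graph_metric f y)"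
  have "(\<Sum>J\<in>idx (2 * m + 2). gen_delta (2 * m + 2) I' J * (\<Prod>c<2 * m. shape (J c) (I c) y) *
      (?M $ J (2 * m) $ s * ?M $ J (2 * m + 1) $ l))
    = - (\<Sum>J\<in>idx (2 * m + 2). gen_delta (2 * m + 2) I' J * (\<Prod>c<2 * m. shape (J c) (I c) y) *
      (?M $ J (2 * m) $ l * ?M $ J (2 * m + 1) $ s))" (is "(\<Sum>J\<in>_. ?F J) = - (\<Sum>J\<in>_. ?G J)") for I I'
  proof -
    have "(\<Sum>J\<in>idx (2 * m + 2). ?F J) = (\<Sum>J\<in>idx (2 * m + 2). ?F (J \<circ> ?t))"
      by (rule sum_idx_transpose[symmetric]) auto
    also have "\<dots> = (\<Sum>J\<in>idx (2 * m + 2). - ?G J)"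
    proof (intro sum.cong refl)
      fix J
      have "(\<Prod>c<2 * m. shape ((J \<circ> ?t) c) (I c) y) = (\<Prod>c<2 * m. shape (J c) (I c) y)"
        by (intro prod.cong refl) (simp add: Transposition.transpose_def)
      moreover have "gen_delta (2 * m + 2) I' (J \<circ> ?t) = - gen_delta (2 * m + 2) I' J"
        by (rule gen_delta_transpose_right) auto
      moreover have "(J \<circ> ?t) (2 * m) = J (2 * m + 1)" "(J \<circ> ?t) (2 * m + 1) = J (2 * m)"
        by (simp_all add: Transposition.transpose_def)
      ultimately show "?F (J \<circ> ?t) = - ?G J" by (simp only:) simp
    qed
    finally show ?thesis by (simp add: sum_negf)
  qed
  note swap = this
  show ?thesis unfolding mod_P_graph swap by (simp add: sum_negf)
qed

lemma mod_P_contract_sym: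
  assumes "\<And>l s. B l s = B s l"
  shows "(\<Sum>l\<in>UNIV. \<Sum>s\<in>UNIV. B l s * mod_P (Suc m) (graph_metric f) i j l s y) = 0"
proof -
  have "(\<Sum>l\<in>UNIV. \<Sum>s\<in>UNIV. B l s * mod_P (Suc m) (graph_metric f) i j l s y)
    = (\<Sum>l\<in>UNIV. \<Sum>s\<in>UNIV. B s l * mod_P (Suc m) (graph_metric f) i j s l y)"
    by (rule sum.swap)
  also have "\<dots> = - (\<Sum>l\<in>UNIV. \<Sum>s\<in>UNIV. B l s * mod_P (Suc m) (graph_metric f) i j l s y)"
  proof -
    have "B s l * mod_P (Suc m) (graph_metric f) i j s l y
        = - (B l s * mod_P (Suc m) (graph_metric f) i j l s y)" for l s
      by (simp only: assms[of s l] mod_P_antisym[of m i j s l y] mult_minus_right)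
    note eq = this
    show ?thesis unfolding sum_negf[symmetric] by (intro sum.cong refl eq)
  qed
  finally show ?thesis by simp
qed

lemma raise_gauss_map:
  "(\<Sum>l\<in>UNIV. matrix_inv (graph_metric f y) $ p $ l * (V0 y * slope f y * pd l f y)) = gauss_map f p y"
  by (rule matrix_inv_cancel[OF graph_metric_invertible gauss_map_lower])

lemma raise_second_form:
  "(\<Sum>s\<in>UNIV. matrix_inv (graph_metric f y) $ p $ s * second_form f s j y) = shape p j y"
  by (rule matrix_inv_cancel[OF graph_metric_invertible shape_lower])

text \<open>The contraction over \<open>l\<close> raises \<open>V slope df\<close> to
  \<open>a\<close>, and the one over \<open>s\<close> raises \<open>h\<close> to the Jacobian. Slot
  \<open>2 * m\<close> then holds a bare \<open>a\<close> and slot \<open>2 * m + 1\<close> the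
  derivative in direction \<open>j\<close>, which is the field with
  \<open>q = 2 * m\<close>.\<close>

lemma mod_P_contract_minor_field:
  "(\<Sum>j\<in>UNIV. \<Sum>l\<in>UNIV. \<Sum>s\<in>UNIV. V0 y * slope f y * pd l f y * second_form f s j y
      * mod_P (Suc m) (graph_metric f) i j l s y)
    = 1 / 2 * minor_field (2 * m + 2) (2 * m) (gauss_map f) i y"
proof -
  let ?M = "matrix_inv (graph_metric f y)" and ?w = "\<lambda>l. V0 y * slope f y * pd l f y"
  let ?K = "\<lambda>I I' J. gen_delta (2 * m + 2) I' J * (\<Prod>c<2 * m. shape (J c) (I c) y)"
  let ?I = "\<lambda>I j. I(2 * m := i, 2 * m + 1 := j)"
  have 1: "(\<Sum>l\<in>UNIV. \<Sum>s\<in>UNIV. ?w l * second_form f s j y * mod_P (Suc m) (graph_metric f) i j l s y)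
     = 1 / 2 * (\<Sum>I\<in>idx (2 * m). \<Sum>J\<in>idx (2 * m + 2).
         ?K I (?I I j) J * (gauss_map f (J (2 * m)) y * shape (J (2 * m + 1)) j y))" for j
  proof -
    have "(\<Sum>l\<in>UNIV. \<Sum>s\<in>UNIV. ?w l * second_form f s j y * mod_P (Suc m) (graph_metric f) i j l s y)
      = (\<Sum>l\<in>UNIV. \<Sum>s\<in>UNIV. \<Sum>I\<in>idx (2 * m). \<Sum>J\<in>idx (2 * m + 2).
          1 / 2 * (?K I (?I I j) J * ((?M $ J (2 * m) $ l * ?w l) * (?M $ J (2 * m + 1) $ s * second_form f s j y))))"
      unfolding mod_P_graph sum_distrib_left
      by (intro sum.cong refl) (simp add: mult.commute mult.left_commute)
    \<comment> \<open>The sums over \<open>l\<close> and \<open>s\<close> are moved inwards one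
      exchange at a time, until they act on the two inverse metrics alone.\<close>
    also have "\<dots> = (\<Sum>l\<in>UNIV. \<Sum>I\<in>idx (2 * m). \<Sum>s\<in>UNIV. \<Sum>J\<in>idx (2 * m + 2).
          1 / 2 * (?K I (?I I j) J * ((?M $ J (2 * m) $ l * ?w l) * (?M $ J (2 * m + 1) $ s * second_form f s j y))))"
      by (intro sum.cong refl sum.swap)
    also have "\<dots> = (\<Sum>I\<in>idx (2 * m). \<Sum>l\<in>UNIV. \<Sum>s\<in>UNIV. \<Sum>J\<in>idx (2 * m + 2).
          1 / 2 * (?K I (?I I j) J * ((?M $ J (2 * m) $ l * ?w l) * (?M $ J (2 * m + 1) $ s * second_form f s j y))))"
      by (rule sum.swap)
    also have "\<dots> = (\<Sum>I\<in>idx (2 * m). \<Sum>l\<in>UNIV. \<Sum>J\<in>idx (2 * m + 2). \<Sum>s\<in>UNIV.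
          1 / 2 * (?K I (?I I j) J * ((?M $ J (2 * m) $ l * ?w l) * (?M $ J (2 * m + 1) $ s * second_form f s j y))))"
      by (intro sum.cong refl sum.swap)
    also have "\<dots> = (\<Sum>I\<in>idx (2 * m). \<Sum>J\<in>idx (2 * m + 2). \<Sum>l\<in>UNIV. \<Sum>s\<in>UNIV.
          1 / 2 * (?K I (?I I j) J * ((?M $ J (2 * m) $ l * ?w l) * (?M $ J (2 * m + 1) $ s * second_form f s j y))))"
      by (intro sum.cong refl sum.swap)
    also have "\<dots> = (\<Sum>I\<in>idx (2 * m). \<Sum>J\<in>idx (2 * m + 2). 1 / 2 * (?K I (?I I j) J *
         ((\<Sum>l\<in>UNIV. ?M $ J (2 * m) $ l * ?w l) * (\<Sum>s\<in>UNIV. ?M $ J (2 * m + 1) $ s * second_form f s j y))))"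
      by (simp only: sum_product) (simp only: sum_distrib_left)
    finally show ?thesis
      by (simp only: raise_gauss_map raise_second_form sum_distrib_left)
  qed
  have 2: "(\<Sum>j\<in>UNIV. \<Sum>I\<in>idx (2 * m). \<Sum>J\<in>idx (2 * m + 2).
         ?K I (?I I j) J * (gauss_map f (J (2 * m)) y * shape (J (2 * m + 1)) j y))
      = minor_field (2 * m + 2) (2 * m) (gauss_map f) i y"
  proof -
    have set_eq: "{..<2 * m + 2} - {2 * m} = insert (2 * m + 1) {..<2 * m}" by auto
    have "(\<Sum>j\<in>UNIV. \<Sum>I\<in>idx (2 * m). \<Sum>J\<in>idx (2 * m + 2).
         ?K I (?I I j) J * (gauss_map f (J (2 * m)) y * shape (J (2 * m + 1)) j y))
       = (\<Sum>(j, I)\<in>UNIV \<times> idx (2 * m). \<Sum>J\<in>idx (2 * m + 2).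
         ?K I (?I I j) J * (gauss_map f (J (2 * m)) y * shape (J (2 * m + 1)) j y))"
      by (rule sum.cartesian_product)
    also have "\<dots> = minor_field (2 * m + 2) (2 * m) (gauss_map f) i y"
      unfolding minor_field_def
    \<comment> \<open>A multi-index with value \<open>i\<close> at \<open>2 * m\<close> amounts to
      its restriction to the slots below \<open>2 * m\<close> and its value \<open>j\<close> at
      \<open>2 * m + 1\<close>.\<close>
    proof (rule sum.reindex_bij_witness[of _
          "\<lambda>I. (I (2 * m + 1), restrict I {..<2 * m})" "\<lambda>(j, I). ?I I j"])
      fix I :: "nat \<Rightarrow> 'n" assume I: "I \<in> {I \<in> idx (2 * m + 2). I (2 * m) = i}"
      then show "(case (I (2 * m + 1), restrict I {..<2 * m}) of (j, I) \<Rightarrow> ?I I j) = I"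
        by (auto simp: PiE_iff extensional_def restrict_def fun_eq_iff less_Suc_eq)
    next
      fix jI :: "'n \<times> (nat \<Rightarrow> 'n)" assume "jI \<in> UNIV \<times> idx (2 * m)"
      then obtain j I where jI: "jI = (j, I)" "I \<in> idx (2 * m)" by auto
      then show "((case jI of (j, I) \<Rightarrow> ?I I j) (2 * m + 1),
          restrict (case jI of (j, I) \<Rightarrow> ?I I j) {..<2 * m}) = jI"
        by (auto simp: PiE_iff extensional_def restrict_def fun_eq_iff)
    next
      fix jI :: "'n \<times> (nat \<Rightarrow> 'n)" assume "jI \<in> UNIV \<times> idx (2 * m)"
      then obtain j I where jI: "jI = (j, I)" "I \<in> idx (2 * m)" by auto
      then have "I c = undefined" if "c \<ge> 2 * m" for c using that by (simp add: PiE_iff extensional_def)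
      then show "(case jI of (j, I) \<Rightarrow> ?I I j) \<in> {I \<in> idx (2 * m + 2). I (2 * m) = i}"
        unfolding jI(1) by (simp add: PiE_iff extensional_def)
    next
      fix I :: "nat \<Rightarrow> 'n"
      show "(I (2 * m + 1), restrict I {..<2 * m}) \<in> UNIV \<times> idx (2 * m)" by auto
    next
      fix jI :: "'n \<times> (nat \<Rightarrow> 'n)" assume "jI \<in> UNIV \<times> idx (2 * m)"
      then obtain j I where jI: "jI = (j, I)" "I \<in> idx (2 * m)" by auto
      have "(\<Prod>c<2 * m. shape (J c) ((?I I j) c) y) = (\<Prod>c<2 * m. shape (J c) (I c) y)" for J
        by (intro prod.cong refl) simp
      then show "(\<Sum>J\<in>idx (2 * m + 2). gen_delta (2 * m + 2) (case jI of (j, I) \<Rightarrow> ?I I j) J *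
          ((\<Prod>c\<in>{..<2 * m + 2} - {2 * m}. shape (J c) ((case jI of (j, I) \<Rightarrow> ?I I j) c) y)
             * gauss_map f (J (2 * m)) y))
        = (case jI of (j, I) \<Rightarrow> \<Sum>J\<in>idx (2 * m + 2).
            ?K I (?I I j) J * (gauss_map f (J (2 * m)) y * shape (J (2 * m + 1)) j y))"
        unfolding jI set_eq by (simp add: ac_simps)
    qed
    finally show ?thesis .
  qed
  show ?thesis
    unfolding 1 2[symmetric] by (simp only: sum_distrib_left)
qed

lemma cov_deriv_e:
  "cov_deriv hyp_metric (tensor2 (\<lambda>y. graph_metric f y - hyp_metric y)) y [s, j, l]
    = 2 * V0 y * pd s V0 y * pd j f y * pd l f y
      + V0 y * V0 y * (pd s (pd j f) y * pd l f y + pd j f y * pd s (pd l f) y)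
      + V0 y * V0 y * radial f y * (hyp_metric y $ s $ j * pd l f y + hyp_metric y $ s $ l * pd j f y)"
proof -
  have "pd s (\<lambda>y. tensor2 (\<lambda>y. graph_metric f y - hyp_metric y) y [j, l]) y
     = pd s (\<lambda>y. V0 y * V0 y * pd j f y * pd l f y) y"
    by (simp add: tensor2_def graph_metric_nth)
  also have "\<dots> = 2 * V0 y * pd s V0 y * pd j f y * pd l f y
      + V0 y * V0 y * (pd s (pd j f) y * pd l f y + pd j f y * pd s (pd l f) y)"
    by (simp add: pd_smooth_mult smooth_V0 smooth_pd smooth_mult f algebra_simps)
  finally have 1: "pd s (\<lambda>y. tensor2 (\<lambda>y. graph_metric f y - hyp_metric y) y [j, l]) y = \<dots>" .
  have 2: "(\<Sum>a<length [j, l]. \<Sum>m\<in>UNIV. christoffel hyp_metric m s ([j, l] ! a) y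
        * tensor2 (\<lambda>y. graph_metric f y - hyp_metric y) y ([j, l][a := m]))
     = - V0 y * V0 y * radial f y * (hyp_metric y $ s $ j * pd l f y + hyp_metric y $ s $ l * pd j f y)"
  proof -
    have "(\<Sum>m\<in>UNIV. y $ m * hyp_metric y $ s $ j * (V0 y * V0 y * pd m f y * pd l f y))
      = V0 y * V0 y * radial f y * (hyp_metric y $ s $ j * pd l f y)"
      "(\<Sum>m\<in>UNIV. y $ m * hyp_metric y $ s $ l * (V0 y * V0 y * pd j f y * pd m f y))
      = V0 y * V0 y * radial f y * (hyp_metric y $ s $ l * pd j f y)"
      by (simp_all add: radial_def sum_distrib_left sum_distrib_right ac_simps)
    then show ?thesis
      by (simp add: lessThan_Suc tensor2_def graph_metric_nth christoffel_hyp sum_negf algebra_simps)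
  qed
  show ?thesis unfolding cov_deriv_def list.case 1 2 by simp
qed

text \<open>
  Terms symmetric in \<open>l, s\<close> do not contribute, and what is left of the integrand is the second
  fundamental form contracted with \<open>df\<close>.
\<close>

lemma flux_integrand:
  "(\<Sum>j\<in>UNIV. \<Sum>l\<in>UNIV. \<Sum>s\<in>UNIV.
      (V0 y * cov_deriv hyp_metric (tensor2 (\<lambda>y. graph_metric f y - hyp_metric y)) y [s, j, l]
        - tensor2 (\<lambda>y. graph_metric f y - hyp_metric y) y [j, l] * pd s V0 y)
        * mod_P (Suc m) (graph_metric f) i j l s y)
    = 1 / 2 * V0 y * minor_field (2 * m + 2) (2 * m) (gauss_map f) i y"
proof -
  let ?V = "V0 y" and ?P = "\<lambda>j l s. mod_P (Suc m) (graph_metric f) i j l s y"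
  \<comment> \<open>The negative terms compensate for what \<open>second_form\<close> contains and
    the derivative of \<open>e\<close> does not: the summand \<open>dV_j df_s\<close>, and the part
    \<open>V^2 df_s df_j\<close> of the graph metric. Times \<open>df_l\<close>, both are symmetric
    in \<open>l\<close> and \<open>s\<close>.\<close>
  define B where "B j l s = ?V * ?V * ?V * pd j f y * (pd s (pd l f) y + radial f y * hyp_metric y $ s $ l)
     - ?V * ?V * pd j V0 y * pd l f y * pd s f y
     - ?V * ?V * ?V * ?V * ?V * radial f y * pd j f y * pd l f y * pd s f y" for j l s
  have split: "?V * cov_deriv hyp_metric (tensor2 (\<lambda>y. graph_metric f y - hyp_metric y)) y [s, j, l]
        - tensor2 (\<lambda>y. graph_metric f y - hyp_metric y) y [j, l] * pd s V0 y
     = ?V * (?V * slope f y * pd l f y * second_form f s j y) + B j l s" for j l s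
  proof -
    have W: "slope f y * second_form f s j y
      = ?V * pd s (pd j f) y + pd s V0 y * pd j f y + pd j V0 y * pd s f y
       + ?V * radial f y * graph_metric f y $ s $ j"
      by (simp add: second_form_def)
    have "?V * (?V * slope f y * pd l f y * second_form f s j y)
      = ?V * ?V * pd l f y * (slope f y * second_form f s j y)" by simp
    then show ?thesis
      unfolding W B_def cov_deriv_e by (simp add: tensor2_def graph_metric_nth algebra_simps)
  qed
  have "(\<Sum>l\<in>UNIV. \<Sum>s\<in>UNIV. B j l s * ?P j l s) = 0" for j
    by (rule mod_P_contract_sym) (simp add: B_def pd_swap[OF f] hyp_metric_sym algebra_simps)
  then have "(\<Sum>j\<in>UNIV. \<Sum>l\<in>UNIV. \<Sum>s\<in>UNIV.
      (?V * (?V * slope f y * pd l f y * second_form f s j y) + B j l s) * ?P j l s)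
    = ?V * (\<Sum>j\<in>UNIV. \<Sum>l\<in>UNIV. \<Sum>s\<in>UNIV. ?V * slope f y * pd l f y * second_form f s j y * ?P j l s)"
    by (simp only: distrib_right sum.distrib) (simp add: sum_distrib_left mult.assoc)
  then show ?thesis unfolding split mod_P_contract_minor_field by simp
qed

end

text \<open>The lowered normal is \<open>dr\<close>, and \<open>r = arsinh |y|\<close>. The factor
  \<open>1 / V\<close> cancels the \<open>V\<close> in \<open>flux_integrand\<close>, which leaves a
  flux against the Euclidean unit normal.\<close>

lemma normal_cov_eq: "normal_cov i y = sgn y $ i / V0 y"
proof -
  have "(\<Sum>m\<in>UNIV. y $ m * sgn y $ m) * y $ i = (\<Sum>m\<in>UNIV. y $ m * y $ m) * sgn y $ i"
    by (simp add: sgn_div_norm sum_distrib_right sum_divide_distrib)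
      (intro sum.cong refl, simp add: ac_simps)
  then have *: "y $ i * (\<Sum>m\<in>UNIV. y $ m * sgn y $ m) = (V0 y * V0 y - 1) * sgn y $ i"
    by (simp add: V0_sq mult.commute)
  have "normal_cov i y = (\<Sum>m\<in>UNIV. hyp_metric y $ i $ m * (V0 y * sgn y $ m))"
    by (simp add: normal_cov_def matrix_vector_mult_def V0_def)
  also have "\<dots> = V0 y * (\<Sum>m\<in>UNIV. hyp_metric y $ i $ m * sgn y $ m)"
    by (simp add: sum_distrib_left ac_simps)
  also have "\<dots> = V0 y * (sgn y $ i - (V0 y * V0 y - 1) * sgn y $ i / (V0 y * V0 y))"
    unfolding hyp_metric_apply * ..
  finally show ?thesis by (simp add: field_simps)
qed

section \<open>The divergence theorem on balls\<close>

text \<open>The derivative of a compactly supported Lipschitz function integrates to 0: by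
  translation invariance all its difference quotients do, and they converge dominatedly. A
  derivative almost everywhere suffices, as the functions to come have kinks along two
  spheres.\<close>

lemma integral_difference_quotient_limit:
  fixes F D :: "'a::euclidean_space \<Rightarrow> real"
  assumes F: "continuous_on UNIV F" and supp: "\<And>x. norm x > B \<Longrightarrow> F x = 0"
    and e: "norm e \<le> 1" and D: "D \<in> borel_measurable lborel"
    and lim: "AE x in lborel. ((\<lambda>s. (F (x + s *\<^sub>R e) - F x) / s) \<longlongrightarrow> D x) (at 0)"
    and bound: "\<And>x s. norm x \<le> B + 1 \<Longrightarrow> 0 < s \<Longrightarrow> s \<le> 1 \<Longrightarrow> \<bar>F (x + s *\<^sub>R e) - F x\<bar> \<le> C * s"
  shows "integral\<^sup>L lborel D = 0"
proof -
  define h where "h m = inverse (real (Suc m))" for m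
  have h: "0 < h m" "h m \<le> 1" for m
    by (simp_all add: h_def inverse_eq_divide)
  have h0: "h \<longlonglongrightarrow> 0" unfolding h_def using LIMSEQ_inverse_real_of_nat .
  have h_at: "filterlim h (at 0) sequentially"
    using h0 h(1) by (intro filterlim_atI) (auto intro!: always_eventually simp: less_imp_neq[symmetric])
  have intF: "integrable lborel F"
  proof -
    have "integrable lborel (\<lambda>x. indicator (cball 0 B) x *\<^sub>R F x)"
      by (intro borel_integrable_compact compact_cball continuous_on_subset[OF F]) auto
    moreover have "(\<lambda>x. indicator (cball 0 B) x *\<^sub>R F x) = F"
      using supp by (auto simp: fun_eq_iff indicator_def not_le)
    ultimately show ?thesis by simp
  qed
  have [measurable]: "F \<in> borel_measurable borel"
    using F by (rule borel_measurable_continuous_onI)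
  have shift: "integrable lborel (\<lambda>x. F (x + c))" "(\<integral>x. F (x + c) \<partial>lborel) = integral\<^sup>L lborel F" for c
  proof -
    have *: "integrable (distr lborel borel ((+) c)) F"
      "integral\<^sup>L (distr lborel borel ((+) c)) F = integral\<^sup>L lborel F"
      using intF by (simp_all add: lborel_distr_plus)
    show "integrable lborel (\<lambda>x. F (x + c))"
      using *(1) by (subst (asm) integrable_distr_eq) (simp_all add: add.commute)
    show "(\<integral>x. F (x + c) \<partial>lborel) = integral\<^sup>L lborel F"
      using *(2) by (subst (asm) integral_distr) (simp_all add: add.commute)
  qed
  let ?q = "\<lambda>m x. (F (x + h m *\<^sub>R e) - F x) / h m"
  have "(\<lambda>m. integral\<^sup>L lborel (?q m)) \<longlonglongrightarrow> integral\<^sup>L lborel D"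
  \<comment> \<open>The shifts have length at most 1, so all quotients vanish outside radius
    \<open>B + 1\<close>; inside, they are bounded by \<open>C\<close>.\<close>
  proof (rule integral_dominated_convergence[where w = "\<lambda>x. indicator (cball 0 (B + 1)) x *\<^sub>R C"])
    show "?q m \<in> borel_measurable lborel" for m by measurable
    show "integrable lborel (\<lambda>x. indicator (cball 0 (B + 1)) x *\<^sub>R C)"
      by (intro borel_integrable_compact) auto
    show "AE x in lborel. (\<lambda>m. ?q m x) \<longlonglongrightarrow> D x"
      using lim
    proof eventually_elim
      case (elim x)
      then show ?case by (rule filterlim_compose[OF _ h_at])
    qed
    show "AE x in lborel. norm (?q m x) \<le> indicator (cball 0 (B + 1)) x *\<^sub>R C" for m
    proof (rule AE_I2)
      fix x
      show "norm (?q m x) \<le> indicator (cball 0 (B + 1)) x *\<^sub>R C"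
      proof (cases "norm x \<le> B + 1")
        case True
        then show ?thesis using bound[OF True h] h(1)[of m] by (simp add: abs_div_pos[symmetric] field_simps)
      next
        case False
        have "norm (h m *\<^sub>R e) \<le> 1 * 1"
          unfolding norm_scaleR using h[of m] e by (intro mult_mono) auto
        then have "norm (x + h m *\<^sub>R e) > B"
          using False norm_diff_ineq[of x "h m *\<^sub>R e"] by simp
        then show ?thesis using False supp by simp
      qed
    qed
  qed (use D in auto)
  moreover have "integral\<^sup>L lborel (?q m) = 0" for m
    using shift[of "h m *\<^sub>R e"] intF by simp
  ultimately have "(\<lambda>m. 0) \<longlonglongrightarrow> integral\<^sup>L lborel D" by (simp only:)
  then show ?thesis by (simp add: LIMSEQ_const_iff)
qed

text \<open>A Lipschitz substitute for the indicator of the ball of radius \<open>R\<close>, linear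
  in the norm across a shell of thickness \<open>\<epsilon>\<close>. Its gradient there is
  \<open>- sgn x / \<epsilon>\<close>, so integration by parts turns the flux into an average over
  the shell.\<close>

definition cutoff :: "real \<Rightarrow> real \<Rightarrow> 'a::real_normed_vector \<Rightarrow> real" where
  "cutoff R \<epsilon> x = max 0 (min 1 ((R + \<epsilon> - norm x) / \<epsilon>))"

lemma cutoff_bounds: "0 \<le> cutoff R \<epsilon> x" "cutoff R \<epsilon> x \<le> 1"
  by (auto simp: cutoff_def)

lemma continuous_cutoff: "\<epsilon> > 0 \<Longrightarrow> continuous_on A (cutoff R \<epsilon>)"
  unfolding cutoff_def[abs_def] by (intro continuous_intros) auto

lemma cutoff_inside: "\<epsilon> > 0 \<Longrightarrow> norm x \<le> R \<Longrightarrow> cutoff R \<epsilon> x = 1"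
  by (simp add: cutoff_def field_simps)

lemma cutoff_outside: "\<epsilon> > 0 \<Longrightarrow> norm x \<ge> R + \<epsilon> \<Longrightarrow> cutoff R \<epsilon> x = 0"
  using divide_nonpos_pos[of "R + \<epsilon> - norm x" \<epsilon>] by (simp add: cutoff_def max_def min_def)

lemma cutoff_shell: "\<epsilon> > 0 \<Longrightarrow> R \<le> norm x \<Longrightarrow> norm x \<le> R + \<epsilon> \<Longrightarrow> cutoff R \<epsilon> x = (R + \<epsilon> - norm x) / \<epsilon>"
  by (simp add: cutoff_def field_simps)

lemma cutoff_lipschitz:
  assumes "\<epsilon> > 0"
  shows "\<bar>cutoff R \<epsilon> x - cutoff R \<epsilon> y\<bar> \<le> norm (x - y) / \<epsilon>"
proof -
  have "\<bar>cutoff R \<epsilon> x - cutoff R \<epsilon> y\<bar> \<le> \<bar>(R + \<epsilon> - norm x) / \<epsilon> - (R + \<epsilon> - norm y) / \<epsilon>\<bar>"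
    unfolding cutoff_def by (simp add: max_def min_def)
  also have "\<dots> = \<bar>norm x - norm y\<bar> / \<epsilon>"
    using assms by (simp add: diff_divide_distrib[symmetric] abs_minus_commute)
  also have "\<dots> \<le> norm (x - y) / \<epsilon>"
    using assms norm_triangle_ineq3[of x y] by (intro divide_right_mono) auto
  finally show ?thesis .
qed

lemma cutoff_derivative:
  fixes x :: "real ^ 'n::finite"
  assumes "R > 0" "\<epsilon> > 0" "norm x \<noteq> R" "norm x \<noteq> R + \<epsilon>"
  shows "((\<lambda>s. cutoff R \<epsilon> (x + s *\<^sub>R axis i 1)) has_real_derivative
     - (indicator {x. R < norm x \<and> norm x < R + \<epsilon>} x * sgn x $ i / \<epsilon>)) (at 0)"
proof -
  have n: "((\<lambda>s. norm (x + s *\<^sub>R axis i 1)) \<longlongrightarrow> norm x) (nhds 0)"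
  proof -
    have "continuous_on UNIV (\<lambda>s::real. norm (x + s *\<^sub>R axis i 1))" by (intro continuous_intros)
    then have "isCont (\<lambda>s::real. norm (x + s *\<^sub>R axis i 1)) 0"
      by (simp add: continuous_on_eq_continuous_at)
    then show ?thesis by (simp add: isCont_def tendsto_nhds_iff)
  qed
  consider "norm x < R" | "R < norm x" "norm x < R + \<epsilon>" | "R + \<epsilon> < norm x"
    using assms by linarith
  then show ?thesis
  proof cases
    case 1
    from order_tendstoD(2)[OF n 1]
    have "\<forall>\<^sub>F s in nhds 0. cutoff R \<epsilon> (x + s *\<^sub>R axis i 1) = 1"
      by eventually_elim (simp add: assms cutoff_inside)
    then show ?thesis
      using 1 by (subst DERIV_cong_ev[OF refl _ refl]) auto
  next
    case 3
    from order_tendstoD(1)[OF n 3]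
    have "\<forall>\<^sub>F s in nhds 0. cutoff R \<epsilon> (x + s *\<^sub>R axis i 1) = 0"
      by eventually_elim (simp add: assms cutoff_outside)
    then show ?thesis
      using 3 by (subst DERIV_cong_ev[OF refl _ refl]) auto
  next
    case 2
    have "\<forall>\<^sub>F s in nhds 0. cutoff R \<epsilon> (x + s *\<^sub>R axis i 1) = (R + \<epsilon> - norm (x + s *\<^sub>R axis i 1)) / \<epsilon>"
      using order_tendstoD(1)[OF n 2(1)] order_tendstoD(2)[OF n 2(2)]
      by eventually_elim (simp add: assms cutoff_shell)
    moreover have "((\<lambda>s. (R + \<epsilon> - norm (x + s *\<^sub>R axis i 1)) / \<epsilon>) has_real_derivative - (sgn x $ i / \<epsilon>)) (at 0)"
    proof -
      have "x \<noteq> 0" using 2 assms by auto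
      then have "(norm has_derivative (\<lambda>v. v \<bullet> sgn x)) (at (x + 0 *\<^sub>R axis i 1))"
        using has_derivative_norm[of x] by (simp add: inner_commute)
      moreover have "((\<lambda>s. x + s *\<^sub>R axis i 1) has_derivative (\<lambda>s. s *\<^sub>R axis i (1::real))) (at 0)"
        by (auto intro!: derivative_eq_intros)
      ultimately have "((\<lambda>s. norm (x + s *\<^sub>R axis i 1)) has_derivative (\<lambda>s. (s *\<^sub>R axis i 1) \<bullet> sgn x)) (at 0)"
        by (rule has_derivative_compose[rotated])
      moreover have "(\<lambda>s. (s *\<^sub>R axis i 1) \<bullet> sgn x) = (*) (sgn x $ i)"
        by (simp add: fun_eq_iff inner_axis')
      ultimately have "((\<lambda>s. norm (x + s *\<^sub>R axis i 1)) has_real_derivative sgn x $ i) (at 0)"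
        by (simp add: has_field_derivative_def)
      then show ?thesis
        using assms by (auto intro!: derivative_eq_intros)
    qed
    ultimately show ?thesis
      using 2 by (subst DERIV_cong_ev[OF refl _ refl]) auto
  qed
qed

lemma continuous_bounded_on_cball:
  fixes F :: "real ^ 'n::finite \<Rightarrow> real"
  assumes "continuous_on UNIV F"
  obtains M where "M \<ge> 0" "\<And>x. norm x \<le> r \<Longrightarrow> \<bar>F x\<bar> \<le> M"
proof -
  have "compact (F ` cball 0 r)"
    by (intro compact_continuous_image continuous_on_subset[OF assms]) auto
  then obtain M where "\<forall>z\<in>F ` cball 0 r. norm z \<le> M"
    using compact_imp_bounded bounded_iff by blast
  then show thesis by (intro that[of "max M 0"]) (auto simp: le_max_iff_disj)
qed

lemma integrable_bounded_set:
  fixes F :: "real ^ 'n::finite \<Rightarrow> real"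
  assumes "F \<in> borel_measurable borel" "A \<in> sets borel" "A \<subseteq> cball 0 r" "\<And>x. x \<in> A \<Longrightarrow> \<bar>F x\<bar> \<le> M"
  shows "integrable lborel (\<lambda>x. indicator A x * F x)"
proof -
  have "emeasure lborel A \<le> emeasure lborel (cball (0 :: real ^ 'n) r)"
    using assms by (intro emeasure_mono) auto
  also have "\<dots> < \<infinity>" by (rule emeasure_lborel_cball_finite)
  finally show ?thesis
    using integrableI_bounded_set_indicator[of A lborel F M] assms by auto
qed

text \<open>Integration by parts: the product of \<open>cutoff\<close> and \<open>Z\<close> has
  compact support, so its derivative integrates to 0.\<close>

lemma integral_partial_cutoff:
  fixes Z :: "real ^ 'n::finite \<Rightarrow> real"
  assumes Z: "smooth_fun Z" and R: "R > 0" and \<epsilon>: "0 < \<epsilon>"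
  shows "(\<integral>x. cutoff R \<epsilon> x * pd i Z x \<partial>lborel)
    = (\<integral>x. indicator {x. R < norm x \<and> norm x < R + \<epsilon>} x * (Z x * sgn x $ i) \<partial>lborel) / \<epsilon>"
    and "integrable lborel (\<lambda>x. cutoff R \<epsilon> x * pd i Z x)"
    and "integrable lborel (\<lambda>x. indicator {x. R < norm x \<and> norm x < R + \<epsilon>} x * (Z x * sgn x $ i))"
proof -
  let ?S = "{x :: real ^ 'n. R < norm x \<and> norm x < R + \<epsilon>}"
  have [measurable]: "Z \<in> borel_measurable borel" "pd i Z \<in> borel_measurable borel"
    "cutoff R \<epsilon> \<in> borel_measurable borel"
    by (intro borel_measurable_continuous_onI smooth_continuous smooth_intros Z continuous_cutoff \<epsilon>)+
  have sgn_m[measurable]: "(\<lambda>x :: real ^ 'n. sgn x $ i) \<in> borel_measurable borel"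
    by (simp add: sgn_div_norm)
  have S[measurable]: "?S \<in> sets borel" by measurable
  \<comment> \<open>The shifts have length at most 1 and start within radius
    \<open>R + \<epsilon> + 1\<close>, hence the margin 2.\<close>
  obtain M where M: "M \<ge> 0" "\<And>x. norm x \<le> R + \<epsilon> + 2 \<Longrightarrow> \<bar>Z x\<bar> \<le> M"
    using continuous_bounded_on_cball[OF smooth_continuous[OF Z]] by metis
  obtain M' where M': "M' \<ge> 0" "\<And>x. norm x \<le> R + \<epsilon> + 2 \<Longrightarrow> \<bar>pd i Z x\<bar> \<le> M'"
    using continuous_bounded_on_cball[OF smooth_continuous[OF smooth_pd[OF Z]]] by metis
  show int1: "integrable lborel (\<lambda>x. cutoff R \<epsilon> x * pd i Z x)"
  proof -
    have "integrable lborel (\<lambda>x. indicator (cball 0 (R + \<epsilon>)) x *\<^sub>R (cutoff R \<epsilon> x * pd i Z x))"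
      by (intro borel_integrable_compact compact_cball continuous_intros continuous_cutoff \<epsilon>
          smooth_continuous smooth_intros Z)
    moreover have "(\<lambda>x. indicator (cball 0 (R + \<epsilon>)) x *\<^sub>R (cutoff R \<epsilon> x * pd i Z x))
       = (\<lambda>x. cutoff R \<epsilon> x * pd i Z x)"
      using \<epsilon> by (auto simp: fun_eq_iff indicator_def cutoff_outside)
    ultimately show ?thesis by simp
  qed
  show int2: "integrable lborel (\<lambda>x. indicator ?S x * (Z x * sgn x $ i))"
  proof (rule integrable_bounded_set[where M = M and r = "R + \<epsilon>"])
    fix x assume "x \<in> ?S"
    then have "\<bar>Z x\<bar> \<le> M" by (intro M) auto
    moreover have "\<bar>sgn x $ i\<bar> \<le> 1"
      using component_le_norm_cart[of "sgn x" i] norm_sgn[of x] by (simp split: if_splits)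
    ultimately show "\<bar>Z x * sgn x $ i\<bar> \<le> M"
      using M(1) mult_mono[of "\<bar>Z x\<bar>" M "\<bar>sgn x $ i\<bar>" 1] by (simp add: abs_mult)
  qed (use S in auto)
  define F where "F x = cutoff R \<epsilon> x * Z x" for x
  let ?D = "\<lambda>x. cutoff R \<epsilon> x * pd i Z x - indicator ?S x * (Z x * sgn x $ i) / \<epsilon>"
  have "integral\<^sup>L lborel ?D = 0"
  \<comment> \<open>A Lipschitz constant of the product: \<open>cutoff\<close> is at most 1 and
    \<open>Z\<close> has slope at most \<open>M'\<close>; \<open>cutoff\<close> has slope at most
    \<open>1 / \<epsilon>\<close> and \<open>Z\<close> is at most \<open>M\<close>.\<close>
  proof (rule integral_difference_quotient_limit[where F = F and e = "axis i 1" and B = "R + \<epsilon>" and C = "M' + M / \<epsilon>"])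
    show "continuous_on UNIV F"
      unfolding F_def by (intro continuous_intros continuous_cutoff \<epsilon> smooth_continuous Z)
    show "F x = 0" if "norm x > R + \<epsilon>" for x
      using that \<epsilon> by (simp add: F_def cutoff_outside)
    show "norm (axis i (1::real)) \<le> 1" by simp
    show "?D \<in> borel_measurable lborel" by measurable
    have "AE x in lborel. x \<notin> sphere (0 :: real ^ 'n) R" "AE x in lborel. x \<notin> sphere (0 :: real ^ 'n) (R + \<epsilon>)"
      using negligible_sphere[of "0 :: real ^ 'n"]
      by (intro AE_not_in; simp add: negligible_iff_null_sets null_sets_completion_iff)+
    then show "AE x in lborel. ((\<lambda>s. (F (x + s *\<^sub>R axis i 1) - F x) / s) \<longlongrightarrow> ?D x) (at 0)"
    proof eventually_elim
      case (elim x)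
      have "((\<lambda>s. F (x + s *\<^sub>R axis i 1)) has_real_derivative ?D x) (at 0)"
        unfolding F_def
        using DERIV_mult[OF cutoff_derivative[OF R \<epsilon>, of x i] smooth_field_derivative[OF Z, of x i 0]] elim
        by (simp add: algebra_simps)
      then show ?case by (simp add: DERIV_def)
    qed
    show "\<bar>F (x + s *\<^sub>R axis i 1) - F x\<bar> \<le> (M' + M / \<epsilon>) * s" if x: "norm x \<le> R + \<epsilon> + 1" and s: "0 < s" "s \<le> 1" for x s
    proof -
      let ?x = "x + s *\<^sub>R axis i 1"
      have near: "norm (x + t *\<^sub>R axis i 1) \<le> R + \<epsilon> + 2" if "0 \<le> t" "t \<le> 1" for t
        using x that norm_triangle_ineq[of x "t *\<^sub>R axis i 1"] by simp
      obtain \<xi> where \<xi>: "0 < \<xi>" "\<xi> < s" "Z ?x - Z (x + 0 *\<^sub>R axis i 1) = (s - 0) * pd i Z (x + \<xi> *\<^sub>R axis i 1)"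
        using MVT2[OF s(1) smooth_field_derivative[OF Z], of x i] by blast
      have "\<bar>pd i Z (x + \<xi> *\<^sub>R axis i 1)\<bar> \<le> M'"
        using \<xi> s by (intro M' near) auto
      then have 1: "\<bar>Z ?x - Z x\<bar> \<le> M' * s"
        using \<xi>(3) s by (simp add: abs_mult mult.commute)
      have 2: "\<bar>Z x\<bar> \<le> M" using near[of 0] by (intro M) simp
      have 3: "\<bar>cutoff R \<epsilon> ?x - cutoff R \<epsilon> x\<bar> \<le> s / \<epsilon>"
        using cutoff_lipschitz[OF \<epsilon>, of R ?x x] s by simp
      have "\<bar>F ?x - F x\<bar> = \<bar>cutoff R \<epsilon> ?x * (Z ?x - Z x) + (cutoff R \<epsilon> ?x - cutoff R \<epsilon> x) * Z x\<bar>"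
        by (simp add: F_def algebra_simps)
      also have "\<dots> \<le> \<bar>cutoff R \<epsilon> ?x\<bar> * \<bar>Z ?x - Z x\<bar> + \<bar>cutoff R \<epsilon> ?x - cutoff R \<epsilon> x\<bar> * \<bar>Z x\<bar>"
        by (simp add: abs_mult[symmetric] abs_triangle_ineq)
      also have "\<dots> \<le> 1 * (M' * s) + s / \<epsilon> * M"
        using cutoff_bounds[of R \<epsilon> ?x] 1 2 3 s \<epsilon> by (intro add_mono mult_mono) auto
      finally show ?thesis by (simp add: algebra_simps)
    qed
  qed
  then show "(\<integral>x. cutoff R \<epsilon> x * pd i Z x \<partial>lborel)
    = (\<integral>x. indicator ?S x * (Z x * sgn x $ i) \<partial>lborel) / \<epsilon>"
    using int1 int2 by (simp add: Bochner_Integration.integral_diff)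
qed

section \<open>Thin shells and the divergence theorem\<close>

lemma integral_scale:
  fixes F :: "'a::euclidean_space \<Rightarrow> real"
  assumes "F \<in> borel_measurable borel" "c > 0"
  shows "integral\<^sup>L lborel F = c ^ DIM('a) * (\<integral>x. F (c *\<^sub>R x) \<partial>lborel)"
proof -
  have "integral\<^sup>L lborel F = integral\<^sup>L (density (distr lborel borel (\<lambda>x. 0 + c *\<^sub>R x)) (\<lambda>_. \<bar>c\<bar> ^ DIM('a))) F"
    using lborel_affine[of c "0 :: 'a"] assms by simp
  also have "\<dots> = (\<integral>x. c ^ DIM('a) * F (c *\<^sub>R x) \<partial>lborel)"
    using assms by (subst integral_density) (simp_all add: integral_distr)
  finally show ?thesis by simp
qed

lemma integral_cball_homogeneous:
  fixes k :: "'a::euclidean_space \<Rightarrow> real"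
  assumes "k \<in> borel_measurable borel" "\<And>c x. c > 0 \<Longrightarrow> k (c *\<^sub>R x) = k x" "r > 0"
  shows "(\<integral>x. indicator (cball 0 r) x * k x \<partial>lborel)
    = r ^ DIM('a) * (\<integral>x. indicator (cball 0 1) x * k x \<partial>lborel)"
proof -
  have "indicator (cball 0 r) (r *\<^sub>R x) = (indicator (cball 0 1) x :: real)" for x :: 'a
    using assms(3) by (simp add: indicator_def)
  moreover have "(\<lambda>x. indicator (cball 0 r) x * k x) \<in> borel_measurable borel"
    using assms(1) by (intro borel_measurable_times borel_measurable_indicator) simp_all
  ultimately show ?thesis
    using integral_scale[of "\<lambda>x. indicator (cball 0 r) x * k x" r] assms(2,3) by simp
qed

abbreviation shell :: "real \<Rightarrow> real \<Rightarrow> 'a::real_normed_vector set" where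
  "shell R \<epsilon> \<equiv> {x. R < norm x \<and> norm x < R + \<epsilon>}"

text \<open>A function homogeneous of degree 0 has ball integrals proportional to the
  \<open>n\<close>-th power of the radius, and a shell is a difference of two balls up to a null
  set. This takes the place of polar coordinates.\<close>

lemma integral_shell_homogeneous:
  fixes k :: "real ^ 'n::finite \<Rightarrow> real"
  assumes k: "k \<in> borel_measurable borel" "\<And>c x. c > 0 \<Longrightarrow> k (c *\<^sub>R x) = k x"
    and M: "\<And>x. \<bar>k x\<bar> \<le> M" and R: "R > 0" "\<epsilon> > 0"
  shows "(\<integral>x. indicator (shell R \<epsilon>) x * k x \<partial>lborel)
    = ((R + \<epsilon>) ^ CARD('n) - R ^ CARD('n)) * (\<integral>x. indicator (cball 0 1) x * k x \<partial>lborel)"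
proof -
  note [measurable] = k(1)
  have int: "integrable lborel (\<lambda>x. indicator (cball 0 r) x * k x)" for r
    by (rule integrable_bounded_set[where M = M and r = r]) (auto simp: M)
  have "(\<integral>x. indicator (shell R \<epsilon>) x * k x \<partial>lborel)
    = (\<integral>x. indicator (cball 0 (R + \<epsilon>)) x * k x - indicator (cball 0 R) x * k x \<partial>lborel)"
  proof (rule integral_cong_AE)
    have "AE x in lborel. x \<notin> sphere (0 :: real ^ 'n) (R + \<epsilon>)"
      using negligible_sphere[of "0 :: real ^ 'n"]
      by (intro AE_not_in; simp add: negligible_iff_null_sets null_sets_completion_iff)
    then show "AE x in lborel. indicator (shell R \<epsilon>) x * k x
       = indicator (cball 0 (R + \<epsilon>)) x * k x - indicator (cball 0 R) x * k x"
      by eventually_elim (use R in \<open>auto simp: indicator_def\<close>)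
  next
    have [measurable]: "shell R \<epsilon> \<in> sets (borel :: (real ^ 'n) measure)" by measurable
    show "(\<lambda>x. indicator (shell R \<epsilon>) x * k x) \<in> borel_measurable lborel"
      using k(1) by (intro borel_measurable_times borel_measurable_indicator) simp_all
    show "(\<lambda>x. indicator (cball 0 (R + \<epsilon>)) x * k x - indicator (cball 0 R) x * k x) \<in> borel_measurable lborel"
      using k(1) by (intro borel_measurable_diff borel_measurable_times borel_measurable_indicator) simp_all
  qed
  also have "\<dots> = (R + \<epsilon>) ^ CARD('n) * (\<integral>x. indicator (cball 0 1) x * k x \<partial>lborel)
      - R ^ CARD('n) * (\<integral>x. indicator (cball 0 1) x * k x \<partial>lborel)"
    using R int integral_cball_homogeneous[OF k, of "R + \<epsilon>"] integral_cball_homogeneous[OF k, of R]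
    by (simp add: Bochner_Integration.integral_diff)
  finally show ?thesis by (simp add: algebra_simps)
qed

text \<open>On the shell, \<open>Z\<close> is replaced by its value at the radial projection to the
  sphere of radius \<open>R\<close>. The replacement is homogeneous of degree 0, so its shell
  integral is exact, with a factor that is a difference quotient of the \<open>n\<close>-th power;
  the error is controlled by uniform continuity.\<close>

lemma shell_average_limit:
  fixes Z :: "real ^ 'n::finite \<Rightarrow> real"
  assumes Z: "continuous_on UNIV Z" and R: "R > 0"
  shows "(\<lambda>m. (\<integral>x. indicator (shell R (inverse (real (Suc m)))) x * (Z x * sgn x $ i) \<partial>lborel) / inverse (real (Suc m)))
    \<longlonglongrightarrow> real CARD('n) * R ^ (CARD('n) - 1) * (\<integral>x. indicator (cball 0 1) x * (Z (R *\<^sub>R sgn x) * sgn x $ i) \<partial>lborel)"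
proof -
  define h where "h m = inverse (real (Suc m))" for m
  have h: "0 < h m" "h m \<le> 1" for m
    by (simp_all add: h_def inverse_eq_divide)
  have h0: "h \<longlonglongrightarrow> 0" unfolding h_def using LIMSEQ_inverse_real_of_nat .
  let ?n = "CARD('n)"
  let ?k = "\<lambda>x :: real ^ 'n. Z (R *\<^sub>R sgn x) * sgn x $ i" and ?H = "\<lambda>x :: real ^ 'n. Z x * sgn x $ i"
  let ?c = "\<lambda>m. ((R + h m) ^ ?n - R ^ ?n) / h m"
  let ?K = "\<integral>x. indicator (cball 0 1) x * ?k x \<partial>lborel"
  define v where "v = (\<integral>x. indicator (cball (0 :: real ^ 'n) 1) x * (1 :: real) \<partial>lborel)"
  have v: "v \<ge> 0" unfolding v_def by (intro integral_nonneg_AE) (auto simp: indicator_def)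
  have c: "?c \<longlonglongrightarrow> real ?n * R ^ (?n - 1)"
  proof -
    have "((\<lambda>x. x ^ ?n) has_real_derivative real ?n * R ^ (?n - 1)) (at R)"
      by (auto intro!: derivative_eq_intros)
    moreover have "filterlim h (at 0) sequentially"
      using h0 h(1) by (intro filterlim_atI) (auto intro!: always_eventually simp: less_imp_neq[symmetric])
    ultimately show ?thesis unfolding DERIV_def by (rule filterlim_compose)
  qed
  have c_pos: "?c m \<ge> 0" for m
    using h[of m] R by (intro divide_nonneg_nonneg) (auto intro!: power_mono)
  have [measurable]: "Z \<in> borel_measurable borel"
    using Z by (rule borel_measurable_continuous_onI)
  have sgn_m [measurable]: "(sgn :: real ^ 'n \<Rightarrow> _) \<in> borel_measurable borel"
    by (simp add: sgn_div_norm[abs_def])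
  have [measurable]: "(\<lambda>x :: real ^ 'n. sgn x $ i) \<in> borel_measurable borel"
    by (simp add: sgn_div_norm)
  have comp: "\<bar>sgn x $ i\<bar> \<le> 1" for x :: "real ^ 'n"
    using component_le_norm_cart[of "sgn x" i] norm_sgn[of x] by (simp split: if_splits)
  obtain M where M: "M \<ge> 0" "\<And>x. norm x \<le> R + 1 \<Longrightarrow> \<bar>Z x\<bar> \<le> M"
    using continuous_bounded_on_cball[OF Z] by metis
  have HM: "\<bar>Z x * sgn x' $ i\<bar> \<le> M" if "norm x \<le> R + 1" for x x' :: "real ^ 'n"
    using M(2)[OF that] M(1) comp[of x'] mult_mono[of "\<bar>Z x\<bar>" M "\<bar>sgn x' $ i\<bar>" 1] by (simp add: abs_mult)
  have kM: "\<bar>?k x\<bar> \<le> M" for x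
    by (rule HM) (use R in \<open>simp add: norm_sgn\<close>)
  have k_hom: "?k (a *\<^sub>R x) = ?k x" if "a > 0" for a x
    using that by (simp add: sgn_scaleR)
  have S[measurable]: "shell R \<epsilon> \<in> sets (borel :: (real ^ 'n) measure)" for \<epsilon> by measurable
  have intk: "integrable lborel (\<lambda>x. indicator (shell R (h m)) x * ?k x)"
    and intH: "integrable lborel (\<lambda>x. indicator (shell R (h m)) x * ?H x)"
    and int1: "integrable lborel (\<lambda>x :: real ^ 'n. indicator (shell R (h m)) x * (1 :: real))" for m
    using h(2)[of m] kM
    by (intro integrable_bounded_set[where r = "R + 1" and M = "max M 1"]; force intro!: HM simp: le_max_iff_disj)+
  have k_shell: "(\<integral>x. indicator (shell R (h m)) x * ?k x \<partial>lborel) / h m = ?c m * ?K" for m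
    by (subst integral_shell_homogeneous[where M = M]) (use R h kM k_hom in auto)
  have v_shell: "(\<integral>x. indicator (shell R (h m) :: (real ^ 'n) set) x * (1 :: real) \<partial>lborel) / h m = ?c m * v" for m
    unfolding v_def by (subst integral_shell_homogeneous[where M = 1]) (use R h in auto)
  have diff: "(\<lambda>m. (\<integral>x. indicator (shell R (h m)) x * ?H x \<partial>lborel) / h m - ?c m * ?K) \<longlonglongrightarrow> 0"
  proof (rule tendstoI)
    fix e :: real assume e: "e > 0"
    \<comment> \<open>\<open>L\<close> is the limit of shell volume over thickness. This quotient is
      eventually below \<open>L + 1\<close>, so an oscillation below \<open>d\<close> costs at most
      \<open>e / 2\<close>.\<close>
    define L where "L = real ?n * R ^ (?n - 1) * v"
    have L: "L \<ge> 0" using v R by (simp add: L_def)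
    define d where "d = e / (2 * (L + 1))"
    have d: "d > 0" using e L by (simp add: d_def)
    have "uniformly_continuous_on (cball 0 (R + 1)) Z"
      by (intro compact_uniformly_continuous continuous_on_subset[OF Z]) auto
    then obtain \<delta> where \<delta>: "\<delta> > 0" "\<And>x x'. x \<in> cball 0 (R + 1) \<Longrightarrow> x' \<in> cball 0 (R + 1)
        \<Longrightarrow> dist x' x < \<delta> \<Longrightarrow> dist (Z x') (Z x) < d"
      using d unfolding uniformly_continuous_on_def by metis
    have "\<forall>\<^sub>F m in sequentially. h m < \<delta>"
      using h0 \<delta>(1) by (rule order_tendstoD(2))
    moreover have "\<forall>\<^sub>F m in sequentially. ?c m * v < L + 1"
    proof -
      have "(\<lambda>m. ?c m * v) \<longlonglongrightarrow> L" unfolding L_def by (intro tendsto_mult c tendsto_const)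
      then show ?thesis by (rule order_tendstoD(2)) simp
    qed
    ultimately show "\<forall>\<^sub>F m in sequentially.
      dist ((\<integral>x. indicator (shell R (h m)) x * ?H x \<partial>lborel) / h m - ?c m * ?K) 0 < e"
    proof eventually_elim
      case (elim m)
      have pt: "norm (indicator (shell R (h m)) x * ?H x - indicator (shell R (h m)) x * ?k x)
          \<le> d * (indicator (shell R (h m)) x * (1 :: real))" for x :: "real ^ 'n"
      proof (cases "x \<in> shell R (h m)")
        case True
        then have "x \<noteq> 0" "R < norm x" "norm x < R + h m" using R by auto
        have "x - R *\<^sub>R sgn x = (norm x - R) *\<^sub>R sgn x"
          using \<open>x \<noteq> 0\<close> by (simp add: sgn_div_norm algebra_simps)
        then have "dist x (R *\<^sub>R sgn x) = norm x - R"
          using \<open>x \<noteq> 0\<close> \<open>R < norm x\<close> by (simp add: dist_norm norm_sgn)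
        then have "dist (Z x) (Z (R *\<^sub>R sgn x)) < d"
          using \<open>norm x < R + h m\<close> elim(1) h(2)[of m] R by (intro \<delta>(2)) (auto simp: norm_sgn)
        then have "\<bar>Z x - Z (R *\<^sub>R sgn x)\<bar> * \<bar>sgn x $ i\<bar> \<le> d * 1"
          using comp[of x] by (intro mult_mono) (auto simp: dist_real_def)
        then show ?thesis using True by (simp add: abs_mult[symmetric] algebra_simps)
      qed simp
      have "\<bar>(\<integral>x. indicator (shell R (h m)) x * ?H x \<partial>lborel) - (\<integral>x. indicator (shell R (h m)) x * ?k x \<partial>lborel)\<bar>
        \<le> (\<integral>x. d * (indicator (shell R (h m) :: (real ^ 'n) set) x * (1 :: real)) \<partial>lborel)"
        unfolding Bochner_Integration.integral_diff[OF intH intk, symmetric] real_norm_def[symmetric]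
        by (rule order_trans[OF integral_norm_bound integral_mono])
          (use intH[of m] intk[of m] int1[of m] pt in \<open>auto simp del: mult_1_right\<close>)
      then have "\<bar>(\<integral>x. indicator (shell R (h m)) x * ?H x \<partial>lborel) - (\<integral>x. indicator (shell R (h m)) x * ?k x \<partial>lborel)\<bar> / h m
        \<le> d * (\<integral>x. indicator (shell R (h m) :: (real ^ 'n) set) x * (1 :: real) \<partial>lborel) / h m"
        using h(1)[of m] by (intro divide_right_mono) auto
      also have "\<dots> = d * (?c m * v)" unfolding v_shell[symmetric] by simp
      also have "\<dots> \<le> d * (L + 1)" using elim(2) d by (intro mult_left_mono) auto
      also have "\<dots> = e / 2"
      proof -
        have "L + 1 \<noteq> 0" using L by linarith
        then show ?thesis by (simp add: d_def field_simps)
      qed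
      also have "\<dots> < e" using e by simp
      finally have "\<bar>((\<integral>x. indicator (shell R (h m)) x * ?H x \<partial>lborel) - (\<integral>x. indicator (shell R (h m)) x * ?k x \<partial>lborel)) / h m\<bar> < e"
        using h(1)[of m] by simp
      then show ?case
        unfolding k_shell[symmetric] by (simp add: diff_divide_distrib dist_real_def)
    qed
  qed
  have "(\<lambda>m. ((\<integral>x. indicator (shell R (h m)) x * ?H x \<partial>lborel) / h m - ?c m * ?K) + ?c m * ?K)
      \<longlonglongrightarrow> 0 + real ?n * R ^ (?n - 1) * ?K"
    by (intro tendsto_add diff tendsto_mult c tendsto_const)
  then show ?thesis by (simp add: h_def)
qed

text \<open>The right-hand side is the Euclidean flux through the sphere of radius \<open>R\<close>,
  written with the cone measure of the unit sphere.\<close>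

lemma divergence_ball:
  fixes Z :: "'n::finite \<Rightarrow> real ^ 'n \<Rightarrow> real"
  assumes Z: "\<And>i. smooth_fun (Z i)" and R: "R > 0"
  shows "(\<integral>x. indicator (cball 0 R) x * (\<Sum>i\<in>UNIV. pd i (Z i) x) \<partial>lborel)
    = real CARD('n) * R ^ (CARD('n) - 1)
      * (\<integral>x. indicator (cball 0 1) x * (\<Sum>i\<in>UNIV. Z i (R *\<^sub>R sgn x) * sgn x $ i) \<partial>lborel)"
proof -
  define h where "h m = inverse (real (Suc m))" for m
  have h: "0 < h m" "h m \<le> 1" for m
    by (simp_all add: h_def inverse_eq_divide)
  have h0: "h \<longlonglongrightarrow> 0" unfolding h_def using LIMSEQ_inverse_real_of_nat .
  have comp: "(\<integral>x. indicator (cball 0 R) x * pd i (Z i) x \<partial>lborel)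
    = real CARD('n) * R ^ (CARD('n) - 1) * (\<integral>x. indicator (cball 0 1) x * (Z i (R *\<^sub>R sgn x) * sgn x $ i) \<partial>lborel)" for i
  \<comment> \<open>Both sides are limits of the integrals of \<open>cutoff\<close> times the
    derivative as the shell thickness tends to 0: one by dominated convergence, the other by parts
    and averaging over the shell.\<close>
  proof (rule LIMSEQ_unique)
    show "(\<lambda>m. \<integral>x. cutoff R (h m) x * pd i (Z i) x \<partial>lborel) \<longlonglongrightarrow> (\<integral>x. indicator (cball 0 R) x * pd i (Z i) x \<partial>lborel)"
    proof (rule integral_dominated_convergence[where w = "\<lambda>x. indicator (cball 0 (R + 1)) x *\<^sub>R \<bar>pd i (Z i) x\<bar>"])
      have m [measurable]: "pd i (Z i) \<in> borel_measurable borel"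
        by (intro borel_measurable_continuous_onI smooth_continuous smooth_intros Z)
      show "(\<lambda>x. indicator (cball 0 R) x * pd i (Z i) x) \<in> borel_measurable lborel"
        using m by (intro borel_measurable_times borel_measurable_indicator) simp_all
      show "(\<lambda>x. cutoff R (h m) x * pd i (Z i) x) \<in> borel_measurable lborel" for m
        using integral_partial_cutoff(2)[OF Z R h(1)] by (rule borel_measurable_integrable)
      show "integrable lborel (\<lambda>x. indicator (cball 0 (R + 1)) x *\<^sub>R \<bar>pd i (Z i) x\<bar>)"
        by (intro borel_integrable_compact compact_cball continuous_intros smooth_continuous smooth_intros Z)
      show "AE x in lborel. (\<lambda>m. cutoff R (h m) x * pd i (Z i) x) \<longlonglongrightarrow> indicator (cball 0 R) x * pd i (Z i) x"
      proof (intro AE_I2 tendsto_mult tendsto_const)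
        fix x :: "real ^ 'n"
        show "(\<lambda>m. cutoff R (h m) x) \<longlonglongrightarrow> indicator (cball 0 R) x"
        proof (cases "norm x \<le> R")
          case True
          then show ?thesis using h by (simp add: cutoff_inside)
        next
          case False
          then have "norm x - R > 0" by simp
          from order_tendstoD(2)[OF h0 this]
          have "\<forall>\<^sub>F m in sequentially. cutoff R (h m) x = 0"
            by eventually_elim (use h in \<open>simp add: cutoff_outside\<close>)
          then show ?thesis using False by (simp add: tendsto_eventually)
        qed
      qed
      show "AE x in lborel. norm (cutoff R (h m) x * pd i (Z i) x) \<le> indicator (cball 0 (R + 1)) x *\<^sub>R \<bar>pd i (Z i) x\<bar>" for m
      proof (rule AE_I2)
        fix x :: "real ^ 'n"
        show "norm (cutoff R (h m) x * pd i (Z i) x) \<le> indicator (cball 0 (R + 1)) x *\<^sub>R \<bar>pd i (Z i) x\<bar>"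
        proof (cases "norm x \<le> R + 1")
          case True
          then show ?thesis using cutoff_bounds[of R "h m" x] by (simp add: abs_mult mult_left_le_one_le)
        next
          case False
          then have "cutoff R (h m) x = 0" using h[of m] by (intro cutoff_outside) auto
          then show ?thesis by simp
        qed
      qed
    qed
    show "(\<lambda>m. \<integral>x. cutoff R (h m) x * pd i (Z i) x \<partial>lborel) \<longlonglongrightarrow>
       real CARD('n) * R ^ (CARD('n) - 1) * (\<integral>x. indicator (cball 0 1) x * (Z i (R *\<^sub>R sgn x) * sgn x $ i) \<partial>lborel)"
      unfolding integral_partial_cutoff(1)[OF Z R h(1)]
      unfolding h_def by (rule shell_average_limit[OF smooth_continuous[OF Z] R])
  qed
  have int1: "integrable lborel (\<lambda>x. indicator (cball 0 R) x * pd i (Z i) x)" for i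
    using borel_integrable_compact[OF compact_cball smooth_continuous[OF smooth_pd[OF Z]], of 0 R i i] by simp
  have int2: "integrable lborel (\<lambda>x. indicator (cball 0 1) x * (Z i (R *\<^sub>R sgn x) * sgn x $ i))" for i
  proof -
    have [measurable]: "Z i \<in> borel_measurable borel"
      by (intro borel_measurable_continuous_onI smooth_continuous Z)
    have [measurable]: "(sgn :: real ^ 'n \<Rightarrow> _) \<in> borel_measurable borel"
      by (simp add: sgn_div_norm[abs_def])
    have [measurable]: "(\<lambda>x :: real ^ 'n. sgn x $ i) \<in> borel_measurable borel"
      by (simp add: sgn_div_norm)
    obtain M where M: "M \<ge> 0" "\<And>x. norm x \<le> R \<Longrightarrow> \<bar>Z i x\<bar> \<le> M"
      using continuous_bounded_on_cball[OF smooth_continuous[OF Z]] by metis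
    show ?thesis
    proof (rule integrable_bounded_set[where r = 1 and M = M])
      fix x :: "real ^ 'n"
      have "\<bar>Z i (R *\<^sub>R sgn x)\<bar> \<le> M" by (rule M) (use R in \<open>simp add: norm_sgn\<close>)
      moreover have "\<bar>sgn x $ i\<bar> \<le> 1"
        using component_le_norm_cart[of "sgn x" i] norm_sgn[of x] by (simp split: if_splits)
      ultimately show "\<bar>Z i (R *\<^sub>R sgn x) * sgn x $ i\<bar> \<le> M"
        using M(1) mult_mono[of "\<bar>Z i (R *\<^sub>R sgn x)\<bar>" M "\<bar>sgn x $ i\<bar>" 1] by (simp add: abs_mult)
    qed auto
  qed
  show ?thesis
    unfolding sum_distrib_left
    by (simp only: Bochner_Integration.integral_sum[OF int1] Bochner_Integration.integral_sum[OF int2] comp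
        sum_distrib_left)
qed

section \<open>Integrals over geodesic spheres as integrals over the unit ball\<close>

lemma integral_sphere_measure:
  fixes G :: "real ^ 'n::finite \<Rightarrow> real"
  assumes "G \<in> borel_measurable borel"
  shows "integral\<^sup>L sphere_measure G = real CARD('n) * (\<integral>x. indicator (cball 0 1) x * G (sgn x) \<partial>lborel)"
proof -
  let ?R = "restrict_space lborel (cball (0 :: real ^ 'n) 1)"
  have [measurable]: "sgn \<in> measurable ?R borel"
    by (intro measurable_restrict_space1) (simp add: sgn_div_norm[abs_def])
  show ?thesis
    unfolding sphere_measure_def using assms
    by (subst integral_density) (simp_all add: integral_distr integral_restrict_space)
qed

text \<open>For \<open>R = sinh r\<close> the prefactor agrees with the one in
  \<open>divergence_ball\<close>.\<close>

lemma integral_geod_sphere_measure: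
  fixes G :: "real ^ 'n::finite \<Rightarrow> real"
  assumes [measurable]: "G \<in> borel_measurable borel" and r: "r \<ge> 0"
  shows "integral\<^sup>L (geod_sphere_measure r) G
    = real CARD('n) * sinh r ^ (CARD('n) - 1) * (\<integral>x. indicator (cball 0 1) x * G (sinh r *\<^sub>R sgn x) \<partial>lborel)"
proof -
  have s: "sets (sphere_measure :: (real ^ 'n) measure) = sets borel"
    by (simp add: sphere_measure_def)
  have m: "(\<lambda>\<theta> :: real ^ 'n. sinh r *\<^sub>R \<theta>) \<in> sphere_measure \<rightarrow>\<^sub>M borel"
    by (subst measurable_cong_sets[OF s refl]) measurable
  show ?thesis
    unfolding geod_sphere_measure_def using assms m
    by (subst integral_density) (simp_all add: integral_distr integral_sphere_measure)
qed

section \<open>The mass of a graph\<close>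

text \<open>The flat second derivatives of \<open>V\<close> give \<open>b / V\<close>, and the
  connection adds \<open>|y|^2 / V\<close> times \<open>b\<close>, with
  \<open>|y|^2 = V^2 - 1\<close>.\<close>

lemma V0_static: "(V0 :: real ^ 'n::finite \<Rightarrow> real) \<in> static_potentials"
proof -
  have "hessian hyp_metric V0 x [i, j] = V0 x * hyp_metric x $ i $ j" for x :: "real ^ 'n" and i j
  proof -
    have "hessian hyp_metric V0 x [i, j]
        = pd i (pd j V0) x - (\<Sum>m\<in>UNIV. christoffel hyp_metric m i j x * pd m V0 x)"
      by (simp add: hessian_def cov_deriv_def tensor0_def[abs_def])
    also have "(\<Sum>m\<in>UNIV. christoffel hyp_metric m i j x * pd m V0 x)
        = - (hyp_metric x $ i $ j / V0 x) * (\<Sum>m\<in>UNIV. x $ m * x $ m)"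
      unfolding sum_distrib_left by (intro sum.cong refl) (simp add: christoffel_hyp pd_V0)
    also have "(\<Sum>m\<in>UNIV. x $ m * x $ m) = V0 x * V0 x - 1" by (simp add: V0_sq)
    finally show ?thesis by (simp add: pd_pd_V0 field_simps)
  qed
  then show ?thesis by (simp add: static_potentials_def smooth_V0)
qed

text \<open>Evaluation at the origin, where all \<open>Vi\<close> vanish, and at the unit vectors
  determines the coefficients. This uniqueness makes the definite description in
  \<open>lorentz\<close> meaningful at \<open>V0\<close>.\<close>

lemma V0_coordinates:
  assumes "V0 = (\<lambda>x :: real ^ 'n::finite. a0 * V0 x + (\<Sum>i\<in>UNIV. a i * Vi i x))"
  shows "a0 = 1" "a i = 0"
proof -
  have eq: "V0 x = a0 * V0 x + (\<Sum>i\<in>UNIV. a i * x $ i)" for x :: "real ^ 'n"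
    using fun_cong[OF assms, of x] by (simp add: Vi_eq)
  show a0: "a0 = 1" using eq[of 0] by (simp add: V0_eq)
  have "(\<Sum>j\<in>UNIV. a j * axis i 1 $ j) = (\<Sum>j\<in>UNIV. if j = i then a j else 0)"
    by (intro sum.cong refl) (simp add: axis_def)
  then show "a i = 0" using eq[of "axis i 1"] a0 by simp
qed

lemma lorentz_V0: "lorentz V0 (V0 :: real ^ 'n::finite \<Rightarrow> real) = 1"
  unfolding lorentz_def
proof (rule the_equality)
  show "\<exists>a0 b0 (a :: 'n \<Rightarrow> real) b.
      V0 = (\<lambda>x. a0 * V0 x + (\<Sum>i\<in>UNIV. a i * Vi i x)) \<and>
      V0 = (\<lambda>x. b0 * V0 x + (\<Sum>i\<in>UNIV. b i * Vi i x)) \<and>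
      1 = a0 * b0 - (\<Sum>i\<in>UNIV. a i * b i)"
    by (rule exI[of _ 1], rule exI[of _ 1], rule exI[of _ "\<lambda>_. 0"], rule exI[of _ "\<lambda>_. 0"]) simp
next
  fix c
  assume "\<exists>a0 b0 (a :: 'n \<Rightarrow> real) b.
      V0 = (\<lambda>x. a0 * V0 x + (\<Sum>i\<in>UNIV. a i * Vi i x)) \<and>
      V0 = (\<lambda>x. b0 * V0 x + (\<Sum>i\<in>UNIV. b i * Vi i x)) \<and>
      c = a0 * b0 - (\<Sum>i\<in>UNIV. a i * b i)"
  then obtain a0 b0 and a b :: "'n \<Rightarrow> real"
    where a: "V0 = (\<lambda>x. a0 * V0 x + (\<Sum>i\<in>UNIV. a i * Vi i x))"
      and b: "V0 = (\<lambda>x. b0 * V0 x + (\<Sum>i\<in>UNIV. b i * Vi i x))"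
      and c: "c = a0 * b0 - (\<Sum>i\<in>UNIV. a i * b i)" by blast
  show "c = 1" by (simp add: c V0_coordinates[OF a] V0_coordinates[OF b])
qed

lemma V0_admissible: "V0 \<in> admissible_potentials"
  by (simp add: admissible_potentials_def V0_static lorentz_V0)

lemma mass_const_nonneg: "mass_const N k \<ge> 0"
  by (simp add: mass_const_def sphere_volume_def)

section \<open>The flux through geodesic spheres and its limit\<close>

context smooth_graph
begin

lemma smooth_mod_L: "smooth_fun (mod_L k (graph_metric f))"
  unfolding mod_L_graph[abs_def] by (intro smooth_intros)

text \<open>In the chart the geodesic sphere of radius \<open>r\<close> is the Euclidean sphere of
  radius \<open>sinh r\<close>, with the same area element; so the Euclidean divergence theorem
  applies directly, with equality at every radius.\<close>

lemma mass_flux_eq: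
  assumes "k \<ge> 1" "r > 0"
  shows "mass_flux k (graph_metric f) V0 r
    = 1 / 2 * (\<integral>x. indicator (cball 0 (sinh r)) x * mod_L k (graph_metric f) x \<partial>lborel)"
proof -
  obtain m where m: "k = Suc m" using assms by (cases k) auto
  let ?Z = "minor_field (2 * m + 2) (2 * m) (gauss_map f)"
  have sm: "smooth_fun (?Z i)" for i by (intro smooth_intros)
  have "mass_flux k (graph_metric f) V0 r
      = (\<integral>x. 1 / 2 * (\<Sum>i\<in>UNIV. ?Z i x * sgn x $ i) \<partial>geod_sphere_measure r)"
  proof -
    have "(\<Sum>i\<in>UNIV. \<Sum>j\<in>UNIV. \<Sum>l\<in>UNIV. \<Sum>s\<in>UNIV.
        (V0 x * cov_deriv hyp_metric (tensor2 (\<lambda>y. graph_metric f y - hyp_metric y)) x [s, j, l]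
          - tensor2 (\<lambda>y. graph_metric f y - hyp_metric y) x [j, l] * pd s V0 x)
        * mod_P k (graph_metric f) i j l s x * normal_cov i x)
      = 1 / 2 * (\<Sum>i\<in>UNIV. ?Z i x * sgn x $ i)" for x
      unfolding m sum_distrib_right[symmetric] flux_integrand
      unfolding sum_distrib_left by (intro sum.cong refl) (simp add: normal_cov_eq)
    then show ?thesis by (simp only: mass_flux_def Let_def)
  qed
  also have "\<dots> = real CARD('n) * sinh r ^ (CARD('n) - 1) * (\<integral>x. indicator (cball 0 1) x *
      (1 / 2 * (\<Sum>i\<in>UNIV. ?Z i (sinh r *\<^sub>R sgn x) * sgn (sinh r *\<^sub>R sgn x) $ i)) \<partial>lborel)"
  proof (rule integral_geod_sphere_measure)
    have "?Z i \<in> borel_measurable borel" for i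
      by (intro borel_measurable_continuous_onI smooth_continuous sm)
    moreover have "(\<lambda>x :: real ^ 'n. sgn x $ i) \<in> borel_measurable borel" for i
      by (simp add: sgn_div_norm)
    ultimately show "(\<lambda>x. 1 / 2 * (\<Sum>i\<in>UNIV. ?Z i x * sgn x $ i)) \<in> borel_measurable borel"
      by (intro borel_measurable_times borel_measurable_sum) simp_all
  qed (use assms in simp)
  also have "\<dots> = 1 / 2 * (real CARD('n) * sinh r ^ (CARD('n) - 1) * (\<integral>x. indicator (cball 0 1) x *
      (\<Sum>i\<in>UNIV. ?Z i (sinh r *\<^sub>R sgn x) * sgn x $ i) \<partial>lborel))"
  proof -
    have "sgn (sgn x) = sgn x" for x :: "real ^ 'n"
      by (simp add: sgn_div_norm[of "sgn x"] norm_sgn)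
    then show ?thesis using assms by (simp add: sgn_scaleR)
  qed
  also have "real CARD('n) * sinh r ^ (CARD('n) - 1) * (\<integral>x. indicator (cball 0 1) x *
      (\<Sum>i\<in>UNIV. ?Z i (sinh r *\<^sub>R sgn x) * sgn x $ i) \<partial>lborel)
    = (\<integral>x. indicator (cball 0 (sinh r)) x * (\<Sum>i\<in>UNIV. pd i (?Z i) x) \<partial>lborel)"
    using assms by (intro divergence_ball[symmetric] sm) simp
  also have "(\<lambda>x. \<Sum>i\<in>UNIV. pd i (?Z i) x) = mod_L k (graph_metric f)"
    by (simp add: fun_eq_iff minor_field_divergence smooth_gauss_map mod_L_graph m)
  finally show ?thesis .
qed

lemma integral_riem_vol:
  assumes "G \<in> borel_measurable borel"
  shows "integral\<^sup>L (riem_vol (graph_metric f)) G = (\<integral>x. slope f x / V0 x * G x \<partial>lborel)"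
    and "integrable (riem_vol (graph_metric f)) G \<longleftrightarrow> integrable lborel (\<lambda>x. slope f x / V0 x * G x)"
proof -
  have s: "sqrt (det (graph_metric f x)) = slope f x / V0 x" for x
    unfolding det_graph_metric using slope_pos[of f x] V0_pos[of x] by (simp add: less_imp_le)
  have m: "(\<lambda>x. slope f x / V0 x) \<in> borel_measurable lborel"
    using borel_measurable_continuous_onI[OF smooth_continuous[OF smooth_divide[OF smooth_slope smooth_V0 V0_nonzero]]]
    by simp
  have nn: "AE x in lborel. 0 \<le> slope f x / V0 x"
    by (intro AE_I2 divide_nonneg_nonneg less_imp_le slope_pos V0_pos)
  have G: "G \<in> borel_measurable lborel" using assms by simp
  show "integral\<^sup>L (riem_vol (graph_metric f)) G = (\<integral>x. slope f x / V0 x * G x \<partial>lborel)"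
    unfolding riem_vol_def s integral_density[OF G m nn] by simp
  show "integrable (riem_vol (graph_metric f)) G \<longleftrightarrow> integrable lborel (\<lambda>x. slope f x / V0 x * G x)"
    unfolding riem_vol_def s integrable_density[OF G m nn] by simp
qed

text \<open>The volume element is \<open>slope / V\<close> times Lebesgue measure, so the hypothesis
  says that \<open>slope * mod_L\<close> is Lebesgue integrable. As \<open>slope\<close> is at least
  1, so is \<open>mod_L\<close>, and dominated convergence applies to the exhausting balls.\<close>

lemma mass_flux_limit:
  assumes "k \<ge> 1" "integrable (riem_vol (graph_metric f)) (\<lambda>x. V0 x * mod_L k (graph_metric f) x)"
  shows "(mass_flux k (graph_metric f) V0 \<longlongrightarrow> 1 / 2 * (\<integral>x. mod_L k (graph_metric f) x \<partial>lborel)) at_top"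
proof -
  let ?L = "mod_L k (graph_metric f)"
  have L: "?L \<in> borel_measurable borel" and VL: "(\<lambda>x. V0 x * ?L x) \<in> borel_measurable borel"
    by (intro borel_measurable_continuous_onI smooth_continuous smooth_mod_L smooth_mult smooth_V0)+
  have "integrable lborel (\<lambda>x. slope f x * ?L x)"
    using assms(2) unfolding integral_riem_vol(2)[OF VL] by simp
  then have int: "integrable lborel ?L"
  proof (rule Bochner_Integration.integrable_bound)
    show "AE x in lborel. norm (?L x) \<le> norm (slope f x * ?L x)"
    proof (rule AE_I2)
      fix x
      have "1 * \<bar>?L x\<bar> \<le> slope f x * \<bar>?L x\<bar>" by (intro mult_right_mono slope_ge_1) simp
      then show "norm (?L x) \<le> norm (slope f x * ?L x)"
        by (simp add: abs_mult abs_of_pos[OF slope_pos])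
    qed
  qed (use L in simp)
  have "((\<lambda>r. \<integral>x. indicator (cball 0 (sinh r)) x * ?L x \<partial>lborel) \<longlongrightarrow> integral\<^sup>L lborel ?L) at_top"
  proof (rule integral_dominated_convergence_at_top[where w = "\<lambda>x. \<bar>?L x\<bar>"])
    show "?L \<in> borel_measurable lborel" using L by simp
    show "(\<lambda>x. indicator (cball 0 (sinh r)) x * ?L x) \<in> borel_measurable lborel" for r
      using L by (intro borel_measurable_times borel_measurable_indicator) simp_all
    show "\<forall>\<^sub>F r in at_top. AE x in lborel. norm (indicator (cball 0 (sinh r)) x * ?L x) \<le> \<bar>?L x\<bar>"
      by (intro always_eventually allI AE_I2) (simp add: indicator_def)
    show "AE x in lborel. ((\<lambda>r. indicator (cball 0 (sinh r)) x * ?L x) \<longlongrightarrow> ?L x) at_top"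
    proof (rule AE_I2)
      fix x :: "real ^ 'n"
      have "\<forall>\<^sub>F r :: real in at_top. norm x \<le> sinh r"
        using sinh_real_at_top by (rule filterlim_at_top[THEN iffD1, rule_format])
      then have "\<forall>\<^sub>F r in at_top. indicator (cball 0 (sinh r)) x * ?L x = ?L x"
        by eventually_elim simp
      then show "((\<lambda>r. indicator (cball 0 (sinh r)) x * ?L x) \<longlongrightarrow> ?L x) at_top"
        by (rule tendsto_eventually)
    qed
  qed (use int in simp)
  then have "((\<lambda>r. 1 / 2 * (\<integral>x. indicator (cball 0 (sinh r)) x * ?L x \<partial>lborel)) \<longlongrightarrow> 1 / 2 * integral\<^sup>L lborel ?L) at_top"
    by (intro tendsto_mult tendsto_const)
  moreover have "\<forall>\<^sub>F r in at_top. mass_flux k (graph_metric f) V0 r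
      = 1 / 2 * (\<integral>x. indicator (cball 0 (sinh r)) x * ?L x \<partial>lborel)"
    using eventually_gt_at_top[of "0 :: real"] by eventually_elim (rule mass_flux_eq[OF assms(1)])
  ultimately show ?thesis by (simp only: tendsto_cong)
qed

lemma graph_integral:
  "(\<integral>x. 1 / 2 * (V0 x * mod_L k (graph_metric f) x / sqrt (1 + (V0 x)\<^sup>2 * hyp_grad_sq f x)) \<partial>riem_vol (graph_metric f))
    = 1 / 2 * (\<integral>x. mod_L k (graph_metric f) x \<partial>lborel)"
proof -
  have m: "(\<lambda>x. 1 / 2 * (V0 x * mod_L k (graph_metric f) x / slope f x)) \<in> borel_measurable borel"
    by (intro borel_measurable_continuous_onI smooth_continuous smooth_mod_L smooth_intros slope_nonzero)
  show ?thesis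
    unfolding slope_def[symmetric] integral_riem_vol(1)[OF m] by simp
qed

end

text \<open>Convergence of the flux is part of the conclusion because \<open>Lim\<close> denotes a
  value even where no limit exists. The hypothesis \<open>inf_attained\<close> is the standing
  convention that the infimum is achieved by \<open>cosh r\<close>.\<close>

theorem theorem1p3:
  fixes f :: "real ^ 'n::finite \<Rightarrow> real" and g :: "'n metric" and k :: nat and \<tau> :: real
  assumes graph: "g = graph_metric f"
    and k: "2 \<le> k" "2 * k < CARD('n)"
    and smooth: "smooth_fun f"
    and ah: "asymp_hyperbolic \<tau> g"
    and decay: "\<tau> > real CARD('n) / real (k + 1)"
    and int: "integrable (riem_vol g) (\<lambda>x. V0 x * mod_L k g x)"
    and inf_attained: "\<forall>V\<in>admissible_potentials. mass_functional k g V0 \<le> mass_functional k g V"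
  shows "(mass_flux k g V0 \<longlongrightarrow> mass_functional k g V0) at_top \<and>
    gbc_mass k g = mass_const TYPE('n) k *
      (\<integral>x. 1 / 2 * (V0 x * mod_L k g x / sqrt (1 + (V0 x)\<^sup>2 * hyp_grad_sq f x)) \<partial>riem_vol g) \<and>
    ((\<forall>x. mod_L k g x \<ge> 0) \<longrightarrow> gbc_mass k g \<ge> 0)"
proof -
  interpret smooth_graph f by unfold_locales (rule smooth)
  have lim: "(mass_flux k g V0 \<longlongrightarrow> 1 / 2 * (\<integral>x. mod_L k g x \<partial>lborel)) at_top"
    using mass_flux_limit[of k] k int unfolding graph by simp
  then have func: "mass_functional k g V0 = 1 / 2 * (\<integral>x. mod_L k g x \<partial>lborel)"
    unfolding mass_functional_def by (intro tendsto_Lim) simp_all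
  \<comment> \<open>As \<open>V0\<close> is itself admissible, the infimum is a minimum, and only
    its functional has to be known.\<close>
  have "(INF V\<in>admissible_potentials. mass_functional k g V) = mass_functional k g V0"
    using V0_admissible inf_attained by (intro cInf_eq_minimum) auto
  then have mass: "gbc_mass k g = mass_const TYPE('n) k * (1 / 2 * (\<integral>x. mod_L k g x \<partial>lborel))"
    by (simp only: gbc_mass_def func)
  have "gbc_mass k g \<ge> 0" if "\<forall>x. mod_L k g x \<ge> 0"
    unfolding mass using that by (intro mult_nonneg_nonneg mass_const_nonneg integral_nonneg_AE) auto
  with lim show ?thesis
    unfolding mass func using graph_integral[of k] by (simp only: graph) simp
qed

end
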